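(* Let $K$ be a real closed field and let $\mathfrak{a}\subseteq K[X_1,\ldots,X_n]$ be an ideal. Then $\mathrm{I}_K(\mathrm{V}_K(\mathfrak{a}))=\mathrm{r}\text{-}\sqrt{\mathfrak{a}}$, where $\mathrm{r}\text{-}\sqrt{\mathfrak{a}}$ denotes the real radical of $\mathfrak{a}$.
   Context: A commutative ring $A$ is called real if for all $a_1,\ldots,a_m\in A$, $a_1^2+\cdots+a_m^2=0$ implies $a_1=\cdots=a_m=0$. A real closed field is a real field with no nontrivial algebraic extension that is real. A prime ideal $\mathfrak{p}$ of a ring $A$ is called real if $A/\mathfrak{p}$ is real (equivalently its quotient field is real). The real radical $\mathrm{r}\text{-}\sqrt{\mathfrak{a}}$ of an ideal $\mathfrak{a}\subseteq A$ is the intersection of all real prime ideals of $A$ containing $\mathfrak{a}$ (equal to $A$ if there are none). $\mathrm{V}_K(\mathfrak{a}):=\{a\in K^n\mid f(a)=0\text{ for all }f\in\mathfrak{a}\}$, and for $W\subseteq K^n$, $\mathrm{I}_K(W):=\{f\in K[X_1,\ldots,X_n]\mid f(a)=0\text{ for all }a\in W\}$. *)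

theory Defs
  imports
    "HOL-Algebra.Algebra"
    "HOL-Algebra.Algebraic_Closure_Type"
    "HOL-Library.Poly_Mapping"
begin

section \<open>Real rings, real closed fields, real radicals\<close>

definition real_ring :: "('a, 'b) ring_scheme \<Rightarrow> bool" where
  "real_ring A \<longleftrightarrow> cring A \<and>
     (\<forall>m::nat. \<forall>a \<in> {..<m} \<rightarrow> carrier A.
        (\<Oplus>\<^bsub>A\<^esub>i\<in>{..<m}. a i \<otimes>\<^bsub>A\<^esub> a i) = \<zero>\<^bsub>A\<^esub> \<longrightarrow> (\<forall>i<m. a i = \<zero>\<^bsub>A\<^esub>))"

text \<open>
  A field extension is a field \<open>L\<close> with an embedding \<open>h\<close> of \<open>K\<close> into \<open>L\<close>; it is nontrivial
  iff \<open>h\<close> is not onto.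

  HOL cannot quantify over the type of the elements of \<open>L\<close> inside a definition, so one type has to
  be chosen. No algebraic extension is lost by this choice: an algebraic extension of an infinite
  field (and real fields have characteristic 0) has the same cardinality as the field, so it is
  isomorphic over \<open>K\<close> to one whose carrier is a subset of \<^typ>\<open>'a list set\<close>, and even of
  \<^typ>\<open>'a\<close>. The type \<^typ>\<open>'a list set\<close> is that of the library's \<open>K[X]/(p)\<close>
  (\<^const>\<open>rupture\<close>).
\<close>
definition real_closed_field :: "'a ring \<Rightarrow> bool" where
  "real_closed_field K \<longleftrightarrow> field K \<and> real_ring K \<and>
     (\<forall>(L :: 'a list set ring) h.
        field L \<and> h \<in> ring_hom K L \<and>
        (\<forall>x\<in>carrier L. (ring.algebraic L over (h ` carrier K)) x) \<and>
        real_ring L \<longrightarrow> h ` carrier K = carrier L)"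

definition real_prime_ideal :: "'a set \<Rightarrow> ('a, 'b) ring_scheme \<Rightarrow> bool" where
  "real_prime_ideal P A \<longleftrightarrow> primeideal P A \<and> real_ring (A Quot P)"

text \<open>The intersection with the carrier only matters if there is no such \<open>P\<close>.\<close>
definition real_radical :: "('a, 'b) ring_scheme \<Rightarrow> 'a set \<Rightarrow> 'a set" where
  "real_radical A I = carrier A \<inter> \<Inter>{P. real_prime_ideal P A \<and> I \<subseteq> P}"


section \<open>Polynomials in \<open>n\<close> variables and their zeros\<close>

text \<open>
  A polynomial over \<^typ>\<open>'k\<close> in variables indexed by all natural numbers maps exponent vectors to
  coefficients, both with finite support; its multiplication is convolution. The ring
  \<open>K[X\<^sub>1,\<dots>,X\<^sub>n]\<close> consists of those that only involve the variables with index below \<open>n\<close>.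
\<close>
type_synonym 'k mpolynomial = "(nat \<Rightarrow>\<^sub>0 nat) \<Rightarrow>\<^sub>0 'k"

definition mpoly_ring :: "nat \<Rightarrow> ('k::field) mpolynomial ring" where
  "mpoly_ring n = ring_of_type_algebra
     \<lparr>carrier := {f. \<forall>\<mu> \<in> Poly_Mapping.keys f. Poly_Mapping.keys \<mu> \<subseteq> {..<n}}\<rparr>"

definition mpoly_eval :: "('k::field) mpolynomial \<Rightarrow> (nat \<Rightarrow> 'k) \<Rightarrow> 'k" where
  "mpoly_eval f x =
     (\<Sum>\<mu> \<in> Poly_Mapping.keys f.
        Poly_Mapping.lookup f \<mu> *
        (\<Prod>i \<in> Poly_Mapping.keys \<mu>. x i ^ Poly_Mapping.lookup \<mu> i))"

definition affine_space :: "nat \<Rightarrow> (nat \<Rightarrow> 'k) set" where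
  "affine_space n = {..<n} \<rightarrow>\<^sub>E UNIV"

definition zero_locus :: "nat \<Rightarrow> ('k::field) mpolynomial set \<Rightarrow> (nat \<Rightarrow> 'k) set" where
  "zero_locus n I = {x \<in> affine_space n. \<forall>f\<in>I. mpoly_eval f x = 0}"

definition vanishing_ideal :: "nat \<Rightarrow> (nat \<Rightarrow> 'k) set \<Rightarrow> ('k::field) mpolynomial set" where
  "vanishing_ideal n W = {f \<in> carrier (mpoly_ring n). \<forall>x\<in>W. mpoly_eval f x = 0}"

lemma mpoly_ring_cring: "cring (mpoly_ring n :: ('k::field) mpolynomial ring)"
proof -
  interpret R: cring "ring_of_type_algebra :: 'k mpolynomial ring"
    by (rule cring_from_type_algebra)
  let ?C = "{f :: 'k mpolynomial. \<forall>\<mu> \<in> Poly_Mapping.keys f. Poly_Mapping.keys \<mu> \<subseteq> {..<n}}"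
  have minus: "\<ominus>\<^bsub>ring_of_type_algebra\<^esub> f = - f" for f :: "'k mpolynomial"
    by (rule R.minus_equality) (auto simp: ring_of_type_algebra_def)
  have mult: "f * g \<in> ?C" if "f \<in> ?C" "g \<in> ?C" for f g
  proof -
    have "Poly_Mapping.keys \<mu> \<subseteq> {..<n}" if \<mu>: "\<mu> \<in> Poly_Mapping.keys (f * g)" for \<mu>
    proof -
      obtain a b where "\<mu> = a + b" "a \<in> Poly_Mapping.keys f" "b \<in> Poly_Mapping.keys g"
        using keys_mult[of f g] \<mu> by blast
      then show ?thesis
        using Poly_Mapping.keys_add[of a b] \<open>f \<in> ?C\<close> \<open>g \<in> ?C\<close> by blast
    qed
    then show ?thesis by simp
  qed
  have add: "f + g \<in> ?C" if "f \<in> ?C" "g \<in> ?C" for f g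
    using Poly_Mapping.keys_add[of f g] that by blast
  have neg: "- f \<in> ?C" if "f \<in> ?C" for f
    using that by simp
  have one: "1 \<in> ?C"
    by simp
  have carrier: "?C \<subseteq> carrier ring_of_type_algebra"
    by (simp add: ring_of_type_algebra_def)
  have "subring ?C (ring_of_type_algebra :: 'k mpolynomial ring)"
  proof (rule R.subringI[OF carrier])
    show "\<one>\<^bsub>ring_of_type_algebra\<^esub> \<in> ?C"
      using one unfolding ring_of_type_algebra_def ring_record_simps .
    show "\<ominus>\<^bsub>ring_of_type_algebra\<^esub> f \<in> ?C" if "f \<in> ?C" for f
      unfolding minus using that by (rule neg)
    show "f \<otimes>\<^bsub>ring_of_type_algebra\<^esub> g \<in> ?C" if "f \<in> ?C" "g \<in> ?C" for f g
      using mult[OF that] unfolding ring_of_type_algebra_def ring_record_simps .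
    show "f \<oplus>\<^bsub>ring_of_type_algebra\<^esub> g \<in> ?C" if "f \<in> ?C" "g \<in> ?C" for f g
      using add[OF that] unfolding ring_of_type_algebra_def ring_record_simps .
  qed
  then show ?thesis
    unfolding mpoly_ring_def
    by (rule R.subcring_iff[OF carrier, THEN iffD1, OF R.subcringI'])
qed

end

theory Submission
  imports Defs "HOL-Computational_Algebra.Fraction_Field"
begin

text \<open>
  Let \<open>P \<supseteq> \<aa>\<close> be a real prime. It has a generic point \<open>y\<close> in the algebraic closure \<open>L\<close> of
  \<open>K(X\<^sub>0, X\<^sub>1, \<dots>)\<close>: a polynomial vanishes at \<open>y\<close> iff it lies in \<open>P\<close>. As \<open>P\<close> is real, \<open>K[y]\<close> is
  formally real, and a maximal formally real subring \<open>R\<close> of \<open>L\<close> containing it is a real closed field.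
  By a back-and-forth comparison of sign diagrams (the algorithm of Cohen, Hoermander and Muchnik),
  applied to one coordinate at a time, for every polynomial \<open>f\<close> there is a point \<open>x\<close> over \<open>K \<subseteq> R\<close> at which \<open>f\<close>
  has the same sign as at \<open>y\<close> and at which all elements of \<open>P\<close> vanish. If \<open>f\<close> vanishes on the zeros
  of \<open>\<aa>\<close>, then \<open>f\<close> vanishes at \<open>x\<close>, hence at \<open>y\<close>, that is, \<open>f \<in> P\<close>. Conversely, the ideal of a
  point is a real prime.

  The intermediate value property of maximal formally real rings is proved directly: a polynomial
  of minimal degree violating it would have a root in a larger formally real ring.
\<close>

section \<open>Formally real subrings\<close>

text \<open>The point \<open>x\<close> amounts to a homomorphism from \<open>K[y]\<close> to
  \<open>K\<close> that does not kill \<open>f(y)\<close> when \<open>f(y)\<close> is nonzero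
  (Artin-Lang). The detour through \<open>R\<close> provides an order: signs can be compared only
  between two ordered fields, and \<open>K[y]\<close> comes with no preferred order, while a real
  closed field has exactly one, given by its squares. As \<open>R\<close> is a subset of
  \<open>L\<close> found by Zorn's lemma, this order is expressed by an integer-valued sign instead
  of a type class. Fixing one coordinate at a time turns coefficients into values, and a leading
  coefficient may vanish on the way. The finite families of polynomials are therefore closed under
  dropping the leading term, besides derivatives and remainders. Infinitely many variables in
  \<open>L\<close> make it depend on \<open>K\<close> alone: whichever coordinates are independent
  modulo \<open>P\<close> can be sent to variables, and only the remaining ones require
  roots.\<close>

inductive_set sos :: "'a::idom set \<Rightarrow> 'a set" for R where
  zero: "0 \<in> sos R"
| add: "x \<in> R \<Longrightarrow> s \<in> sos R \<Longrightarrow> x * x + s \<in> sos R"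

definition formally_real :: "'a::idom set \<Rightarrow> bool" where
  "formally_real R \<longleftrightarrow> (\<forall>x\<in>R. \<forall>s\<in>sos R. x * x + s = 0 \<longrightarrow> x = 0)"

definition pol :: "'a::idom set \<Rightarrow> 'a poly set" where
  "pol R = {p. \<forall>i. poly.coeff p i \<in> R}"

definition adjoin :: "'a::idom set \<Rightarrow> 'a \<Rightarrow> 'a set" where
  "adjoin R a = (\<lambda>p. poly p a) ` pol R"

lemma formally_realD: "formally_real R \<Longrightarrow> x \<in> R \<Longrightarrow> s \<in> sos R \<Longrightarrow> x * x + s = 0 \<Longrightarrow> x = 0"
  unfolding formally_real_def by blast

lemma sos_mono: "s \<in> sos R \<Longrightarrow> R \<subseteq> S \<Longrightarrow> s \<in> sos S"
  by (induction rule: sos.induct) (auto intro: sos.intros)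

lemma sos_plus: "s \<in> sos R \<Longrightarrow> t \<in> sos R \<Longrightarrow> s + t \<in> sos R"
  by (induction rule: sos.induct) (auto simp: add.assoc intro: sos.intros)

lemma sos_square: "x \<in> R \<Longrightarrow> x * x \<in> sos R"
  using sos.add[OF _ sos.zero] by fastforce

lemma formally_real_sos_plus_eq_0:
  assumes "formally_real R" "s \<in> sos R" "t \<in> sos R" "s + t = 0"
  shows "s = 0"
  using assms(2,4)
proof (induction rule: sos.induct)
  case (add x s)
  then have "x = 0"
    using formally_realD[OF assms(1), of x "s + t"] sos_plus[OF _ assms(3)] by (simp add: add.assoc)
  with add show ?case by simp
qed simp

locale subring_set =
  fixes R :: "'a::idom set"
  assumes one_closed [simp]: "1 \<in> R"
    and diff_closed [simp]: "x \<in> R \<Longrightarrow> y \<in> R \<Longrightarrow> x - y \<in> R"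
    and mult_closed [simp]: "x \<in> R \<Longrightarrow> y \<in> R \<Longrightarrow> x * y \<in> R"
begin

lemma zero_closed [simp]: "0 \<in> R"
  using diff_closed[OF one_closed one_closed] by simp

lemma uminus_closed [simp]: "x \<in> R \<Longrightarrow> - x \<in> R"
  using diff_closed[of 0 x] by simp

lemma add_closed [simp]: "x \<in> R \<Longrightarrow> y \<in> R \<Longrightarrow> x + y \<in> R"
  using diff_closed[of x "- y"] by simp

lemma power_closed [simp]: "x \<in> R \<Longrightarrow> x ^ n \<in> R"
  by (induction n) auto

lemma of_nat_closed [simp]: "of_nat n \<in> R"
  by (induction n) auto

lemma sum_closed: "(\<And>i. i \<in> A \<Longrightarrow> f i \<in> R) \<Longrightarrow> sum f A \<in> R"
  by (induction A rule: infinite_finite_induct) auto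

lemma prod_closed: "(\<And>i. i \<in> A \<Longrightarrow> f i \<in> R) \<Longrightarrow> prod f A \<in> R"
  by (induction A rule: infinite_finite_induct) auto

lemma sos_closed: "s \<in> sos R \<Longrightarrow> s \<in> R"
  by (induction rule: sos.induct) auto

lemma sos_times_square: "s \<in> sos R \<Longrightarrow> x \<in> R \<Longrightarrow> s * (x * x) \<in> sos R"
proof (induction rule: sos.induct)
  case (add y s)
  have "(y * y + s) * (x * x) = (y * x) * (y * x) + s * (x * x)" by (simp add: algebra_simps)
  then show ?case using add by (metis mult_closed sos.add)
qed (simp add: sos.zero)

lemma sos_times: "s \<in> sos R \<Longrightarrow> t \<in> sos R \<Longrightarrow> s * t \<in> sos R"
proof (induction rule: sos.induct)
  case (add y s)
  have "(y * y + s) * t = t * (y * y) + s * t" by (simp add: algebra_simps)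
  then show ?case using add by (metis sos_plus sos_times_square)
qed (simp add: sos.zero)

lemma polI [intro]: "(\<And>i. poly.coeff p i \<in> R) \<Longrightarrow> p \<in> pol R"
  by (simp add: pol_def)

lemma pol_coeff: "p \<in> pol R \<Longrightarrow> poly.coeff p i \<in> R"
  by (simp add: pol_def)

lemma pol_0 [simp]: "0 \<in> pol R"
  by (simp add: pol_def)

lemma pol_pCons [simp]: "pCons c p \<in> pol R \<longleftrightarrow> c \<in> R \<and> p \<in> pol R"
proof
  assume *: "pCons c p \<in> pol R"
  have "poly.coeff (pCons c p) 0 \<in> R" "\<And>i. poly.coeff (pCons c p) (Suc i) \<in> R"
    using pol_coeff[OF *] by blast+
  then show "c \<in> R \<and> p \<in> pol R" by (auto simp: pol_def)
qed (auto simp: pol_def coeff_pCons split: nat.split)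

lemma pol_monom [simp]: "c \<in> R \<Longrightarrow> monom c n \<in> pol R"
  by (auto simp: pol_def)

lemma pol_smult [simp]: "c \<in> R \<Longrightarrow> p \<in> pol R \<Longrightarrow> smult c p \<in> pol R"
  by (auto simp: pol_def)

lemma pol_mult [simp]: "p \<in> pol R \<Longrightarrow> q \<in> pol R \<Longrightarrow> p * q \<in> pol R"
  by (intro polI) (auto simp: coeff_mult pol_coeff intro!: sum_closed)

lemma pol_pderiv [simp]: "p \<in> pol R \<Longrightarrow> pderiv p \<in> pol R"
  by (intro polI) (auto simp: coeff_pderiv pol_coeff simp del: of_nat_Suc)

lemma pol_subring: "subring_set (pol R)"
  by standard (auto simp: one_pCons, auto simp: pol_def)

lemma pol_diff [simp]: "p \<in> pol R \<Longrightarrow> q \<in> pol R \<Longrightarrow> p - q \<in> pol R"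
  using subring_set.diff_closed[OF pol_subring] .

lemma pol_add [simp]: "p \<in> pol R \<Longrightarrow> q \<in> pol R \<Longrightarrow> p + q \<in> pol R"
  using subring_set.add_closed[OF pol_subring] .

lemma pol_uminus [simp]: "p \<in> pol R \<Longrightarrow> - p \<in> pol R"
  using subring_set.uminus_closed[OF pol_subring] .

lemma poly_closed [simp]: "p \<in> pol R \<Longrightarrow> x \<in> R \<Longrightarrow> poly p x \<in> R"
  by (induction p) auto

lemma sos_pol_closed: "s \<in> sos Q \<Longrightarrow> Q \<subseteq> pol R \<Longrightarrow> s \<in> pol R"
  by (induction rule: sos.induct) auto

lemma poly_sos: "s \<in> sos Q \<Longrightarrow> Q \<subseteq> pol R \<Longrightarrow> x \<in> R \<Longrightarrow> poly s x \<in> sos R"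
  by (induction rule: sos.induct) (auto intro!: sos.intros poly_closed)

lemma adjoin_subring: "subring_set (adjoin R a)"
proof
  show "1 \<in> adjoin R a"
    by (force simp: adjoin_def intro: image_eqI[of _ _ "[:1:]"])
  show "x - y \<in> adjoin R a" "x * y \<in> adjoin R a" if xy: "x \<in> adjoin R a" "y \<in> adjoin R a" for x y
  proof -
    from xy obtain p q where "p \<in> pol R" "q \<in> pol R" "x = poly p a" "y = poly q a"
      by (auto simp: adjoin_def)
    then show "x - y \<in> adjoin R a" "x * y \<in> adjoin R a"
      by (auto simp: adjoin_def intro: image_eqI[of _ _ "p - q"] image_eqI[of _ _ "p * q"])
  qed
qed

lemma adjoin_mem: "a \<in> adjoin R a"
  by (force simp: adjoin_def intro: image_eqI[of _ _ "[:0, 1:]"])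

lemma subset_adjoin: "R \<subseteq> adjoin R a"
  by (auto simp: adjoin_def intro: image_eqI[of _ _ "[:c:]" for c])

end

lemma (in subring_set) pseudo_division:
  assumes "p \<in> pol R" "q \<in> pol R" "q \<noteq> 0"
  shows "\<exists>k s r. s \<in> pol R \<and> r \<in> pol R \<and> smult (lead_coeff q ^ k) p = q * s + r
           \<and> (r = 0 \<or> degree r < degree q)"
  using assms(1)
\<comment> \<open>The measure separates 0 from the nonzero constants, which share its degree:
  dividing a constant by a constant has to count as progress.\<close>
proof (induction "if p = 0 then 0 else Suc (degree p)" arbitrary: p rule: less_induct)
  case (less p)
  show ?case
  proof (cases "p = 0 \<or> degree p < degree q")
    case True
    then show ?thesis using less.prems by (intro exI[of _ 0] exI[of _ 0] exI[of _ p]) auto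
  next
    case False
    define t where "t = monom (lead_coeff p) (degree p - degree q)"
    define p' where "p' = smult (lead_coeff q) p - t * q"
    have t: "t \<in> pol R" and p': "p' \<in> pol R"
      using less.prems assms(2) by (auto simp: t_def p'_def pol_coeff)
    have le: "degree p' \<le> degree p"
      using False degree_mult_le[of t q] degree_monom_le[of "lead_coeff p" "degree p - degree q"]
      unfolding p'_def by (intro degree_diff_le order.trans[OF degree_smult_le]) (auto simp: t_def)
    have "poly.coeff p' (degree p) = 0"
      using False by (simp add: p'_def t_def coeff_monom_mult)
    then have "p' \<noteq> 0 \<Longrightarrow> degree p' \<noteq> degree p" using leading_coeff_0_iff by metis
    with le have "(if p' = 0 then 0 else Suc (degree p')) < (if p = 0 then 0 else Suc (degree p))"
      using False by (auto simp: le_less)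
    from less.hyps[OF this p'] obtain k s r where *: "s \<in> pol R" "r \<in> pol R"
      "smult (lead_coeff q ^ k) p' = q * s + r" "r = 0 \<or> degree r < degree q" by blast
    have "smult (lead_coeff q ^ Suc k) p = smult (lead_coeff q ^ k) (p' + t * q)"
      by (simp add: p'_def mult.commute)
    also have "\<dots> = q * (s + smult (lead_coeff q ^ k) t) + r"
      by (simp add: smult_add_right *(3) algebra_simps)
    finally show ?thesis
      using * t assms(2) pol_coeff[OF assms(2)] by (intro exI[of _ "Suc k"] exI[of _ "s + smult (lead_coeff q ^ k) t"] exI[of _ r]) auto
  qed
qed


section \<open>Ordered fields whose order is determined by squares\<close>

text \<open>Under the axioms of \<open>euclidean_field\<close> this is the sign for the only
  possible order of \<open>R\<close>, and \<open>x < y\<close> becomes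
  \<open>sg R (y - x) = 1\<close>. Integer values let signs in two different fields be
  equated.\<close>

definition sg :: "'a::idom set \<Rightarrow> 'a \<Rightarrow> int" where
  "sg R x = (if x = 0 then 0 else if \<exists>y\<in>R. x = y * y then 1 else - 1)"

text \<open>Euclidean as in Euclidean ordered fields, where the squares are exactly the nonnegative
  elements; Euclidean division is not meant. The axioms avoid the order that they determine.\<close>

locale euclidean_field = subring_set R for R :: "'a::field set" +
  assumes inverse_closed [simp]: "x \<in> R \<Longrightarrow> inverse x \<in> R"
    and square_or_neg_square: "x \<in> R \<Longrightarrow> \<exists>y\<in>R. x = y * y \<or> x = - (y * y)"
    and sum_squares_square: "x \<in> R \<Longrightarrow> y \<in> R \<Longrightarrow> \<exists>z\<in>R. x * x + y * y = z * z"
    and sum_squares_eq_0: "x \<in> R \<Longrightarrow> y \<in> R \<Longrightarrow> x * x + y * y = 0 \<Longrightarrow> x = 0"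
begin

lemma divide_closed [simp]: "x \<in> R \<Longrightarrow> y \<in> R \<Longrightarrow> x / y \<in> R"
  by (simp add: divide_inverse)

lemma sg_cases: "sg R x = 0 \<or> sg R x = 1 \<or> sg R x = -1"
  by (simp add: sg_def)

lemma sg_eq_0_iff [simp]: "sg R x = 0 \<longleftrightarrow> x = 0"
  by (simp add: sg_def)

lemma sg_0 [simp]: "sg R 0 = 0"
  by simp

lemma sg_square: "x \<in> R \<Longrightarrow> x \<noteq> 0 \<Longrightarrow> sg R (x * x) = 1"
  by (auto simp: sg_def)

lemma sg_uminus: assumes "x \<in> R" shows "sg R (- x) = - sg R x"
proof -
  have *: False if "x = y * y" "- x = z * z" "y \<in> R" "z \<in> R" "x \<noteq> 0" for y z
  proof -
    have "y * y + z * z = x + - x" by (simp only: that(1)[symmetric] that(2)[symmetric])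
    then have "y = 0" using sum_squares_eq_0[of y z] that(3,4) by simp
    then show False using that(1,5) by simp
  qed
  define P Q where "P \<longleftrightarrow> (\<exists>y\<in>R. x = y * y)" and "Q \<longleftrightarrow> (\<exists>y\<in>R. - x = y * y)"
  have "P \<or> Q"
    using square_or_neg_square[OF assms] unfolding P_def Q_def by (metis minus_minus)
  moreover have "\<not> (P \<and> Q)" if "x \<noteq> 0"
    using * that unfolding P_def Q_def by blast
  moreover have "sg R x = (if x = 0 then 0 else if P then 1 else - 1)"
    "sg R (- x) = (if x = 0 then 0 else if Q then 1 else - 1)"
    by (simp_all add: sg_def P_def Q_def)
  ultimately show ?thesis by auto
qed

lemma sg_1 [simp]: "sg R 1 = 1"
  using sg_square[of 1] by simp

lemma sg_eq_1D: "sg R x = 1 \<Longrightarrow> \<exists>y\<in>R. x = y * y \<and> y \<noteq> 0"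
  by (auto simp: sg_def split: if_splits)

lemma sg_eq_minus_1D: "x \<in> R \<Longrightarrow> sg R x = -1 \<Longrightarrow> \<exists>y\<in>R. x = - (y * y) \<and> y \<noteq> 0"
  using sg_eq_1D[of "- x"] sg_uminus[of x] by (metis minus_minus)

lemma sg_mult: assumes "x \<in> R" "y \<in> R" shows "sg R (x * y) = sg R x * sg R y"
proof -
  have pos: "sg R (u * v) = sg R v" if uv: "sg R u = 1" "u \<in> R" "v \<in> R" for u v
  proof -
    obtain a where a: "a \<in> R" "u = a * a" "a \<noteq> 0" using sg_eq_1D[OF uv(1)] by blast
    have "(\<exists>y\<in>R. u * v = y * y) \<longleftrightarrow> (\<exists>y\<in>R. v = y * y)"
    proof safe
      fix y assume y: "y \<in> R" "u * v = y * y"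
      then have "v = (y / a) * (y / a)" using a by (simp add: field_simps)
      then show "\<exists>y\<in>R. v = y * y" using y a by (metis divide_closed)
    next
      fix y assume y: "y \<in> R" "v = y * y"
      then have "u * (y * y) = (a * y) * (a * y)" using a by (simp add: field_simps)
      then show "\<exists>z\<in>R. u * (y * y) = z * z" using y a by (metis mult_closed)
    qed
    then show ?thesis using a by (auto simp: sg_def)
  qed
  consider "x = 0" | "sg R x = 1" | "sg R x = -1" using sg_cases[of x] by auto
  then show ?thesis
  proof cases
    case 3
    then have "sg R (- x * y) = sg R y" using assms by (intro pos) (auto simp: sg_uminus)
    then show ?thesis using 3 assms sg_uminus[of "x * y"] by simp
  qed (use assms pos in auto)
qed

lemma sg_power: "x \<in> R \<Longrightarrow> sg R (x ^ n) = sg R x ^ n"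
  by (induction n) (auto simp: sg_mult)

lemma sg_add_pos: 
  assumes "x \<in> R" "y \<in> R" "sg R x = 1" "sg R y \<ge> 0" shows "sg R (x + y) = 1"
proof (cases "y = 0")
  case False
  then have "sg R y = 1" using sg_cases[of y] assms by auto
  then obtain u v where uv: "u \<in> R" "v \<in> R" "x = u * u" "y = v * v" "u \<noteq> 0"
    using sg_eq_1D assms(3) by metis
  obtain z where z: "z \<in> R" "x + y = z * z" using sum_squares_square[OF uv(1,2)] uv by auto
  have "x + y \<noteq> 0" using sum_squares_eq_0[OF uv(1,2)] uv by auto
  then show ?thesis using z by (auto simp: sg_def)
qed (use assms in auto)

lemma sg_add_same: 
  assumes "x \<in> R" "y \<in> R" "sg R x = sg R y" shows "sg R (x + y) = sg R x"
proof -
  consider "sg R x = 0" | "sg R x = 1" | "sg R x = - 1" using sg_cases by blast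
  then show ?thesis
  proof cases
    case 3
    then have "sg R (- x + - y) = 1"
      using assms by (intro sg_add_pos) (auto simp: sg_uminus)
    then have "sg R (- (x + y)) = 1" by (simp add: algebra_simps)
    then show ?thesis using 3 sg_uminus[of "x + y"] assms by simp
  next
    case 1
    then have "x = 0" "y = 0" using assms(3) by auto
    then show ?thesis by simp
  qed (use assms sg_add_pos in auto)
qed

lemma sg_minus_swap: "x \<in> R \<Longrightarrow> y \<in> R \<Longrightarrow> sg R (x - y) = - sg R (y - x)"
  using sg_uminus[of "y - x"] by simp

lemma sg_diff_trans:
  assumes "x \<in> R" "y \<in> R" "z \<in> R" "sg R (x - y) = 1" "sg R (y - z) \<ge> 0"
  shows "sg R (x - z) = 1"
  using sg_add_pos[of "x - y" "y - z"] assms by simp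

lemma sg_diff_trans':
  assumes "x \<in> R" "y \<in> R" "z \<in> R" "sg R (x - y) \<ge> 0" "sg R (y - z) = 1"
  shows "sg R (x - z) = 1"
  using sg_add_pos[of "y - z" "x - y"] assms by simp

lemma sg_diff_less:
  assumes "sg R (x - z) < sg R (y - z)" "x \<in> R" "y \<in> R" "z \<in> R"
  shows "sg R (x - y) = -1"
proof -
  have "sg R (y - z) \<ge> 0" "sg R (z - x) \<ge> 0" "sg R (y - z) = 1 \<or> sg R (z - x) = 1"
    using assms sg_cases[of "x - z"] sg_cases[of "y - z"] sg_minus_swap[of z x] by auto
  then have "sg R (y - x) = 1"
    using sg_diff_trans[of y z x] sg_diff_trans'[of y z x] assms by blast
  then show ?thesis using sg_minus_swap[of x y] assms by simp
qed

lemma sg_of_nat_Suc [simp]: "sg R (of_nat (Suc n)) = 1"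
proof (induction n)
  case (Suc n)
  have "sg R (1 + of_nat (Suc n)) = 1"
    by (rule sg_add_pos) (use Suc in \<open>auto simp del: of_nat_Suc\<close>)
  then show ?case by simp
qed simp

lemma of_nat_Suc_neq_0: "of_nat (Suc n) \<noteq> (0::'a)"
  using sg_of_nat_Suc[of n] by (metis sg_0 zero_neq_one)

lemma inj_of_nat: "inj (of_nat :: nat \<Rightarrow> 'a)"
proof (rule linorder_injI)
  fix m n :: nat assume "m < n"
  then obtain k where "n = m + Suc k" using less_iff_Suc_add by auto
  then show "of_nat m \<noteq> (of_nat n :: 'a)" using of_nat_Suc_neq_0[of k] by simp
qed

lemma infinite_R: "infinite R"
  using finite_subset[of "range (of_nat :: nat \<Rightarrow> 'a)" R] range_inj_infinite[OF inj_of_nat]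
  by (meson image_subsetI of_nat_closed)

lemma poly_0_on_R: "(\<And>x. x \<in> R \<Longrightarrow> poly p x = 0) \<Longrightarrow> p = 0"
  using poly_roots_finite[of p] infinite_R finite_subset[of R "{x. poly p x = 0}"] by blast

lemma sg_sos: "s \<in> sos R \<Longrightarrow> sg R s \<ge> 0"
proof (induction rule: sos.induct)
  case (add x s)
  then show ?case
    using sg_add_pos[of "x * x" s] sg_square[of x] sos_closed by (cases "x = 0") auto
qed simp

lemma division:
  assumes "p \<in> pol R" "q \<in> pol R" "q \<noteq> 0"
  shows "\<exists>s r. s \<in> pol R \<and> r \<in> pol R \<and> p = q * s + r \<and> (r = 0 \<or> degree r < degree q)"
proof -
  from pseudo_division[OF assms] obtain k s r where *: "s \<in> pol R" "r \<in> pol R"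
     "smult (lead_coeff q ^ k) p = q * s + r" "r = 0 \<or> degree r < degree q" by blast
  define c where "c = inverse (lead_coeff q ^ k)"
  have c: "c \<in> R" "c \<noteq> 0" "c * lead_coeff q ^ k = 1"
    using assms pol_coeff[of q] by (auto simp: c_def)
  have "p = smult c (smult (lead_coeff q ^ k) p)" using c by simp
  also have "\<dots> = q * smult c s + smult c r" by (simp add: *(3) smult_add_right)
  finally show ?thesis using * c by (intro exI[of _ "smult c s"] exI[of _ "smult c r"]) auto
qed

lemma root_factor:
  assumes "p \<in> pol R" "c \<in> R" "poly p c = 0"
  shows "\<exists>s\<in>pol R. p = [:- c, 1:] * s"
proof -
  obtain s r where *: "s \<in> pol R" "r \<in> pol R" "p = [:- c, 1:] * s + r"
      "r = 0 \<or> degree r < degree [:- c, 1:]"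
    using division[of p "[:- c, 1:]"] assms by auto
  then obtain d where "r = [:d:]" by (metis degree_eq_zeroE degree_0 less_one degree_pCons_eq_if one_neq_zero One_nat_def pCons_eq_0_iff)
  then have "r = 0" using assms(3) *(3) by simp
  then show ?thesis using * by auto
qed

end


section \<open>Real closed subfields of an algebraically closed field\<close>

text \<open>Maximality is demanded only against elements algebraic over \<open>R\<close>. This fits
  the image of \<open>K\<close>, which may have transcendental formally real extensions inside the
  ambient field, as well as the ring obtained from Zorn's lemma.\<close>

locale real_closed_subring = subring_set R for R :: "'a::alg_closed_field set" +
  assumes real: "formally_real R"
    and max: "p \<in> pol R \<Longrightarrow> p \<noteq> 0 \<Longrightarrow> poly p a = 0 \<Longrightarrow> formally_real (adjoin R a) \<Longrightarrow> a \<in> R"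
begin

text \<open>Denominators are cleared: multiplying \<open>u * u + s = 0\<close> over
  \<open>R[1/x]\<close> by a high even power of \<open>x\<close> gives a relation over
  \<open>R\<close>. So \<open>R[1/x]\<close> is formally real, and it is generated by the root of
  the linear polynomial \<open>[:- 1, x:]\<close>.\<close>

lemma inverse_closed: 
  assumes x: "x \<in> R" shows "inverse x \<in> R"
proof (cases "x = 0")
  case False
  define a where "a = inverse x"
  have ax: "a * x = 1" using False by (simp add: a_def)
  \<comment> \<open>Stated for all large exponents, so that several elements can share one.\<close>
  have rep: "\<exists>k. \<forall>l\<ge>k. u * x ^ l \<in> R" if u: "u \<in> adjoin R a" for u
  proof -
    obtain p where p: "p \<in> pol R" "u = poly p a" using u by (auto simp: adjoin_def)
    have "\<exists>k. poly p a * x ^ k \<in> R" using p(1)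
    proof (induction p)
      case (pCons c p)
      then obtain k where k: "poly p a * x ^ k \<in> R" by auto
      have "poly (pCons c p) a * x ^ Suc k = c * x ^ Suc k + (a * x) * (poly p a * x ^ k)"
        by (simp add: algebra_simps)
      then show ?case using k pCons.prems x ax by (intro exI[of _ "Suc k"]) simp
    qed simp
    then obtain k where k: "u * x ^ k \<in> R" using p by auto
    have "u * x ^ l \<in> R" if "l \<ge> k" for l
    proof -
      have "x ^ l = x ^ k * x ^ (l - k)" using that by (simp flip: power_add)
      then have eq: "u * x ^ l = (u * x ^ k) * x ^ (l - k)" by (simp only: mult.assoc)
      show ?thesis unfolding eq by (rule mult_closed[OF k power_closed[OF x]])
    qed
    then show ?thesis by blast
  qed
  have reps: "\<exists>k. \<forall>l\<ge>k. s * (x ^ l * x ^ l) \<in> sos R" if "s \<in> sos (adjoin R a)" for s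
    using that
  proof (induction rule: sos.induct)
    case (add u s)
    obtain k1 where k1: "\<forall>l\<ge>k1. u * x ^ l \<in> R" using rep[OF add(1)] by blast
    obtain k2 where k2: "\<forall>l\<ge>k2. s * (x ^ l * x ^ l) \<in> sos R" using add by blast
    have "(u * u + s) * (x ^ l * x ^ l) = (u * x ^ l) * (u * x ^ l) + s * (x ^ l * x ^ l)" for l
      by (simp add: algebra_simps)
    then have "\<forall>l\<ge>max k1 k2. (u * u + s) * (x ^ l * x ^ l) \<in> sos R"
      using k1 k2 by (auto intro!: sos.add)
    then show ?case ..
  qed (simp add: sos.zero)
  have "formally_real (adjoin R a)"
    unfolding formally_real_def
  proof (intro ballI impI)
    fix u s assume u: "u \<in> adjoin R a" and s: "s \<in> sos (adjoin R a)" and us: "u * u + s = 0"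
    obtain k1 where k1: "\<forall>l\<ge>k1. u * x ^ l \<in> R" using rep[OF u] by blast
    obtain k2 where k2: "\<forall>l\<ge>k2. s * (x ^ l * x ^ l) \<in> sos R" using reps[OF s] by blast
    define l where "l = max k1 k2"
    have "(u * x ^ l) * (u * x ^ l) + s * (x ^ l * x ^ l) = (u * u + s) * (x ^ l * x ^ l)"
      by (simp only: algebra_simps)
    then have "u * x ^ l = 0"
      using us k1 k2 formally_realD[OF real, of "u * x ^ l" "s * (x ^ l * x ^ l)"] by (simp add: l_def)
    then show "u = 0" using False by simp
  qed
  moreover have "poly [:- 1, x:] a = 0" using ax by (simp add: mult.commute)
  ultimately show ?thesis using max[of "[:- 1, x:]" a] x by (simp add: a_def)
qed simp

text \<open>If the root \<open>w\<close> of \<open>X^2 - a\<close> lies outside \<open>R\<close>,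
  maximality prevents \<open>R[w]\<close> from being formally real. Split a witnessing relation
  along \<open>1\<close> and \<open>w\<close>: its first component reads
  \<open>B' + Z * a = 0\<close> with sums of squares \<open>B'\<close> and
  \<open>Z \<noteq> 0\<close>, hence \<open>- a = B' / Z\<close>.\<close>

lemma square_or_neg_sos:
  assumes a: "a \<in> R" shows "(\<exists>y\<in>R. a = y * y) \<or> - a \<in> sos R"
proof -
  have "degree [:- a, 0, 1:] > 0" by simp
  then obtain w where "poly [:- a, 0, 1:] w = 0" using alg_closed_imp_poly_has_root by blast
  then have w: "w * w = a" by simp
  have wz: "w * (w * z) = a * z" for z using w by (metis mult.assoc)
  show ?thesis
  proof (cases "w \<in> R")
    case False
    have rep: "\<exists>b\<in>R. \<exists>c\<in>R. u = b + c * w" if u: "u \<in> adjoin R w" for u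
    proof -
      obtain p where p: "p \<in> pol R" "u = poly p w" using u by (auto simp: adjoin_def)
      have "\<exists>b\<in>R. \<exists>c\<in>R. poly p w = b + c * w" using p(1)
      proof (induction p)
        case (pCons d p)
        then obtain b c where bc: "b \<in> R" "c \<in> R" "poly p w = b + c * w" by auto
        have "poly (pCons d p) w = (d + c * a) + b * w" using bc wz w by (simp add: algebra_simps)
        then show ?case using bc pCons a by (metis add_closed mult_closed pol_pCons)
      qed (auto intro!: bexI[of _ 0])
      then show ?thesis using p by auto
    qed
    have reps: "\<exists>B\<in>sos R. \<exists>C\<in>sos R. \<exists>D\<in>R. s = B + C * a + 2 * D * w" if s: "s \<in> sos (adjoin R w)" for s
      using s
    proof (induction rule: sos.induct)
      case zero
      then show ?case by (auto intro!: bexI[of _ 0] sos.zero)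
    next
      case (add u s)
      then obtain b c B C D where *: "b \<in> R" "c \<in> R" "u = b + c * w" 
        "B \<in> sos R" "C \<in> sos R" "D \<in> R" "s = B + C * a + 2 * D * w" using rep[OF add(1)] by blast
      have "u * u + s = (b * b + B) + (c * c + C) * a + 2 * (b * c + D) * w"
        using wz w by (simp add: * algebra_simps)
      then show ?case using * by (metis sos.add add_closed mult_closed)
    qed
    have "\<not> formally_real (adjoin R w)"
      using max[of "[:- a, 0, 1:]" w] w a False by auto
    then obtain u s where us: "u \<in> adjoin R w" "s \<in> sos (adjoin R w)" "u * u + s = 0" "u \<noteq> 0"
      by (auto simp: formally_real_def)
    obtain b c where bc: "b \<in> R" "c \<in> R" "u = b + c * w" using rep us(1) by blast
    obtain B C D where BCD: "B \<in> sos R" "C \<in> sos R" "D \<in> R" "s = B + C * a + 2 * D * w"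
      using reps[OF us(2)] by blast
    define v0 where "v0 = (b * b + B) + (c * c + C) * a"
    define v1 where "v1 = 2 * (b * c + D)"
    have v01: "v0 + v1 * w = 0"
      using us(3) wz w by (simp add: bc BCD v0_def v1_def algebra_simps)
    have inR: "v0 \<in> R" "v1 \<in> R" using bc BCD a sos_closed of_nat_closed[of 2] by (auto simp: v0_def v1_def)
    have "v1 = 0"
    proof (rule ccontr)
      assume "v1 \<noteq> 0"
      then have "w = - v0 * inverse v1" using v01 by (simp add: field_simps add_eq_0_iff)
      then have "w \<in> R" using inR inverse_closed by (metis mult_closed uminus_closed)
      then show False using False by simp
    qed
    then have v0: "v0 = 0" using v01 by simp
    define Z where "Z = c * c + C"
    have Z: "Z \<in> sos R" "Z \<in> R" using bc BCD sos_closed[of Z] by (auto simp: Z_def intro: sos.add)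
    have "Z \<noteq> 0"
    proof
      assume "Z = 0"
      then have "c = 0" using formally_realD[OF real bc(2) BCD(2)] by (simp add: Z_def)
      moreover have "b = 0" using formally_realD[OF real bc(1) BCD(1)] v0 \<open>Z = 0\<close> by (simp add: v0_def Z_def)
      ultimately show False using bc us(4) by simp
    qed
    moreover have "b * b + B = - (a * Z)"
      using v0 by (simp add: v0_def Z_def eq_neg_iff_add_eq_0 mult.commute)
    \<comment> \<open>Written as \<open>B' * Z\<close> times the square of \<open>1 / Z\<close>, the
      quotient is visibly a sum of squares.\<close>
    ultimately have "- a = (b * b + B) * Z * (inverse Z * inverse Z)"
      by (simp add: field_simps del: add_uminus_conv_diff)
    moreover have "\<dots> \<in> sos R"
      using bc BCD Z inverse_closed by (intro sos_times_square sos_times sos.add) auto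
    ultimately show ?thesis by simp
  qed (use w in auto)
qed

lemma sos_is_square:
  assumes "s \<in> sos R" shows "\<exists>y\<in>R. s = y * y"
  using square_or_neg_sos[OF sos_closed[OF assms]]
proof
  assume "- s \<in> sos R"
  then have "s = 0" using formally_real_sos_plus_eq_0[OF real assms, of "- s"] by simp
  then show ?thesis by (auto intro: bexI[of _ 0])
qed

sublocale euclidean_field
proof
  fix x y assume x: "x \<in> R" and y: "y \<in> R"
  show "inverse x \<in> R" using inverse_closed[OF x] .
  show "\<exists>y\<in>R. x = y * y \<or> x = - (y * y)"
    using square_or_neg_sos[OF x] sos_is_square[of "- x"] by (metis minus_minus)
  show "\<exists>z\<in>R. x * x + y * y = z * z"
    using sos_is_square[OF sos.add[OF x sos_square[OF y]]] .
  show "x = 0" if "x * x + y * y = 0"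
    using formally_realD[OF real x sos_square[OF y] that] .
qed


section \<open>The intermediate value property\<close>

definition small_pol :: "nat \<Rightarrow> 'a poly set" where
  "small_pol d = {u \<in> pol R. u \<noteq> 0 \<longrightarrow> degree u < d}"

lemma small_pol_subset: "small_pol d \<subseteq> pol R"
  by (auto simp: small_pol_def)

lemma degree_sos_small_pol: "T \<in> sos (small_pol (Suc d)) \<Longrightarrow> degree T \<le> 2 * d"
proof (induction rule: sos.induct)
  case (add x s)
  have "degree (x * x) \<le> 2 * d"
    using add(1) degree_mult_le[of x x] by (cases "x = 0") (auto simp: small_pol_def)
  then show ?case using add by (intro degree_add_le)
qed simp

text \<open>A sum of squares that vanishes at a point of a formally real ring vanishes there summand
  by summand. Each summand splits off \<open>X - c\<close>, the sum its square, and the degree bound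
  drops by one.\<close>

lemma sos_small_pol_factor:
  assumes "T \<in> sos (small_pol (Suc d))" "c \<in> R" "poly T c = 0"
  shows "\<exists>T'\<in>sos (small_pol d). T = [:- c, 1:] * [:- c, 1:] * T'"
  using assms(1,3)
proof (induction rule: sos.induct)
  case zero
  then show ?case by (auto intro!: bexI[of _ 0] sos.zero)
next
  case (add u s)
  have u: "u \<in> pol R" "u \<noteq> 0 \<longrightarrow> degree u < Suc d" using add(1) by (auto simp: small_pol_def)
  have s: "poly s c \<in> sos R" using poly_sos[OF add(2) small_pol_subset assms(2)] .
  have uc: "poly u c = 0"
    using formally_realD[OF real poly_closed[OF u(1) assms(2)] s] add(4) by simp
  with add(3,4) obtain T' where T': "T' \<in> sos (small_pol d)" "s = [:- c, 1:] * [:- c, 1:] * T'"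
    by auto
  obtain v where v: "v \<in> pol R" "u = [:- c, 1:] * v" using root_factor[OF u(1) assms(2) uc] by auto
  have "degree u = Suc (degree v)" if "v \<noteq> 0"
    using degree_mult_eq[of "[:- c, 1:]" v] that unfolding v(2)[symmetric] by simp
  then have "v \<in> small_pol d"
    using u(2) v by (auto simp: small_pol_def)
  then have "v * v + T' \<in> sos (small_pol d)" using T'(1) by (rule sos.add)
  moreover have "u * u + s = [:- c, 1:] * [:- c, 1:] * (v * v + T')"
    unfolding v(2) T'(2) by (simp only: algebra_simps)
  ultimately show ?case by blast
qed

text \<open>The two sign equations place \<open>c\<close> strictly between \<open>a\<close> and
  \<open>b\<close>, whichever of them is larger.\<close>

definition ivt_for :: "'a poly \<Rightarrow> bool" where
  "ivt_for p \<longleftrightarrow> (\<forall>a\<in>R. \<forall>b\<in>R. sg R (poly p a) * sg R (poly p b) = -1 \<longrightarrow>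
     (\<exists>c\<in>R. poly p c = 0 \<and> sg R (c - a) = sg R (b - a) \<and> sg R (b - c) = sg R (b - a)))"

text \<open>
  The descent behind the intermediate value property: on a sign change of \<open>m\<close> also the cofactor
  \<open>q\<close> changes sign or vanishes, hence has a root, and there all summands of \<open>T\<close> vanish.
\<close>
lemma sos_multiple_eq_0:
  assumes m: "m \<in> pol R" "\<And>c. c \<in> R \<Longrightarrow> poly m c \<noteq> 0"
    and ab: "a \<in> R" "b \<in> R" "sg R (poly m a) * sg R (poly m b) = -1"
    and ivt: "\<And>q. q \<in> pol R \<Longrightarrow> degree q < degree m \<Longrightarrow> ivt_for q"
  shows "d \<le> degree m \<Longrightarrow> T \<in> sos (small_pol d) \<Longrightarrow> q \<in> pol R \<Longrightarrow> T = m * q \<Longrightarrow> T = 0"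
proof (induction d arbitrary: T q)
  \<comment> \<open>Only the zero polynomial belongs to \<open>small_pol 0\<close>, so
    \<open>T\<close> is a sum of zeros.\<close>
  case 0
  from 0(2) show ?case
    by (induction rule: sos.induct) (auto simp: small_pol_def)
next
  case (Suc d)
  show ?case
  proof (rule ccontr)
    assume T0: "T \<noteq> 0"
    then have q0: "q \<noteq> 0" "m \<noteq> 0" using Suc.prems(4) by auto
    \<comment> \<open>The degree of \<open>m\<close> exceeds \<open>d\<close>, which leaves less
      than \<open>d\<close> for the degree of \<open>q\<close>.\<close>
    have "degree m + degree q \<le> 2 * d"
      using degree_sos_small_pol[OF Suc.prems(2)] Suc.prems(4) q0 by (simp add: degree_mult_eq)
    then have "degree q < degree m" using Suc.prems(1) by linarith
    then have ivt_q: "ivt_for q" using ivt Suc.prems(3) by blast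
    have Tsos: "poly T x \<in> sos R" if "x \<in> R" for x
      using poly_sos[OF Suc.prems(2) small_pol_subset that] .
    have sgn: "poly q x = 0 \<or> sg R (poly q x) = sg R (poly m x)" if x: "x \<in> R" for x
    proof -
      have "sg R (poly m x) * sg R (poly q x) \<ge> 0"
        using sg_sos[OF Tsos[OF x]] sg_mult[of "poly m x" "poly q x"] Suc.prems m x by simp
      then show ?thesis
        using sg_cases[of "poly m x"] sg_cases[of "poly q x"] m(2)[OF x] by auto
    qed
    have "\<exists>c\<in>R. poly q c = 0"
    proof (cases "poly q a = 0 \<or> poly q b = 0")
      case False
      then have "sg R (poly q a) * sg R (poly q b) = -1" using sgn[of a] sgn[of b] ab by simp
      then show ?thesis using ivt_q ab unfolding ivt_for_def by blast
    qed (use ab in auto)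
    then obtain c where c: "c \<in> R" "poly q c = 0" by blast
    obtain T' where T': "T' \<in> sos (small_pol d)" "T = [:- c, 1:] * [:- c, 1:] * T'"
      using sos_small_pol_factor[OF Suc.prems(2) c(1)] c(2) Suc.prems(4) by auto
    obtain q1 where q1: "q1 \<in> pol R" "q = [:- c, 1:] * q1" using root_factor[OF Suc.prems(3) c] by auto
    \<comment> \<open>\<open>T\<close> has \<open>c\<close> as a double root while \<open>m\<close>
      does not vanish there, so \<open>q\<close> supplies both factors \<open>X - c\<close>.
      Cancelling them gives a relation of the same kind for \<open>d\<close>.\<close>
    have nz: "[:- c, 1:] \<noteq> 0" by simp
    have "[:- c, 1:] * ([:- c, 1:] * T') = [:- c, 1:] * (m * q1)"
      using T'(2) Suc.prems(4) unfolding q1(2) by (simp only: ac_simps)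
    then have eq1: "[:- c, 1:] * T' = m * q1" using nz mult_left_cancel by blast
    have "poly ([:- c, 1:] * T') c = 0" by simp
    then have "poly q1 c = 0" using m(2)[OF c(1)] unfolding eq1 by simp
    then obtain q2 where q2: "q2 \<in> pol R" "q1 = [:- c, 1:] * q2" using root_factor[OF q1(1) c(1)] by auto
    have "[:- c, 1:] * T' = [:- c, 1:] * (m * q2)"
      using eq1 unfolding q2(2) by (simp only: ac_simps)
    then have "T' = m * q2" using nz mult_left_cancel by blast
    then have "T' = 0" using Suc.IH[OF _ T'(1) q2(1)] Suc.prems(1) by simp
    then show False using T0 T'(2) by simp
  qed
qed

text \<open>Let \<open>m\<close> have least degree among the polynomials over \<open>R\<close> with
  a given root \<open>\<alpha>\<close> of \<open>p\<close>. A sign change of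
  \<open>p = m * s\<close> is one of \<open>s\<close>, of smaller degree, or one of
  \<open>m\<close>. In the latter case \<open>\<alpha>\<close> lies in \<open>R\<close>: otherwise
  \<open>m\<close> has no root in \<open>R\<close>, the descent of \<open>sos_multiple_eq_0\<close>
  makes \<open>R[\<alpha>]\<close> formally real, and maximality is contradicted. Then
  \<open>m\<close> is linear.\<close>

lemma ivt_for_all: "p \<in> pol R \<Longrightarrow> ivt_for p"
proof (induction "degree p" arbitrary: p rule: less_induct)
  case (less p)
  show ?case
    unfolding ivt_for_def
  proof (intro ballI impI)
    fix a b assume ab: "a \<in> R" "b \<in> R" and sgp: "sg R (poly p a) * sg R (poly p b) = -1"
    have p0: "p \<noteq> 0" using sgp by auto
    have "degree p \<noteq> 0"
    proof
      assume "degree p = 0"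
      then obtain c where "p = [:c:]" by (metis degree_eq_zeroE)
      then show False using sgp sg_cases[of c] by auto
    qed
    then obtain \<alpha> where \<alpha>: "poly p \<alpha> = 0" using alg_closed_imp_poly_has_root by blast
    define A where "A = {m \<in> pol R. m \<noteq> 0 \<and> poly m \<alpha> = 0}"
    have "p \<in> A" using less.prems p0 \<alpha> by (simp add: A_def)
    then obtain m where m: "m \<in> A" and m_min: "\<And>q. q \<in> A \<Longrightarrow> degree m \<le> degree q"
      using ex_has_least_nat[of "\<lambda>q. q \<in> A" p degree] by blast
    have mR: "m \<in> pol R" "m \<noteq> 0" "poly m \<alpha> = 0" using m by (auto simp: A_def)
    have m_dvd: "\<exists>s\<in>pol R. q = m * s" if q: "q \<in> pol R" "poly q \<alpha> = 0" for q
    proof -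
      obtain s r where *: "s \<in> pol R" "r \<in> pol R" "q = m * s + r" "r = 0 \<or> degree r < degree m"
        using division[OF q(1) mR(1,2)] by blast
      have "poly r \<alpha> = 0" using *(3) q(2) mR(3) by simp
      then have "r = 0" using m_min[of r] * by (cases "r = 0") (auto simp: A_def)
      then show ?thesis using * by auto
    qed
    have m_deg: "degree m \<noteq> 0"
    proof
      assume "degree m = 0"
      then obtain c where "m = [:c:]" by (metis degree_eq_zeroE)
      then show False using mR by simp
    qed
    obtain s where s: "s \<in> pol R" "p = m * s" using m_dvd[OF less.prems \<alpha>] by auto
    have s0: "s \<noteq> 0" using s p0 by auto
    have degp: "degree p = degree m + degree s" using s s0 mR by (simp add: degree_mult_eq)
    have sgp': "sg R (poly p x) = sg R (poly m x) * sg R (poly s x)" if "x \<in> R" for x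
      using s mR that by (simp add: sg_mult)
    let ?goal = "\<lambda>p. \<exists>c\<in>R. poly p c = 0 \<and> sg R (c - a) = sg R (b - a) \<and> sg R (b - c) = sg R (b - a)"
    consider "sg R (poly s a) * sg R (poly s b) = -1" | "sg R (poly m a) * sg R (poly m b) = -1"
      using sgp unfolding sgp'[OF ab(1)] sgp'[OF ab(2)]
      using sg_cases[of "poly s a"] sg_cases[of "poly s b"] sg_cases[of "poly m a"] sg_cases[of "poly m b"]
      by auto
    then show "?goal p"
    proof cases
      case 1
      have "ivt_for s" using less.hyps[of s] degp m_deg s(1) by simp
      then show ?thesis using 1 ab s unfolding ivt_for_def by auto
    next
      case 2
      have ivt: "ivt_for q" if "q \<in> pol R" "degree q < degree m" for q
        using less.hyps[of q] degp that by simp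
      have "\<alpha> \<in> R"
      proof (rule ccontr)
        assume \<alpha>R: "\<alpha> \<notin> R"
        have m_roots: "poly m c \<noteq> 0" if c: "c \<in> R" for c
        proof
          assume "poly m c = 0"
          then obtain k where k: "k \<in> pol R" "m = [:- c, 1:] * k" using root_factor[OF mR(1) c] by auto
          have "poly k \<alpha> = 0" using mR(3) k(2) \<alpha>R c by auto
          moreover have "k \<noteq> 0" using mR(2) k(2) by auto
          ultimately show False using m_min[of k] k by (simp add: A_def degree_mult_eq del: mult_pCons_left)
        qed
        \<comment> \<open>Reduction modulo \<open>m\<close> supplies representatives of degree below
          that of \<open>m\<close>, the bound from which the descent starts.\<close>
        have rep: "\<exists>v\<in>small_pol (degree m). u = poly v \<alpha>" if u: "u \<in> adjoin R \<alpha>" for u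
        proof -
          obtain p where p: "p \<in> pol R" "u = poly p \<alpha>" using u by (auto simp: adjoin_def)
          obtain t r where *: "t \<in> pol R" "r \<in> pol R" "p = m * t + r" "r = 0 \<or> degree r < degree m"
            using division[OF p(1) mR(1,2)] by blast
          then show ?thesis using p(2) mR(3) by (intro bexI[of _ r]) (auto simp: small_pol_def)
        qed
        have reps: "\<exists>S\<in>sos (small_pol (degree m)). s = poly S \<alpha>" if s: "s \<in> sos (adjoin R \<alpha>)" for s
          using s
        proof (induction rule: sos.induct)
          case zero
          then show ?case by (auto intro!: bexI[of _ 0] sos.zero)
        next
          case (add u s)
          then show ?case using rep[OF add(1)] by (metis poly_add poly_mult sos.add)
        qed
        have "formally_real (adjoin R \<alpha>)"
          unfolding formally_real_def
        proof (intro ballI impI)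
          fix u s assume us: "u \<in> adjoin R \<alpha>" "s \<in> sos (adjoin R \<alpha>)" "u * u + s = 0"
          obtain v where v: "v \<in> small_pol (degree m)" "u = poly v \<alpha>" using rep[OF us(1)] by blast
          obtain S where S: "S \<in> sos (small_pol (degree m))" "s = poly S \<alpha>" using reps[OF us(2)] by blast
          have T: "v * v + S \<in> sos (small_pol (degree m))" using v(1) S(1) by (rule sos.add)
          have "poly (v * v + S) \<alpha> = 0" using us(3) v S by simp
          then obtain q where q: "q \<in> pol R" "v * v + S = m * q"
            using m_dvd[OF sos_pol_closed[OF T small_pol_subset]] by blast
          have T0: "v * v + S = 0"
            using sos_multiple_eq_0[OF mR(1) m_roots ab 2 ivt order_refl T q] .
          \<comment> \<open>The sum \<open>v * v + S\<close> is the zero polynomial. Reality of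
            \<open>R\<close> at each of its points makes \<open>v\<close> vanish on the infinite set
            \<open>R\<close>.\<close>
          have "poly v x = 0" if x: "x \<in> R" for x
          proof (rule formally_realD[OF real])
            show "poly v x * poly v x + poly S x = 0" using T0 by (metis poly_0 poly_add poly_mult)
            show "poly S x \<in> sos R" by (rule poly_sos[OF S(1) small_pol_subset x])
            show "poly v x \<in> R" using v(1) small_pol_subset x by (meson poly_closed subsetD)
          qed
          then have "v = 0" by (rule poly_0_on_R)
          then show "u = 0" using v by simp
        qed
        then show False using max[OF mR] \<alpha>R by blast
      qed
      then have "[:- \<alpha>, 1:] \<in> A" by (simp add: A_def)
      then have "degree m = 1" using m_min[of "[:- \<alpha>, 1:]"] m_deg by simp
      moreover obtain k where k: "k \<in> pol R" "m = [:- \<alpha>, 1:] * k"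
        using root_factor[OF mR(1) \<open>\<alpha> \<in> R\<close> mR(3)] by auto
      ultimately have "degree k = 0"
        using mR(2) by (auto simp: degree_mult_eq simp del: mult_pCons_left)
      then obtain c where c: "k = [:c:]" by (metis degree_eq_zeroE)
      have cR: "c \<in> R" using k(1) c by simp
      \<comment> \<open>Now \<open>m\<close> is a constant times \<open>X - \<alpha>\<close>, so its
        sign change puts \<open>\<alpha>\<close> between \<open>a\<close> and
        \<open>b\<close>.\<close>
      have sgm: "sg R (poly m x) = sg R (x - \<alpha>) * sg R c" if "x \<in> R" for x
        using that \<open>\<alpha> \<in> R\<close> cR by (simp add: k(2) c algebra_simps flip: sg_mult)
      have opp: "sg R (b - \<alpha>) = sg R (\<alpha> - a)" "sg R (\<alpha> - a) \<noteq> 0"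
        using 2 unfolding sgm[OF ab(1)] sgm[OF ab(2)]
        using sg_cases[of c] sg_cases[of "a - \<alpha>"] sg_cases[of "b - \<alpha>"] 
          sg_minus_swap[OF \<open>\<alpha> \<in> R\<close> ab(1)]
        by auto
      have "sg R (b - a) = sg R (\<alpha> - a)"
        using sg_add_same[of "b - \<alpha>" "\<alpha> - a"] opp ab \<open>\<alpha> \<in> R\<close> by simp
      then show ?thesis using \<open>\<alpha> \<in> R\<close> \<alpha> opp by (intro bexI[of _ \<alpha>]) auto
    qed
  qed
qed

end

section \<open>Polynomials over a real closed field\<close>

text \<open>Collects what the sign comparison uses: an order given by squares, and intermediate
  values of polynomials. General suprema do not exist in such fields, so Rolle's theorem and
  monotonicity are derived by factoring polynomials.\<close>

locale rcf = euclidean_field +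
  assumes ivt: "p \<in> pol R \<Longrightarrow> a \<in> R \<Longrightarrow> b \<in> R \<Longrightarrow> sg R (poly p a) * sg R (poly p b) = -1 \<Longrightarrow>
     \<exists>c\<in>R. poly p c = 0 \<and> sg R (c - a) = sg R (b - a) \<and> sg R (b - c) = sg R (b - a)"
begin

text \<open>Symmetric in the end points, so that intervals need no orientation. For
  \<open>a = b\<close> it degenerates to \<open>c = a\<close>.\<close>

definition btw :: "'a \<Rightarrow> 'a \<Rightarrow> 'a \<Rightarrow> bool" where
  "btw a c b \<longleftrightarrow> c \<in> R \<and> sg R (c - a) = sg R (b - a) \<and> sg R (b - c) = sg R (b - a)"

lemma btw_closed: "btw a c b \<Longrightarrow> c \<in> R"
  by (simp add: btw_def)

lemma btw_sym: "a \<in> R \<Longrightarrow> b \<in> R \<Longrightarrow> btw a c b \<Longrightarrow> btw b c a"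
  using sg_minus_swap[of c a] sg_minus_swap[of b c] sg_minus_swap[of b a] by (auto simp: btw_def)

lemma btw_neq: "btw a c b \<Longrightarrow> a \<noteq> b \<Longrightarrow> c \<noteq> a \<and> c \<noteq> b"
  unfolding btw_def by (metis right_minus_eq sg_eq_0_iff)

lemma btw_trans: "a \<in> R \<Longrightarrow> b \<in> R \<Longrightarrow> btw a c b \<Longrightarrow> btw a d c \<Longrightarrow> btw a d b"
  using sg_add_same[of "b - c" "c - d"] by (auto simp: btw_def)

lemma btw_sg_left: 
  assumes "a \<in> R" "b \<in> R" "r \<in> R" "btw a c b" "sg R (a - r) = sg R (b - r)"
  shows "sg R (c - r) = sg R (a - r)"
proof -
  have c: "c \<in> R" and eq: "sg R (c - a) = sg R (b - c)" using assms by (auto simp: btw_def)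
  have 1: "sg R (c - r) = 1" if "x \<in> R" "sg R (c - x) \<ge> 0" "sg R (x - r) = 1" for x
    using sg_add_pos[of "x - r" "c - x"] that assms c by simp
  have 2: "sg R (r - c) = 1" if "x \<in> R" "sg R (x - c) \<ge> 0" "sg R (r - x) = 1" for x
    using sg_add_pos[of "r - x" "x - c"] that assms c by simp
  show ?thesis
    using 1[of a] 1[of b] 2[of a] 2[of b] sg_cases[of "a - r"] sg_cases[of "c - a"] sg_cases[of "c - b"] 
      sg_minus_swap[of a r] sg_minus_swap[of b r] sg_minus_swap[of c r] sg_minus_swap[of a c] sg_minus_swap[of b c]
      assms c eq
    by (auto simp: btw_def)
qed

lemma same_sg_if_no_root:
  assumes "p \<in> pol R" "a \<in> R" "b \<in> R" "poly p a \<noteq> 0" "poly p b \<noteq> 0"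
    "\<And>c. btw a c b \<Longrightarrow> poly p c \<noteq> 0"
  shows "sg R (poly p a) = sg R (poly p b)"
proof (rule ccontr)
  assume "sg R (poly p a) \<noteq> sg R (poly p b)"
  then have "sg R (poly p a) * sg R (poly p b) = -1"
    using sg_cases[of "poly p a"] sg_cases[of "poly p b"] assms by auto
  then show False using ivt[of p a b] assms by (auto simp: btw_def)
qed

lemma sg_inverse: "x \<in> R \<Longrightarrow> sg R (inverse x) = sg R x"
  using sg_mult[of x "inverse x"] sg_cases[of x] sg_cases[of "inverse x"] by (cases "x = 0") auto

lemma infinite_btw:
  assumes "a \<in> R" "b \<in> R" "a \<noteq> b"
  shows "infinite {c. btw a c b}"
proof -
  \<comment> \<open>The denominators start at 2, which keeps every point strictly between
    \<open>a\<close> and \<open>b\<close>.\<close>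
  define f where "f n = a + (b - a) * inverse (of_nat (Suc (Suc n)))" for n
  have "f n \<in> {c. btw a c b}" for n
  proof -
    have nz: "of_nat (Suc (Suc n)) \<noteq> (0::'a)" by (rule of_nat_Suc_neq_0)
    have *: "sg R (inverse (of_nat (Suc (Suc n)))) = 1"
      by (subst sg_inverse) (auto simp del: of_nat_Suc)
    have "b - f n = (b - a) * (of_nat (Suc n) * inverse (of_nat (Suc (Suc n))))"
      using nz unfolding f_def by (simp add: field_simps)
    then have "sg R (b - f n) = sg R (b - a)"
      using * assms by (simp add: sg_mult del: of_nat_Suc)
    moreover have "sg R (f n - a) = sg R (b - a)"
      using * assms by (simp add: f_def sg_mult del: of_nat_Suc)
    moreover have "f n \<in> R" using assms by (simp add: f_def del: of_nat_Suc)
    ultimately show ?thesis by (simp add: btw_def)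
  qed
  moreover have "inj f"
  proof (rule injI)
    fix m n assume "f m = f n"
    then have "inverse (of_nat (Suc (Suc m))) = (inverse (of_nat (Suc (Suc n))) :: 'a)"
      using assms(3) unfolding f_def by simp
    then have "of_nat (Suc (Suc m)) = (of_nat (Suc (Suc n)) :: 'a)" by (rule inverse_eq_imp_eq)
    then show "m = n" using inj_of_nat by (metis injD nat.inject)
  qed
  ultimately show ?thesis
    using range_inj_infinite finite_subset by (metis image_subsetI)
qed

lemma btw_exists: "a \<in> R \<Longrightarrow> b \<in> R \<Longrightarrow> a \<noteq> b \<Longrightarrow> \<exists>c. btw a c b"
  using infinite_btw[of a b] by (metis finite.emptyI empty_Collect_eq)

section \<open>Rolle's theorem and signs from the derivative\<close>

lemma nearest_root:
  assumes "p \<noteq> 0" "a \<in> R" "b \<in> R" "a \<noteq> b" "poly p b = 0"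
  shows "\<exists>b'\<in>R. a \<noteq> b' \<and> poly p b' = 0 \<and> (b' = b \<or> btw a b' b) \<and> (\<forall>c. btw a c b' \<longrightarrow> poly p c \<noteq> 0)"
  using assms(3-)
\<comment> \<open>Induction on the number of roots strictly between \<open>a\<close> and
  \<open>b\<close>: as long as there is one, it takes the place of \<open>b\<close>.\<close>
proof (induction "card {c. btw a c b \<and> poly p c = 0}" arbitrary: b rule: less_induct)
  case (less b)
  show ?case
  proof (cases "\<forall>c. btw a c b \<longrightarrow> poly p c \<noteq> 0")
    case False
    then obtain c where c: "btw a c b" "poly p c = 0" by auto
    have cR: "c \<in> R" "a \<noteq> c" using c btw_closed btw_neq[OF c(1) less.prems(2)] by auto
    have "{d. btw a d c \<and> poly p d = 0} \<subset> {d. btw a d b \<and> poly p d = 0}"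
      using c btw_trans[OF assms(2) less.prems(1) c(1)] btw_neq[of a c c] cR by auto
    moreover have "finite {d. btw a d b \<and> poly p d = 0}"
      using poly_roots_finite[OF assms(1)] by (rule finite_subset[rotated]) auto
    ultimately have "card {d. btw a d c \<and> poly p d = 0} < card {d. btw a d b \<and> poly p d = 0}"
      by (rule psubset_card_mono[rotated])
    from less.hyps[OF this cR(1,2) c(2)] show ?thesis
      using c btw_trans[OF assms(2) less.prems(1) c(1)] by blast
  qed (use less.prems in blast)
qed

lemma root_power_factor:
  assumes "p \<in> pol R" "p \<noteq> 0" "a \<in> R"
  shows "\<exists>m. \<exists>q\<in>pol R. p = [:- a, 1:] ^ m * q \<and> poly q a \<noteq> 0"
  using assms
proof (induction "degree p" arbitrary: p rule: less_induct)
  case (less p)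
  show ?case
  proof (cases "poly p a = 0")
    case False
    then show ?thesis using less.prems by (intro exI[of _ 0] bexI[of _ p]) auto
  next
    case True
    then obtain s where s: "s \<in> pol R" "p = [:- a, 1:] * s" using root_factor less.prems by blast
    then have "s \<noteq> 0" using less.prems by auto
    then have "degree s < degree p"
      using degree_mult_eq[of "[:- a, 1:]" s] unfolding s(2)[symmetric] by simp
    from less.hyps[OF this s(1) \<open>s \<noteq> 0\<close> less.prems(3)] obtain m q
      where "q \<in> pol R" "s = [:- a, 1:] ^ m * q" "poly q a \<noteq> 0" by auto
    then show ?thesis using s by (intro exI[of _ "Suc m"] bexI[of _ q]) (auto simp: mult.assoc simp del: mult_pCons_left)
  qed
qed

text \<open>With \<open>d\<close> the root nearest to \<open>a\<close> on the way to
  \<open>b\<close>, write \<open>p = (X - a)^m (X - d)^n g\<close>, where \<open>g\<close> keeps its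
  sign from \<open>a\<close> to \<open>d\<close>. Then
  \<open>p' = (X - a)^(m-1) (X - d)^(n-1) k\<close>, and \<open>k\<close> has opposite signs at
  \<open>a\<close> and \<open>d\<close>, hence a root between them.\<close>

lemma rolle:
  assumes p: "p \<in> pol R" "p \<noteq> 0" and ab: "a \<in> R" "b \<in> R" "a \<noteq> b" "poly p a = 0" "poly p b = 0"
  shows "\<exists>c. btw a c b \<and> poly (pderiv p) c = 0"
proof -
  obtain d where d: "d \<in> R" "a \<noteq> d" "poly p d = 0" "d = b \<or> btw a d b" 
     "\<And>c. btw a c d \<Longrightarrow> poly p c \<noteq> 0"
    using nearest_root[of p a b] assms by blast
  obtain m q where q: "q \<in> pol R" "p = [:- a, 1:] ^ m * q" "poly q a \<noteq> 0"
    using root_power_factor[OF p ab(1)] by blast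
  have "m \<noteq> 0" using q ab by auto
  then obtain i where i: "m = Suc i" by (cases m) auto
  have "q \<noteq> 0" using q by auto
  obtain n g where g: "g \<in> pol R" "q = [:- d, 1:] ^ n * g" "poly g d \<noteq> 0"
    using root_power_factor[OF q(1) \<open>q \<noteq> 0\<close> d(1)] by blast
  have "poly q d = 0" using d(2,3) q(2) by simp
  then have "n \<noteq> 0" using g by auto
  then obtain j where j: "n = Suc j" by (cases n) auto
  \<comment> \<open>At \<open>a\<close> only the first summand survives, at \<open>d\<close> only
    the second.\<close>
  define k where "k = smult (of_nat (Suc i)) ([:- d, 1:] * g) + smult (of_nat (Suc j)) ([:- a, 1:] * g)
     + [:- a, 1:] * [:- d, 1:] * pderiv g"
  have kR: "k \<in> pol R" unfolding k_def using g d(1) ab(1)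
    by (intro pol_add pol_smult pol_mult pol_pderiv of_nat_closed) auto
  have deriv: "pderiv p = [:- a, 1:] ^ i * [:- d, 1:] ^ j * k"
    unfolding q(2) g(2) i j k_def pderiv_mult pderiv_power_Suc
    by (simp add: pderiv_pCons algebra_simps smult_add_right flip: one_pCons del: mult_pCons_left mult_pCons_right of_nat_Suc)
  have ka: "sg R (poly k a) = - (sg R (d - a) * sg R (poly g a))"
  proof -
    have "poly k a = of_nat (Suc i) * ((a - d) * poly g a)" by (simp add: k_def algebra_simps del: of_nat_Suc)
    then show ?thesis
      using ab(1) d(1) g(1) sg_minus_swap[of a d] by (simp add: sg_mult del: of_nat_Suc)
  qed
  have kd: "sg R (poly k d) = sg R (d - a) * sg R (poly g d)"
  proof -
    have "poly k d = of_nat (Suc j) * ((d - a) * poly g d)" by (simp add: k_def algebra_simps del: of_nat_Suc)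
    then show ?thesis
      using ab(1) d(1) g(1) by (simp add: sg_mult del: of_nat_Suc)
  qed
  have ga: "poly g a \<noteq> 0" using q(3) g(2) by auto
  have "poly g c \<noteq> 0" if "btw a c d" for c
    using d(5)[OF that] q(2) g(2) by auto
  then have "sg R (poly g a) = sg R (poly g d)"
    using same_sg_if_no_root g ga ab(1) d(1) by blast
  then have "sg R (poly k a) * sg R (poly k d) = -1"
    using ka kd sg_cases[of "d - a"] sg_cases[of "poly g d"] d(2) g(3) by auto
  then obtain c where c: "poly k c = 0" "btw a c d"
    using ivt[OF kR ab(1) d(1)] by (auto simp: btw_def)
  then have "btw a c b" using d(4) btw_trans ab by blast
  then show ?thesis using c(1) deriv by auto
qed

text \<open>A substitute for the mean value theorem. In \<open>p = (X - z)^m q\<close> and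
  \<open>p' = (X - z)^(m-1) k\<close> the cofactors satisfy \<open>k(z) = m q(z)\<close>, and
  neither changes sign from \<open>z\<close> to \<open>x\<close>: for \<open>q\<close> because of
  Rolle, for \<open>k\<close> by the assumption on \<open>p'\<close>.\<close>

lemma sg_by_derivative:
  assumes p: "p \<in> pol R" "p \<noteq> 0" and zx: "z \<in> R" "x \<in> R" "z \<noteq> x" "poly p z = 0"
    and deriv: "poly (pderiv p) x \<noteq> 0" "\<And>c. btw z c x \<Longrightarrow> poly (pderiv p) c \<noteq> 0"
  shows "sg R (poly p x) = sg R (x - z) * sg R (poly (pderiv p) x)"
proof -
  obtain m q where q: "q \<in> pol R" "p = [:- z, 1:] ^ m * q" "poly q z \<noteq> 0"
    using root_power_factor[OF p zx(1)] by blast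
  have "m \<noteq> 0" using q zx by auto
  then obtain i where i: "m = Suc i" by (cases m) auto
  define k where "k = smult (of_nat (Suc i)) q + [:- z, 1:] * pderiv q"
  have kR: "k \<in> pol R" unfolding k_def using q zx
    by (intro pol_add pol_smult pol_mult pol_pderiv of_nat_closed) auto
  have pd: "pderiv p = [:- z, 1:] ^ i * k"
    unfolding q(2) i k_def pderiv_mult pderiv_power_Suc
    by (simp add: pderiv_pCons algebra_simps smult_add_right flip: one_pCons del: mult_pCons_left mult_pCons_right of_nat_Suc)
  have px: "poly p x \<noteq> 0"
    using rolle[OF p zx(1-4)] deriv(2) by blast
  have pc: "poly p c \<noteq> 0" if c: "btw z c x" for c
    using rolle[OF p zx(1) btw_closed[OF c] _ zx(4)] btw_neq[OF c zx(3)] deriv(2) btw_trans[OF zx(1,2) c] by metis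
  have "sg R (poly q z) = sg R (poly q x)"
    using q px pc by (intro same_sg_if_no_root zx) auto
  moreover have "poly k z = of_nat (Suc i) * poly q z" by (simp add: k_def del: of_nat_Suc)
  then have kz: "sg R (poly k z) = sg R (poly q z)" "poly k z \<noteq> 0"
    using q(1,3) zx of_nat_Suc_neq_0[of i] by (simp_all add: sg_mult del: of_nat_Suc)
  have "sg R (poly k z) = sg R (poly k x)"
    using kR kz(2) deriv pd by (intro same_sg_if_no_root zx) auto
  ultimately have eq: "sg R (poly q x) = sg R (poly k x)" using kz by simp
  have "poly p x = (x - z) ^ Suc i * poly q x"
    unfolding q(2) i by (simp del: power_Suc)
  then have "sg R (poly p x) = sg R (x - z) ^ Suc i * sg R (poly q x)"
    using q(1) zx by (simp add: sg_mult sg_power del: power_Suc)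
  moreover have "sg R (poly (pderiv p) x) = sg R (x - z) ^ i * sg R (poly k x)"
    using kR zx pd by (simp add: sg_mult sg_power)
  ultimately show ?thesis by (simp add: eq mult.assoc)
qed

section \<open>Bounds of finite sets and signs near infinity\<close>

lemma finite_has_max:
  assumes "finite S" "S \<noteq> {}" "S \<subseteq> R" shows "\<exists>m\<in>S. \<forall>s\<in>S. sg R (m - s) \<ge> 0"
  using assms
proof (induction rule: finite_ne_induct)
  case (insert x F)
  then obtain m where m: "m \<in> F" "\<forall>s\<in>F. sg R (m - s) \<ge> 0" by auto
  have R: "x \<in> R" "m \<in> R" "F \<subseteq> R" using insert m by auto
  show ?case
  proof (cases "sg R (m - x) \<ge> 0")
    case False
    then have "sg R (x - m) = 1" using sg_minus_swap[of m x] sg_cases[of "x - m"] R by auto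
    then have "sg R (x - s) \<ge> 0" if "s \<in> F" for s
      using sg_diff_trans[of x m s] R m that by auto
    then show ?thesis by auto
  qed (use m in auto)
qed auto

lemma finite_has_min:
  assumes "finite S" "S \<noteq> {}" "S \<subseteq> R" shows "\<exists>m\<in>S. \<forall>s\<in>S. sg R (s - m) \<ge> 0"
proof -
  have "\<exists>m\<in>uminus ` S. \<forall>s\<in>uminus ` S. sg R (m - s) \<ge> 0"
    using assms by (intro finite_has_max) auto
  then show ?thesis by (auto simp: add.commute)
qed

lemma upper_bound:
  assumes "finite S" "S \<subseteq> R" shows "\<exists>u\<in>R. \<forall>s\<in>S. sg R (u - s) = 1"
proof (cases "S = {}")
  case False
  obtain m where m: "m \<in> S" "\<forall>s\<in>S. sg R (m - s) \<ge> 0" using finite_has_max assms False by blast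
  have "sg R (m + 1 - s) = 1" if "s \<in> S" for s
  proof -
    have "m \<in> R" "s \<in> R" using m assms that by auto
    then show ?thesis using sg_add_pos[of 1 "m - s"] m that by (simp add: algebra_simps)
  qed
  then show ?thesis using m assms by (intro bexI[of _ "m + 1"]) auto
qed (use one_closed in blast)

text \<open>A statement about the sign alone would not survive the induction over the coefficients,
  since adding \<open>c\<close> may spoil it. The constant positive lower bound \<open>e\<close>
  survives.\<close>

lemma poly_large:
  assumes "p \<in> pol R" "p \<noteq> 0"
  shows "\<exists>B\<in>R. \<exists>e\<in>R. sg R e = 1 \<and> (\<forall>x\<in>R. sg R (x - B) \<ge> 0 \<longrightarrow> sg R (poly p x * lead_coeff p - e) \<ge> 0)"
  using assms
proof (induction p)
  case (pCons c q)
  show ?case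
  proof (cases "q = 0")
    case True
    then show ?thesis using pCons
      by (intro bexI[of _ 0] bexI[of _ "c * c"]) (auto simp: sg_square)
  next
    case False
    have qR: "q \<in> pol R" "c \<in> R" using pCons by auto
    define l where "l = lead_coeff q"
    have l: "l \<in> R" using qR by (simp add: l_def pol_coeff)
    obtain B e where B: "B \<in> R" "e \<in> R" "sg R e = 1" 
      "\<And>x. x \<in> R \<Longrightarrow> sg R (x - B) \<ge> 0 \<Longrightarrow> sg R (poly q x * l - e) \<ge> 0"
      using pCons.IH qR False by (auto simp: l_def)
    have e0: "e \<noteq> 0" using B(3) by auto
    \<comment> \<open>From \<open>C\<close> on one has \<open>e * x + c * l \<ge> e\<close>, so the
      bound \<open>e\<close> of \<open>q\<close> serves again.\<close>
    define C where "C = 1 - c * l / e"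
    have C: "C \<in> R" using B qR l by (auto simp: C_def)
    obtain u where u: "u \<in> R" "\<forall>s\<in>{0, B, C}. sg R (u - s) = 1"
      using upper_bound[of "{0, B, C}"] B C by auto
    have "sg R (poly (pCons c q) x * lead_coeff (pCons c q) - e) \<ge> 0" 
      if x: "x \<in> R" "sg R (x - u) \<ge> 0" for x
    proof -
      have gt: "sg R (x - s) = 1" if "s \<in> {0, B, C}" for s
        using sg_diff_trans'[of x u s] x u that B C by auto
      have "poly (pCons c q) x * lead_coeff (pCons c q) - e = e * (x - C) + x * (poly q x * l - e)"
        using e0 False by (simp add: C_def l_def field_simps)
      moreover have "sg R (e * (x - C)) = 1" using gt[of C] B C x by (simp add: sg_mult)
      moreover have "sg R (x * (poly q x * l - e)) \<ge> 0"
        using gt[of 0] gt[of B] B(4)[of x] B l qR x by (simp add: sg_mult)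
      ultimately show ?thesis
        using sg_add_pos[of "e * (x - C)" "x * (poly q x * l - e)"] B C x l qR by simp
    qed
    then show ?thesis using u B by blast
  qed
qed simp

lemma sg_at_top:
  assumes "p \<in> pol R" "p \<noteq> 0"
  shows "\<exists>B\<in>R. \<forall>x\<in>R. sg R (x - B) \<ge> 0 \<longrightarrow> sg R (poly p x) = sg R (lead_coeff p)"
proof -
  obtain B e where B: "B \<in> R" "e \<in> R" "sg R e = 1" 
    "\<And>x. x \<in> R \<Longrightarrow> sg R (x - B) \<ge> 0 \<Longrightarrow> sg R (poly p x * lead_coeff p - e) \<ge> 0"
    using poly_large[OF assms] by auto
  have l: "lead_coeff p \<in> R" using assms by (simp add: pol_coeff)
  have "sg R (poly p x) = sg R (lead_coeff p)" if "x \<in> R" "sg R (x - B) \<ge> 0" for x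
  proof -
    have "sg R (poly p x * lead_coeff p) = 1"
      using sg_add_pos[of e "poly p x * lead_coeff p - e"] B that l assms by simp
    then have "sg R (poly p x) * sg R (lead_coeff p) = 1"
      using sg_mult[of "poly p x" "lead_coeff p"] l assms that by simp
    then show ?thesis using sg_cases[of "poly p x"] sg_cases[of "lead_coeff p"] by auto
  qed
  then show ?thesis using B by blast
qed

lemma sg_at_bot:
  assumes "p \<in> pol R" "p \<noteq> 0"
  shows "\<exists>B\<in>R. \<forall>x\<in>R. sg R (B - x) \<ge> 0 \<longrightarrow> sg R (poly p x) = (- 1) ^ degree p * sg R (lead_coeff p)"
proof -
  define q where "q = pcompose p [:0, - 1:]"
  have "q \<in> pol R" unfolding q_def using assms(1)
    by (induction p) (auto simp: pcompose_pCons)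
  moreover have lq: "lead_coeff q = lead_coeff p * (- 1) ^ degree p"
    unfolding q_def by (subst lead_coeff_comp) auto
  moreover have "q \<noteq> 0" using lq assms by auto
  ultimately obtain B where B: "B \<in> R" "\<And>x. x \<in> R \<Longrightarrow> sg R (x - B) \<ge> 0 \<Longrightarrow> sg R (poly q x) = sg R (lead_coeff q)"
    using sg_at_top by blast
  have l: "lead_coeff p \<in> R" using assms by (simp add: pol_coeff)
  have "sg R (poly p x) = (- 1) ^ degree p * sg R (lead_coeff p)" if "x \<in> R" "sg R (- B - x) \<ge> 0" for x
  proof -
    have "sg R (poly q (- x)) = sg R (lead_coeff q)"
    proof (rule B(2))
      have "- x - B = - B - x" by simp
      then show "sg R (- x - B) \<ge> 0" using that(2) by metis
    qed (use that in auto)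
    moreover have "poly q (- x) = poly p x" by (simp add: q_def poly_pcompose)
    ultimately show ?thesis using lq l by (simp add: sg_mult sg_power sg_uminus)
  qed
  then show ?thesis using B(1) by (intro bexI[of _ "- B"]) auto
qed

end

sublocale real_closed_subring \<subseteq> rcf
  using ivt_for_all by unfold_locales (simp add: ivt_for_def)

context rcf begin

lemma lower_bound:
  assumes "finite S" "S \<subseteq> R" shows "\<exists>u\<in>R. \<forall>s\<in>S. sg R (s - u) = 1"
proof -
  have "\<exists>u\<in>R. \<forall>s\<in>uminus ` S. sg R (u - s) = 1"
    using assms by (intro upper_bound) auto
  then obtain u where u: "u \<in> R" "\<forall>s\<in>S. sg R (u + s) = 1" by auto
  then show ?thesis by (intro bexI[of _ "- u"]) (auto simp: add.commute)
qed

lemma sg_outside_interval: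
  assumes R: "a \<in> R" "b \<in> R" "sg R (b - a) = 1" and c: "btw a c b" and z: "z \<in> R"
    "sg R (a - z) \<ge> 0 \<or> sg R (z - b) \<ge> 0"
  shows "sg R (c - z) = (if sg R (a - z) \<ge> 0 then 1 else -1)"
proof -
  have *: "c \<in> R" "sg R (c - a) = 1" "sg R (b - c) = 1" using c R by (auto simp: btw_def)
  show ?thesis
    using sg_diff_trans[of c a z] sg_diff_trans'[of z b c] sg_minus_swap[of c z] * R z by auto
qed

lemma btw_convex:
  assumes R: "a \<in> R" "b \<in> R" "a \<noteq> b" and x: "btw a x b" and z: "z = a \<or> z = b \<or> btw a z b"
    and c: "btw z c x"
  shows "btw a c b"
proof -
  have zR: "z \<in> R" "c \<in> R" "x \<in> R" using R z c x btw_closed by auto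
  have 1: "sg R (c - a) = sg R (x - a)" if "z \<noteq> a"
  proof -
    have "sg R (z - a) = sg R (x - a)"
      using that z x by (auto simp: btw_def)
    then show ?thesis using btw_sg_left[OF zR(1,3) R(1) c] by simp
  qed
  have 2: "sg R (c - b) = sg R (x - b)" if "z \<noteq> b"
  proof -
    have "sg R (z - b) = sg R (x - b)"
      using that z x zR R sg_minus_swap[of _ b] by (auto simp: btw_def)
    then show ?thesis using btw_sg_left[OF zR(1,3) R(2) c] by simp
  qed
  consider "z = a" | "z = b" | "z \<noteq> a" "z \<noteq> b" by blast
  then show ?thesis
  proof cases
    case 1
    then show ?thesis using btw_trans[OF R(1,2) x] c by blast
  next
    case 2
    then show ?thesis using btw_trans[OF R(2,1) btw_sym[OF R(1,2) x]] c btw_sym R by blast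
  next
    case 3
    then show ?thesis using 1 2 x zR R sg_minus_swap[of _ b] by (auto simp: btw_def)
  qed
qed

text \<open>As \<open>p'\<close> has no zero inside, \<open>z\<close> is a simple root, and by Rolle
  it is the only one on the closed interval. The cofactor of \<open>X - z\<close> therefore keeps
  its sign.\<close>

lemma root_sign_change:
  assumes p: "p \<in> pol R" "p \<noteq> 0" and ab: "a \<in> R" "b \<in> R" "a \<noteq> b" "poly p z = 0" "btw a z b"
    and deriv: "\<And>c. btw a c b \<Longrightarrow> poly (pderiv p) c \<noteq> 0"
  shows "sg R (poly p a) * sg R (poly p b) = -1"
proof -
  have z: "z \<in> R" "z \<noteq> a" "z \<noteq> b" using ab btw_neq btw_closed by blast+
  obtain q where q: "q \<in> pol R" "p = [:- z, 1:] * q" using root_factor[OF p(1) z(1) ab(4)] by blast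
  have "poly (pderiv p) z = poly q z" unfolding q(2) pderiv_mult by (simp add: pderiv_pCons)
  then have qz: "poly q z \<noteq> 0" using deriv[OF ab(5)] by simp
  have nz: "poly q c \<noteq> 0" if c: "c \<in> R" "c = a \<or> c = b \<or> btw a c b" for c
  proof
    assume "poly q c = 0"
    then have "c \<noteq> z" "poly p c = 0" using qz q(2) by auto
    then obtain d where d: "btw c d z" "poly (pderiv p) d = 0" using rolle[OF p c(1) z(1)] ab(4) by blast
    then show False using deriv[OF btw_convex[OF ab(1-3,5) c(2) d(1)]] by simp
  qed
  have "sg R (poly q a) = sg R (poly q b)"
    using nz btw_closed ab(1,2) q(1) by (intro same_sg_if_no_root) auto
  moreover have "sg R (poly p x) = sg R (x - z) * sg R (poly q x)" if "x \<in> R" for x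
    using q z(1) that by (simp add: left_diff_distrib flip: sg_mult)
  moreover have "sg R (a - z) = - sg R (b - z)"
    using ab z sg_minus_swap[of a z] by (auto simp: btw_def)
  ultimately show ?thesis
    using nz[of b] z(3) ab(1,2) sg_cases[of "b - z"] sg_cases[of "poly q b"] by auto
qed

end


section \<open>Sign diagrams\<close>

text \<open>\<open>Z\<close> marks points on two lines in pairs; \<open>x\<close> has the same
  position among the left points as \<open>y\<close> among the right ones. Sign 0 covers the case
  that \<open>x\<close> is itself marked.\<close>

definition sim :: "'a::idom set \<Rightarrow> 'b::idom set \<Rightarrow> ('a \<times> 'b) set \<Rightarrow> 'a \<Rightarrow> 'b \<Rightarrow> bool" where
  "sim R1 R2 Z x y \<longleftrightarrow> (\<forall>z w. (z, w) \<in> Z \<longrightarrow> sg R1 (x - z) = sg R2 (y - w))"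

text \<open>In Euclidean fields the mutual similarity of the pairs makes \<open>Z\<close> the graph
  of an order isomorphism between two finite sets.\<close>

definition matching :: "'a::idom set \<Rightarrow> 'b::idom set \<Rightarrow> ('a \<times> 'b) set \<Rightarrow> bool" where
  "matching R1 R2 Z \<longleftrightarrow> finite Z \<and> Z \<subseteq> R1 \<times> R2 \<and> (\<forall>z w. (z, w) \<in> Z \<longrightarrow> sim R1 R2 Z z w)"

text \<open>A common sign table: the signs depend only on the position relative to \<open>Z\<close>.
  Marked points have to be roots of members of \<open>T\<close>, so that a further polynomial can be
  replaced there by a remainder.\<close>

definition diagram :: "'a::idom set \<Rightarrow> 'b::idom set \<Rightarrow> ('a poly \<times> 'b poly) set \<Rightarrow> ('a \<times> 'b) set \<Rightarrow> bool" where
  "diagram R1 R2 T Z \<longleftrightarrow> matching R1 R2 Z \<and> (\<forall>z w. (z, w) \<in> Z \<longrightarrow> (\<exists>p q. (p, q) \<in> T \<and> poly p z = 0)) \<and>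
     (\<forall>x y p q. x \<in> R1 \<longrightarrow> y \<in> R2 \<longrightarrow> sim R1 R2 Z x y \<longrightarrow> (p, q) \<in> T \<longrightarrow> sg R1 (poly p x) = sg R2 (poly q y))"

lemma sim_converse: "sim R2 R1 (Z\<inverse>) y x \<longleftrightarrow> sim R1 R2 Z x y"
  unfolding sim_def converse_iff by metis

lemma matching_converse: "matching R1 R2 Z \<Longrightarrow> matching R2 R1 (Z\<inverse>)"
  unfolding matching_def sim_converse converse_iff by auto

lemma simD: "sim R1 R2 Z x y \<Longrightarrow> (z, w) \<in> Z \<Longrightarrow> sg R1 (x - z) = sg R2 (y - w)"
  by (auto simp: sim_def)

lemma sim_mono: "sim R1 R2 Z x y \<Longrightarrow> Z' \<subseteq> Z \<Longrightarrow> sim R1 R2 Z' x y"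
  by (auto simp: sim_def)

section \<open>Cells of a matching and outer points\<close>

locale rcf_pair = A: rcf R1 + B: rcf R2 for R1 :: "'a::field set" and R2 :: "'b::field set"
begin

abbreviation "similar \<equiv> sim R1 R2"

text \<open>Singles out the bounded cells, where the intermediate value property applies. The two
  unbounded cells are made bounded by adding outer points.\<close>

definition enclosed :: "('a \<times> 'b) set \<Rightarrow> 'a \<Rightarrow> bool" where
  "enclosed Z x \<longleftrightarrow> (\<exists>(r, r')\<in>Z. sg R1 (x - r) = 1) \<and> (\<exists>(s, s')\<in>Z. sg R1 (s - x) = 1)"

text \<open>\<open>(r, r')\<close> and \<open>(s, s')\<close> are the marked neighbours of
  \<open>x\<close>. The last three clauses follow from this and are bundled, so that they are proved
  only once, in \<open>gap\<close>.\<close>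

definition is_gap :: "('a \<times> 'b) set \<Rightarrow> 'a \<Rightarrow> 'a \<Rightarrow> 'b \<Rightarrow> 'a \<Rightarrow> 'b \<Rightarrow> bool" where
  "is_gap Z x r r' s s' \<longleftrightarrow> (r, r') \<in> Z \<and> (s, s') \<in> Z \<and> A.btw r x s \<and> r \<noteq> s \<and> r' \<noteq> s' \<and>
    (\<forall>c d. A.btw r c s \<longrightarrow> B.btw r' d s' \<longrightarrow> similar Z c d) \<and>
    (\<forall>d. d \<in> R2 \<longrightarrow> similar Z x d \<longrightarrow> B.btw r' d s') \<and>
    (\<forall>c d z w. A.btw r c s \<longrightarrow> A.btw r d s \<longrightarrow> (z, w) \<in> Z \<longrightarrow> sg R1 (c - z) = sg R1 (d - z))"

lemma is_gapD:
  assumes "is_gap Z x r r' s s'"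
  shows "(r, r') \<in> Z" "(s, s') \<in> Z" "A.btw r x s" "r \<noteq> s" "r' \<noteq> s'"
    "\<And>c d. A.btw r c s \<Longrightarrow> B.btw r' d s' \<Longrightarrow> similar Z c d"
    "\<And>d. d \<in> R2 \<Longrightarrow> similar Z x d \<Longrightarrow> B.btw r' d s'"
    "\<And>c d z w. A.btw r c s \<Longrightarrow> A.btw r d s \<Longrightarrow> (z, w) \<in> Z \<Longrightarrow> sg R1 (c - z) = sg R1 (d - z)"
  using assms unfolding is_gap_def by blast+

lemma gap:
  assumes Z: "matching R1 R2 Z" and x: "x \<in> R1" "\<And>w. (x, w) \<notin> Z" and encl: "enclosed Z x"
  shows "\<exists>r r' s s'. is_gap Z x r r' s s'"
proof -
  have fin: "finite Z" and ZR: "Z \<subseteq> R1 \<times> R2" using Z by (auto simp: matching_def)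
  define Lo where "Lo = fst ` {(z, w) \<in> Z. sg R1 (x - z) = 1}"
  define Up where "Up = fst ` {(z, w) \<in> Z. sg R1 (z - x) = 1}"
  have LU: "finite Lo" "Lo \<noteq> {}" "Lo \<subseteq> R1" "finite Up" "Up \<noteq> {}" "Up \<subseteq> R1"
    using fin ZR encl by (auto simp: Lo_def Up_def enclosed_def intro!: finite_imageI elim: finite_subset[rotated])
  obtain r where r: "r \<in> Lo" "\<forall>s\<in>Lo. sg R1 (r - s) \<ge> 0" using A.finite_has_max[OF LU(1-3)] by blast
  obtain s where s: "s \<in> Up" "\<forall>z\<in>Up. sg R1 (z - s) \<ge> 0" using A.finite_has_min[OF LU(4-6)] by blast
  obtain r' where r': "(r, r') \<in> Z" "sg R1 (x - r) = 1" using r by (auto simp: Lo_def)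
  obtain s' where s': "(s, s') \<in> Z" "sg R1 (s - x) = 1" using s by (auto simp: Up_def)
  have R: "r \<in> R1" "s \<in> R1" "r' \<in> R2" "s' \<in> R2" using r' s' ZR by auto
  have rs: "sg R1 (s - r) = 1" using A.sg_diff_trans[of s x r] R x r' s' by simp
  have match: "sg R1 (z - z2) = sg R2 (w - w2)" if "(z, w) \<in> Z" "(z2, w2) \<in> Z" for z w z2 w2
    using Z that by (auto simp: matching_def sim_def)
  have rs': "sg R2 (s' - r') = 1" using match[OF s'(1) r'(1)] rs by simp
  \<comment> \<open>By the extremal choice of \<open>r\<close> and \<open>s\<close> no marked point
    lies strictly between them.\<close>
  have dich: "sg R1 (r - z) \<ge> 0 \<or> sg R1 (z - s) \<ge> 0" if zw: "(z, w) \<in> Z" for z w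
  proof -
    have "z \<noteq> x" using x(2) zw by auto
    moreover have "z \<in> R1" using zw ZR by auto
    ultimately have "sg R1 (x - z) = 1 \<or> sg R1 (z - x) = 1"
      using A.sg_cases[of "x - z"] A.sg_minus_swap[of x z] x by auto
    moreover have "z \<in> Lo" if "sg R1 (x - z) = 1"
      unfolding Lo_def using zw that by (intro image_eqI[of _ fst "(z, w)"]) auto
    moreover have "z \<in> Up" if "sg R1 (z - x) = 1"
      unfolding Up_def using zw that by (intro image_eqI[of _ fst "(z, w)"]) auto
    ultimately show ?thesis using r s by blast
  qed
  have side1: "sg R1 (c - z) = (if sg R1 (r - z) \<ge> 0 then 1 else -1)" 
    if "A.btw r c s" "(z, w) \<in> Z" for c z w
    using A.sg_outside_interval[OF R(1,2) rs that(1) _ dich[OF that(2)]] that(2) ZR by blast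
  have side2: "sg R2 (d - w) = (if sg R1 (r - z) \<ge> 0 then 1 else -1)" 
    if "B.btw r' d s'" "(z, w) \<in> Z" for d z w
    using B.sg_outside_interval[OF R(3,4) rs' that(1), of w] dich[OF that(2)] that(2) ZR
      match[OF r'(1) that(2)] match[OF that(2) s'(1)] by auto
  have "is_gap Z x r r' s s'"
    unfolding is_gap_def
  proof (intro conjI allI impI)
    show "A.btw r x s" using x r' s' rs by (simp add: A.btw_def)
    show "r \<noteq> s" "r' \<noteq> s'" using rs rs' by auto
    show "similar Z c d" if "A.btw r c s" "B.btw r' d s'" for c d
      using side1[OF that(1)] side2[OF that(2)] by (auto simp: sim_def)
    show "B.btw r' d s'" if "d \<in> R2" "similar Z x d" for d
      using simD[OF that(2) r'(1)] simD[OF that(2) s'(1)] r' s' rs' that R 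
        B.sg_minus_swap[of s' d] A.sg_minus_swap[of s x] x by (simp add: B.btw_def)
    show "sg R1 (c - z) = sg R1 (d - z)" if "A.btw r c s" "A.btw r d s" "(z, w) \<in> Z" for c d z w
      using side1[OF that(1,3)] side1[OF that(2,3)] by simp
  qed (use r' s' in blast)+
  then show ?thesis by blast
qed

end

lemma (in rcf) bounds_with_sign:
  assumes S: "finite S" "S \<subseteq> R" and p: "p \<in> pol R" "p \<noteq> 0"
  obtains l u where "l \<in> R" "u \<in> R" "sg R (u - l) = 1" "sg R (l - u) = -1"
    "\<And>s. s \<in> S \<Longrightarrow> sg R (u - s) = 1 \<and> sg R (s - u) = -1 \<and> sg R (s - l) = 1 \<and> sg R (l - s) = -1"
    "sg R (poly p u) = sg R (lead_coeff p)" "sg R (poly p l) = (- 1) ^ degree p * sg R (lead_coeff p)"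
proof -
  obtain t where t: "t \<in> R" "\<And>x. x \<in> R \<Longrightarrow> sg R (x - t) \<ge> 0 \<Longrightarrow> sg R (poly p x) = sg R (lead_coeff p)"
    using sg_at_top[OF p] by blast
  obtain b where b: "b \<in> R" 
    "\<And>x. x \<in> R \<Longrightarrow> sg R (b - x) \<ge> 0 \<Longrightarrow> sg R (poly p x) = (- 1) ^ degree p * sg R (lead_coeff p)"
    using sg_at_bot[OF p] by blast
  define Q where "Q = insert b (insert t S)"
  have Q: "finite Q" "Q \<subseteq> R" using S t b by (auto simp: Q_def)
  obtain u where u: "u \<in> R" "\<forall>s\<in>Q. sg R (u - s) = 1" using upper_bound[OF Q] by blast
  obtain l where l: "l \<in> R" "\<forall>s\<in>insert u Q. sg R (s - l) = 1" using lower_bound[of "insert u Q"] Q u by auto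
  show thesis
  proof (rule that[OF l(1) u(1)])
    show ul: "sg R (u - l) = 1" using l by simp
    show "sg R (l - u) = -1" using ul sg_minus_swap[of l u] l u by simp
    show "sg R (u - s) = 1 \<and> sg R (s - u) = -1 \<and> sg R (s - l) = 1 \<and> sg R (l - s) = -1" if "s \<in> S" for s
      using that u l S sg_minus_swap[of s u] sg_minus_swap[of l s] by (auto simp: Q_def)
    show "sg R (poly p u) = sg R (lead_coeff p)" using t u by (auto simp: Q_def)
    show "sg R (poly p l) = (- 1) ^ degree p * sg R (lead_coeff p)" using b l by (auto simp: Q_def)
  qed
qed

text \<open>Far out the sign of a polynomial depends only on its degree and the sign of its leading
  coefficient, and these agree for \<open>f1\<close> and \<open>f2\<close>. The outer pairs are in
  general no roots; they are scaffolding for a proof and do not enter a diagram.\<close>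

lemma (in rcf_pair) matching_add_bounds:
  assumes Z: "matching R1 R2 Z" and S: "finite S1" "S1 \<subseteq> R1" "finite S2" "S2 \<subseteq> R2"
    and f1: "f1 \<in> pol R1" "f1 \<noteq> 0" and f2: "f2 \<in> pol R2" "f2 \<noteq> 0"
    and deg: "degree f1 = degree f2" and lc: "sg R1 (lead_coeff f1) = sg R2 (lead_coeff f2)"
  obtains Z0 where "matching R1 R2 Z0" "Z \<subseteq> Z0"
    "\<And>z w. (z, w) \<in> Z0 - Z \<Longrightarrow> sg R1 (poly f1 z) = sg R2 (poly f2 w)"
    "\<And>x. x \<in> S1 \<Longrightarrow> enclosed Z0 x"
    "\<And>x y. x \<in> S1 \<Longrightarrow> y \<in> S2 \<Longrightarrow> similar Z x y \<Longrightarrow> similar Z0 x y"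
proof -
  have fin: "finite Z" and ZR: "Z \<subseteq> R1 \<times> R2" using Z by (auto simp: matching_def)
  define Q1 where "Q1 = S1 \<union> fst ` Z"
  define Q2 where "Q2 = S2 \<union> snd ` Z"
  have Q: "finite Q1" "Q1 \<subseteq> R1" "finite Q2" "Q2 \<subseteq> R2"
    using fin ZR S by (auto simp: Q1_def Q2_def)
  obtain l1 u1 where b1: "l1 \<in> R1" "u1 \<in> R1" "sg R1 (u1 - l1) = 1" "sg R1 (l1 - u1) = -1"
    "\<And>s. s \<in> Q1 \<Longrightarrow> sg R1 (u1 - s) = 1 \<and> sg R1 (s - u1) = -1 \<and> sg R1 (s - l1) = 1 \<and> sg R1 (l1 - s) = -1"
    "sg R1 (poly f1 u1) = sg R1 (lead_coeff f1)" "sg R1 (poly f1 l1) = (- 1) ^ degree f1 * sg R1 (lead_coeff f1)"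
    using A.bounds_with_sign[OF Q(1,2) f1] by blast
  obtain l2 u2 where b2: "l2 \<in> R2" "u2 \<in> R2" "sg R2 (u2 - l2) = 1" "sg R2 (l2 - u2) = -1"
    "\<And>s. s \<in> Q2 \<Longrightarrow> sg R2 (u2 - s) = 1 \<and> sg R2 (s - u2) = -1 \<and> sg R2 (s - l2) = 1 \<and> sg R2 (l2 - s) = -1"
    "sg R2 (poly f2 u2) = sg R2 (lead_coeff f2)" "sg R2 (poly f2 l2) = (- 1) ^ degree f2 * sg R2 (lead_coeff f2)"
    using B.bounds_with_sign[OF Q(3,4) f2] by blast
  define Z0 where "Z0 = insert (u1, u2) (insert (l1, l2) Z)"
  have ext: "similar Z0 x y" if "x \<in> Q1" "y \<in> Q2" "similar Z x y" for x y
    using that b1(5)[of x] b2(5)[of y] by (auto simp: Z0_def sim_def)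
  have ZQ: "z \<in> Q1 \<and> w \<in> Q2" if "(z, w) \<in> Z" for z w
    unfolding Q1_def Q2_def using image_eqI[OF _ that, of z fst] image_eqI[OF _ that, of w snd] by simp
  have simu: "similar Z u1 u2" "similar Z l1 l2"
    unfolding sim_def using b1(5) b2(5) ZQ by metis+
  have "similar Z0 z w" if zw: "(z, w) \<in> Z0" for z w
  proof -
    consider "(z, w) = (u1, u2)" | "(z, w) = (l1, l2)" | "(z, w) \<in> Z" using zw unfolding Z0_def by blast
    then show ?thesis
    proof cases
      case 3
      then show ?thesis using Z ZQ[of z w] by (intro ext) (auto simp: matching_def)
    qed (use simu b1 b2 in \<open>auto simp: Z0_def sim_def\<close>)
  qed
  then have "matching R1 R2 Z0"
    using fin ZR b1 b2 by (auto simp: matching_def Z0_def)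
  moreover have "sg R1 (poly f1 z) = sg R2 (poly f2 w)" if "(z, w) \<in> Z0 - Z" for z w
    using that b1(6,7) b2(6,7) lc deg by (auto simp: Z0_def)
  moreover have "enclosed Z0 x" if "x \<in> S1" for x
    using b1(5)[of x] that by (auto simp: enclosed_def Z0_def Q1_def)
  moreover have "similar Z0 x y" if "x \<in> S1" "y \<in> S2" "similar Z x y" for x y
    using that by (intro ext) (auto simp: Q1_def Q2_def)
  ultimately show thesis using that[of Z0] unfolding Z0_def by blast
qed

text \<open>The order is dense and without end points, so every position on one line is occupied on
  the other.\<close>

lemma (in rcf_pair) sim_exists:
  assumes Z: "matching R1 R2 Z" and x: "x \<in> R1" shows "\<exists>y\<in>R2. similar Z x y"
\<comment> \<open>Only the outer points matter here, so the constant 1 is taken as polynomial on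
  both sides.\<close>
proof (rule matching_add_bounds[OF Z, of "{x}" "{}" "[:1:]" "[:1:]"])
  fix Z0 assume Z0: "matching R1 R2 Z0" "Z \<subseteq> Z0" "\<And>u. u \<in> {x} \<Longrightarrow> enclosed Z0 u"
  have "\<exists>y\<in>R2. similar Z0 x y"
  proof (cases "\<exists>w. (x, w) \<in> Z0")
    case True
    then show ?thesis using Z0(1) by (auto simp: matching_def)
  next
    case False
    then obtain r r' s s' where "is_gap Z0 x r r' s s'" using gap[OF Z0(1) x] Z0(3) by blast
    note g = is_gapD[OF this]
    have "r' \<in> R2" "s' \<in> R2" using g(1,2) Z0(1) by (auto simp: matching_def)
    then obtain d where "B.btw r' d s'" using B.btw_exists g(5) by blast
    then show ?thesis using g(3,6) B.btw_closed by blast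
  qed
  then show ?thesis using sim_mono Z0(2) by blast
qed (use x in auto)

text \<open>
  The extension step, from a diagram that already controls the derivative of \<open>f\<close> to one that
  also controls \<open>f\<close>.
\<close>
locale diagram_step = rcf_pair +
  fixes Z f1 f2
  assumes matching: "matching R1 R2 Z"
    and f1: "f1 \<in> pol R1" "f1 \<noteq> 0" "pderiv f1 \<noteq> 0"
    and f2: "f2 \<in> pol R2" "f2 \<noteq> 0" "pderiv f2 \<noteq> 0"
    and deriv: "x \<in> R1 \<Longrightarrow> y \<in> R2 \<Longrightarrow> sim R1 R2 Z x y \<Longrightarrow> 
          sg R1 (poly (pderiv f1) x) = sg R2 (poly (pderiv f2) y)"
begin

lemma diagram_step_converse: "diagram_step R2 R1 (Z\<inverse>) f2 f1"
  by unfold_locales (use matching f1 f2 deriv in \<open>auto simp: sim_converse intro: matching_converse\<close>)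

lemma Z_subset: "(z, w) \<in> Z \<Longrightarrow> z \<in> R1 \<and> w \<in> R2"
  using matching by (auto simp: matching_def)

text \<open>All points of the interval have the same position relative to \<open>Z\<close>, so
  \<open>f1'\<close> has the same sign at all of them, namely that of \<open>f2'\<close> at one
  similar point. A single zero would make the nonzero polynomial \<open>f1'\<close> vanish
  infinitely often.\<close>

lemma deriv_nz:
  assumes "a \<in> R1" "b \<in> R1" "a \<noteq> b" "A.btw a c b"
    "\<And>u v z w. A.btw a u b \<Longrightarrow> A.btw a v b \<Longrightarrow> (z, w) \<in> Z \<Longrightarrow> sg R1 (u - z) = sg R1 (v - z)"
  shows "poly (pderiv f1) c \<noteq> 0"
proof
  assume c0: "poly (pderiv f1) c = 0"
  have c: "c \<in> R1" using assms A.btw_closed by auto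
  obtain d where d: "d \<in> R2" "similar Z c d" using sim_exists[OF matching c] by blast
  have "poly (pderiv f1) u = 0" if u: "A.btw a u b" for u
  proof -
    have "similar Z u d" using d assms(5)[OF u assms(4)] by (auto simp: sim_def)
    then have "sg R1 (poly (pderiv f1) u) = sg R1 (poly (pderiv f1) c)"
      using deriv[of u d] deriv[OF c d] d(1) A.btw_closed[OF u] by simp
    then show ?thesis using c0 by simp
  qed
  then have "finite {u. A.btw a u b}"
    using poly_roots_finite[OF f1(3)] by (rule_tac finite_subset[rotated]) auto
  then show False using A.infinite_btw[OF assms(1-3)] by simp
qed

text \<open>Two distinct roots in the same cell would, by Rolle, enclose a zero of
  \<open>f1'\<close>, which \<open>deriv_nz\<close> excludes.\<close>

lemma root_unique:
  assumes "a \<in> R1" "b \<in> R1" "poly f1 a = 0" "poly f1 b = 0"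
    and same: "\<And>z w. (z, w) \<in> Z \<Longrightarrow> sg R1 (a - z) = sg R1 (b - z)"
  shows "a = b"
proof (rule ccontr)
  assume ab: "a \<noteq> b"
  obtain c where c: "A.btw a c b" "poly (pderiv f1) c = 0"
    using A.rolle[OF f1(1,2) assms(1,2) ab assms(3,4)] by blast
  have "sg R1 (u - z) = sg R1 (a - z)" if "A.btw a u b" "(z, w) \<in> Z" for u z w
    using A.btw_sg_left[OF assms(1,2) _ that(1) same[OF that(2)]] Z_subset that by blast
  then have "poly (pderiv f1) c \<noteq> 0" using deriv_nz[OF assms(1,2) ab c(1)] by metis
  then show False using c by simp
qed

end

text \<open>The added agreement at marked points comes from remainders where these are roots of
  earlier polynomials, and from the behaviour near infinity at outer points.\<close>

locale diagram_step_matched = diagram_step +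
  assumes match: "(z, w) \<in> Z \<Longrightarrow> sg R1 (poly f1 z) = sg R2 (poly f2 w)"
begin

lemma diagram_step_matched_converse: "diagram_step_matched R2 R1 (Z\<inverse>) f2 f1"
  using diagram_step_converse match
  by (simp add: diagram_step_matched_def diagram_step_matched_axioms_def)

text \<open>Inside a cell \<open>f1'\<close> does not vanish, so a root of \<open>f1\<close> there
  forces opposite signs at the marked neighbours. Their partners carry the same signs, and
  \<open>f2\<close> has a root between them.\<close>

lemma root_exists:
  assumes z: "z \<in> R1" "poly f1 z = 0" and encl: "enclosed Z z"
  shows "\<exists>w\<in>R2. poly f2 w = 0 \<and> similar Z z w"
proof (cases "\<exists>w. (z, w) \<in> Z")
  case True
  then obtain w where w: "(z, w) \<in> Z" by auto
  then have "similar Z z w" using matching by (auto simp: matching_def)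
  moreover have "poly f2 w = 0" using match[OF w] z(2) by simp
  ultimately show ?thesis using Z_subset w by blast
next
  case False
  then obtain r r' s s' where "is_gap Z z r r' s s'"
    using gap[OF matching z(1) _ encl] by blast
  note g = is_gapD[OF this]
  have R: "r \<in> R1" "s \<in> R1" "r' \<in> R2" "s' \<in> R2" using g Z_subset by auto
  have "poly (pderiv f1) c \<noteq> 0" if "A.btw r c s" for c
    using deriv_nz[OF R(1,2) g(4) that] g(8) by blast
  then have "sg R1 (poly f1 r) * sg R1 (poly f1 s) = -1"
    using A.root_sign_change[OF f1(1,2) R(1,2) g(4) z(2) g(3)] by blast
  then have "sg R2 (poly f2 r') * sg R2 (poly f2 s') = -1"
    using match[OF g(1)] match[OF g(2)] by simp
  then obtain w where "poly f2 w = 0" "B.btw r' w s'"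
    using B.ivt[OF f2(1) R(3,4)] by (auto simp: B.btw_def)
  then show ?thesis using g(3,6) B.btw_closed by blast
qed

text \<open>Compare on the closed cell around \<open>x\<close>. If it contains a root of
  \<open>f1\<close>, then \<open>f2\<close> has a matching one, and both signs are determined by the
  side of the root and the sign of the derivative. Otherwise neither polynomial changes sign, and
  the neighbours \<open>r\<close> and \<open>r'\<close> decide.\<close>

lemma sg_eq:
  assumes x: "x \<in> R1" "enclosed Z x" and y: "y \<in> R2" "similar Z x y"
    and roots: "\<And>z w. z \<in> R1 \<Longrightarrow> w \<in> R2 \<Longrightarrow> poly f1 z = 0 \<Longrightarrow> poly f2 w = 0 \<Longrightarrow> similar Z z w 
         \<Longrightarrow> sg R1 (x - z) = sg R2 (y - w)"
  shows "sg R1 (poly f1 x) = sg R2 (poly f2 y)"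
proof -
  interpret C: diagram_step_matched R2 R1 "Z\<inverse>" f2 f1 by (rule diagram_step_matched_converse)
  have encl: "C.enclosed (Z\<inverse>) w" if w: "w \<in> R2" "similar Z x w" for w
  proof -
    obtain r r' s s' where *: "(r, r') \<in> Z" "sg R1 (x - r) = 1" "(s, s') \<in> Z" "sg R1 (s - x) = 1"
      using x(2) by (auto simp: enclosed_def)
    have "sg R2 (s' - w) = 1"
      using simD[OF w(2) *(3)] *(4) A.sg_minus_swap[of x s] B.sg_minus_swap[of s' w] Z_subset[OF *(3)] x w
      by simp
    then show ?thesis using simD[OF w(2) *(1)] * by (force simp: C.enclosed_def)
  qed
  show ?thesis
  proof (cases "poly f1 x = 0 \<or> poly f2 y = 0 \<or> (\<exists>w. (x, w) \<in> Z)")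
    case True
    then consider "poly f1 x = 0" | "poly f2 y = 0" | w where "(x, w) \<in> Z" by blast
    then show ?thesis
    proof cases
      case 1
      then obtain w where w: "w \<in> R2" "poly f2 w = 0" "similar Z x w" using root_exists x by blast
      then have "y = w" using roots[OF x(1) w(1) 1 w(2,3)] by simp
      then show ?thesis using 1 w by simp
    next
      case 2
      then obtain z where z: "z \<in> R1" "poly f1 z = 0" "similar Z z y" 
        using C.root_exists[OF y(1) 2 encl[OF y]] by (auto simp: sim_converse)
      then have "x = z" using roots[OF z(1) y(1) z(2) 2 z(3)] by simp
      then show ?thesis using 2 z by simp
    next
      case 3
      then have "y = w" using simD[OF y(2) 3] by simp
      then show ?thesis using match 3 by simp
    qed
  next
    case False
    then have xZ: "(x, w) \<notin> Z" for w by auto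
    obtain r r' s s' where "is_gap Z x r r' s s'"
      using gap[OF matching x(1) xZ x(2)] by blast
    note g = is_gapD[OF this]
    have R: "r \<in> R1" "s \<in> R1" "r' \<in> R2" "s' \<in> R2" using g Z_subset by auto
    have y_btw: "B.btw r' y s'" using g(7) y by blast
    have same2: "sg R2 (c - w) = sg R2 (d - w)" 
      if "B.btw r' c s'" "B.btw r' d s'" "(z, w) \<in> Z" for c d z w
      using simD[OF g(6)[OF g(3) that(1)] that(3)] simD[OF g(6)[OF g(3) that(2)] that(3)] by simp
    have d1: "poly (pderiv f1) c \<noteq> 0" if "A.btw r c s" for c
      using deriv_nz[OF R(1,2) g(4) that] g(8) by blast
    have d2: "poly (pderiv f2) c \<noteq> 0" if "B.btw r' c s'" for c
      using C.deriv_nz[OF R(3,4) g(5) that] same2 by blast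
    have pair: "sg R1 (poly f1 x) = sg R2 (poly f2 y)"
      if zw: "z \<in> R1" "w \<in> R2" "poly f1 z = 0" "poly f2 w = 0" "similar Z z w"
        "z = r \<or> z = s \<or> A.btw r z s" "w = r' \<or> w = s' \<or> B.btw r' w s'" for z w
    proof -
      have "sg R1 (poly f1 x) = sg R1 (x - z) * sg R1 (poly (pderiv f1) x)"
        using zw x False d1 g(3) A.btw_convex[OF R(1,2) g(4,3) zw(6)]
        by (intro A.sg_by_derivative f1) auto
      moreover have "sg R2 (poly f2 y) = sg R2 (y - w) * sg R2 (poly (pderiv f2) y)"
        using zw y False d2 y_btw B.btw_convex[OF R(3,4) g(5) y_btw zw(7)]
        by (intro B.sg_by_derivative f2) auto
      ultimately show ?thesis using roots[OF zw(1-5)] deriv[OF x(1) y] by simp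
    qed
    have sim_ends: "similar Z r r'" "similar Z s s'" using matching g(1,2) by (auto simp: matching_def)
    have encl_btw: "enclosed Z z" if "A.btw r z s" for z
    proof -
      have "sg R1 (x - r) = 1 \<or> sg R1 (x - r) = - 1" "sg R1 (s - r) = sg R1 (x - r)" 
        "sg R1 (z - r) = sg R1 (x - r)" "sg R1 (s - z) = sg R1 (x - r)" 
        using g(3,4) that A.sg_cases[of "s - r"] by (auto simp: A.btw_def)
      then show ?thesis
        using g(1,2) A.sg_minus_swap[of z s] A.sg_minus_swap[of r z] A.btw_closed[OF that] R
        unfolding enclosed_def by force
    qed
    show ?thesis
    proof (cases "\<exists>z. poly f1 z = 0 \<and> (z = r \<or> z = s \<or> A.btw r z s)")
      case True
      then obtain z where z: "poly f1 z = 0" "z = r \<or> z = s \<or> A.btw r z s" by blast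
      from z(2) show ?thesis
      proof (elim disjE)
        assume "z = r"
        then show ?thesis using pair[OF R(1,3)] z(1) match[OF g(1)] sim_ends by auto
      next
        assume "z = s"
        then show ?thesis using pair[OF R(2,4)] z(1) match[OF g(2)] sim_ends by auto
      next
        assume zb: "A.btw r z s"
        then have zR: "z \<in> R1" by (rule A.btw_closed)
        obtain w where w: "w \<in> R2" "poly f2 w = 0" "similar Z z w"
          using root_exists[OF zR z(1) encl_btw[OF zb]] by blast
        have "B.btw r' w s'"
          using simD[OF w(3) g(1)] simD[OF w(3) g(2)] simD[OF sim_ends(2) g(1)] zb w(1) R zR
            A.sg_minus_swap[of z s] B.sg_minus_swap[of w s'] by (simp add: A.btw_def B.btw_def)
        then show ?thesis using pair[OF zR w(1) z(1) w(2,3)] zb by blast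
      qed
    next
      case no_root: False
      have no_root2: "poly f2 w \<noteq> 0" if "B.btw r' w s'" for w
      proof
        assume w0: "poly f2 w = 0"
        have wR: "w \<in> R2" using that by (rule B.btw_closed)
        have "C.enclosed (Z\<inverse>) w" using encl[OF wR] g(3,6) that by blast
        then obtain z where z: "z \<in> R1" "poly f1 z = 0" "similar Z z w"
          using C.root_exists[OF wR w0] by (auto simp: sim_converse)
        have "A.btw r z s"
          using simD[OF z(3) g(1)] simD[OF z(3) g(2)] simD[OF sim_ends(2) g(1)] that z(1) R wR
            A.sg_minus_swap[of z s] B.sg_minus_swap[of w s'] by (simp add: A.btw_def B.btw_def)
        then show False using no_root z(2) by blast
      qed
      have "poly f1 r \<noteq> 0" using no_root by blast
      then have "poly f2 r' \<noteq> 0" using match[OF g(1)] by auto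
      have "sg R1 (poly f1 r) = sg R1 (poly f1 x)"
        using \<open>poly f1 r \<noteq> 0\<close> False no_root A.btw_trans[OF R(1,2) g(3)] x R f1
        by (intro A.same_sg_if_no_root) blast+
      moreover have "sg R2 (poly f2 r') = sg R2 (poly f2 y)"
        using \<open>poly f2 r' \<noteq> 0\<close> False no_root2 B.btw_trans[OF R(3,4) y_btw] y R f2
        by (intro B.same_sg_if_no_root) blast+
      ultimately show ?thesis using match[OF g(1)] by simp
    qed
  qed
qed

end

section \<open>Building diagrams by increasing degree\<close>

lemma (in rcf) pderiv_neq_0:
  fixes p :: "'a poly"
  assumes "degree p \<noteq> 0" shows "pderiv p \<noteq> 0" "degree (pderiv p) < degree p"
    "lead_coeff (pderiv p) = of_nat (degree p) * lead_coeff p"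
proof -
  obtain d where d: "degree p = Suc d" using assms by (cases "degree p") auto
  have "poly.coeff (pderiv p) d = of_nat (Suc d) * lead_coeff p"
    by (simp add: coeff_pderiv d)
  moreover have "lead_coeff p \<noteq> 0" using assms by auto
  ultimately have c: "poly.coeff (pderiv p) d \<noteq> 0" using of_nat_Suc_neq_0[of d] by simp
  have "degree (pderiv p) \<le> d"
    by (rule degree_le) (auto simp: coeff_pderiv d coeff_eq_0)
  moreover have "d \<le> degree (pderiv p)" using c by (rule le_degree)
  ultimately have "degree (pderiv p) = d" by simp
  then show "degree (pderiv p) < degree p"
    "lead_coeff (pderiv p) = of_nat (degree p) * lead_coeff p" 
    using d by (simp_all add: coeff_pderiv)
  show "pderiv p \<noteq> 0" using c by (metis coeff_0)
qed

text \<open>The new marked points are the pairs \<open>N\<close> of similar roots. A cell holds at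
  most one root on either side, which makes \<open>N\<close> consistent with itself; similarity
  makes it consistent with \<open>Z\<close>.\<close>

lemma (in rcf_pair) diagram_insert:
  assumes D: "diagram R1 R2 T Z"
    and f1: "f1 \<in> pol R1" "f1 \<noteq> 0" and f2: "f2 \<in> pol R2" "f2 \<noteq> 0"
    and deg: "degree f1 = degree f2" and lc: "sg R1 (lead_coeff f1) = sg R2 (lead_coeff f2)"
    and der: "degree f1 \<noteq> 0 \<Longrightarrow> (pderiv f1, pderiv f2) \<in> T"
    and match: "\<And>z w. (z, w) \<in> Z \<Longrightarrow> sg R1 (poly f1 z) = sg R2 (poly f2 w)"
  shows "\<exists>Z'. diagram R1 R2 (insert (f1, f2) T) Z'"
proof (cases "degree f1 = 0")
  case True
  then obtain c1 c2 where "f1 = [:c1:]" "f2 = [:c2:]" using deg by (metis degree_eq_zeroE)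
  then have "sg R1 (poly f1 x) = sg R2 (poly f2 y)" for x y using lc by simp
  then have "diagram R1 R2 (insert (f1, f2) T) Z"
    using D unfolding diagram_def by blast
  then show ?thesis ..
next
  case False
  have Z: "matching R1 R2 Z" and roots_Z: "\<And>z w. (z, w) \<in> Z \<Longrightarrow> \<exists>p q. (p, q) \<in> T \<and> poly p z = 0"
    and sgT: "\<And>x y p q. x \<in> R1 \<Longrightarrow> y \<in> R2 \<Longrightarrow> similar Z x y \<Longrightarrow> (p, q) \<in> T \<Longrightarrow> sg R1 (poly p x) = sg R2 (poly q y)"
    using D unfolding diagram_def by blast+
  have fin: "finite Z" and ZR: "Z \<subseteq> R1 \<times> R2" using Z by (auto simp: matching_def)
  define roots1 where "roots1 = {z \<in> R1. poly f1 z = 0}"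
  define roots2 where "roots2 = {z \<in> R2. poly f2 z = 0}"
  have fr: "finite roots1" "finite roots2" "roots1 \<subseteq> R1" "roots2 \<subseteq> R2"
    using poly_roots_finite[OF f1(2)] poly_roots_finite[OF f2(2)]
    by (auto simp: roots1_def roots2_def elim: finite_subset[rotated])
  define N where "N = {(z, w) \<in> roots1 \<times> roots2. similar Z z w}"
  have pd1: "pderiv f1 \<noteq> 0" and pd2: "pderiv f2 \<noteq> 0"
    using A.pderiv_neq_0[OF False] B.pderiv_neq_0[of f2] False deg by auto
  have step: "diagram_step R1 R2 Z f1 f2"
    by unfold_locales (use Z f1 f2 pd1 pd2 sgT der[OF False] in auto)
  then interpret S: diagram_step R1 R2 Z f1 f2 .
  interpret S': diagram_step R2 R1 "Z\<inverse>" f2 f1 by (rule S.diagram_step_converse)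
  have NN: "sg R1 (z - z2) = sg R2 (w - w2)" if "(z, w) \<in> N" "(z2, w2) \<in> N" for z w z2 w2
  proof -
    have *: "z \<in> R1" "w \<in> R2" "z2 \<in> R1" "w2 \<in> R2" "poly f1 z = 0" "poly f1 z2 = 0" 
      "poly f2 w = 0" "poly f2 w2 = 0" "similar Z z w" "similar Z z2 w2"
      using that by (auto simp: N_def roots1_def roots2_def)
    show ?thesis
    \<comment> \<open>Roots in the same cell coincide on both sides; roots in different cells are
      separated by a marked pair, which orders both sides alike.\<close>
    proof (cases "\<forall>(r, r')\<in>Z. sg R1 (z - r) = sg R1 (z2 - r)")
      case True
      have "z = z2" using True by (intro S.root_unique[OF *(1,3,5,6)]) blast
      moreover have "sg R2 (w - r') = sg R2 (w2 - r')" if "(r, r') \<in> Z" for r r'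
        using True simD[OF *(9) that] simD[OF *(10) that] that by auto
      then have "w = w2" by (intro S'.root_unique[OF *(2,4,7,8)]) blast
      ultimately show ?thesis by simp
    next
      case F: False
      then obtain r r' where r: "(r, r') \<in> Z" "sg R1 (z - r) \<noteq> sg R1 (z2 - r)" by auto
      have rR: "r \<in> R1" "r' \<in> R2" using r ZR by auto
      have e: "sg R1 (z - r) = sg R2 (w - r')" "sg R1 (z2 - r) = sg R2 (w2 - r')"
        using simD[OF *(9) r(1)] simD[OF *(10) r(1)] by auto
      show ?thesis
        using A.sg_diff_less[of z r z2] A.sg_diff_less[of z2 r z] B.sg_diff_less[of w r' w2] B.sg_diff_less[of w2 r' w] r(2) rR * e
          A.sg_minus_swap[of z z2] B.sg_minus_swap[of w w2]
        by (cases "sg R1 (z - r)" "sg R1 (z2 - r)" rule: linorder_cases) auto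
    qed
  qed
  have NZ: "similar Z z w" if "(z, w) \<in> Z \<union> N" for z w
    using that Z by (auto simp: N_def matching_def)
  have ZN: "sg R1 (z - z2) = sg R2 (w - w2)" if "(z, w) \<in> Z \<union> N" "(z2, w2) \<in> Z \<union> N" for z w z2 w2
  proof (cases "(z2, w2) \<in> Z")
    case True
    then show ?thesis using simD[OF NZ[OF that(1)]] by blast
  next
    case F: False
    then have N2: "(z2, w2) \<in> N" using that by blast
    show ?thesis
    proof (cases "(z, w) \<in> Z")
      case True
      have "z \<in> R1" "w \<in> R2" "z2 \<in> R1" "w2 \<in> R2" 
        using True N2 ZR by (auto simp: N_def roots1_def roots2_def)
      then show ?thesis 
        using simD[OF NZ[OF that(2)] True] A.sg_minus_swap[of z z2] B.sg_minus_swap[of w w2] by simp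
    qed (use NN N2 that in blast)
  qed
  have "matching R1 R2 (Z \<union> N)"
  proof -
    have "finite N" using fr by (intro finite_subset[of N "roots1 \<times> roots2"]) (auto simp: N_def)
    moreover have "N \<subseteq> R1 \<times> R2" by (auto simp: N_def roots1_def roots2_def)
    ultimately show ?thesis using fin ZR ZN unfolding matching_def sim_def by blast
  qed
  moreover have "\<exists>p q. (p, q) \<in> insert (f1, f2) T \<and> poly p z = 0" if "(z, w) \<in> Z \<union> N" for z w
  proof (cases "(z, w) \<in> Z")
    case False
    then have "poly f1 z = 0" using that by (auto simp: N_def roots1_def)
    then show ?thesis by blast
  qed (use roots_Z in blast)
  moreover have "sg R1 (poly p x) = sg R2 (poly q y)"
    if xy: "x \<in> R1" "y \<in> R2" "similar (Z \<union> N) x y" "(p, q) \<in> insert (f1, f2) T" for x y p q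
  proof -
    have simZ: "similar Z x y" using sim_mono[OF xy(3)] by blast
    have "sg R1 (poly f1 x) = sg R2 (poly f2 y)"
    proof -
      \<comment> \<open>The outer points in \<open>Z0\<close> only serve to evaluate signs in
        unbounded cells; the new diagram consists of \<open>Z\<close> and \<open>N\<close>.\<close>
      obtain Z0 where Z0: "matching R1 R2 Z0" "Z \<subseteq> Z0"
        "\<And>z w. (z, w) \<in> Z0 - Z \<Longrightarrow> sg R1 (poly f1 z) = sg R2 (poly f2 w)"
        "\<And>x'. x' \<in> insert x roots1 \<Longrightarrow> enclosed Z0 x'"
        "\<And>x' y'. x' \<in> insert x roots1 \<Longrightarrow> y' \<in> insert y roots2 \<Longrightarrow> similar Z x' y' \<Longrightarrow> similar Z0 x' y'"
        using matching_add_bounds[OF Z, of "insert x roots1" "insert y roots2" f1 f2] fr xy(1,2) f1 f2 deg lc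
        by (smt (verit) finite_insert insert_subset)
      interpret S0: diagram_step_matched R1 R2 Z0 f1 f2
      proof unfold_locales
        show "sg R1 (poly (pderiv f1) u) = sg R2 (poly (pderiv f2) v)"
          if "u \<in> R1" "v \<in> R2" "similar Z0 u v" for u v
          using S.deriv that sim_mono[OF that(3) Z0(2)] by blast
        show "sg R1 (poly f1 z) = sg R2 (poly f2 w)" if "(z, w) \<in> Z0" for z w
          using Z0(3) match that by blast
      qed (use Z0(1) f1 f2 pd1 pd2 in auto)
      show ?thesis
      proof (rule S0.sg_eq)
        show "enclosed Z0 x" using Z0(4) by blast
        show "similar Z0 x y" using Z0(5) simZ by blast
        fix z w assume zw: "z \<in> R1" "w \<in> R2" "poly f1 z = 0" "poly f2 w = 0" "similar Z0 z w"
        then have "(z, w) \<in> N" using sim_mono[OF zw(5) Z0(2)] by (auto simp: N_def roots1_def roots2_def)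
        then show "sg R1 (x - z) = sg R2 (y - w)" using simD[OF xy(3)] by blast
      qed (use xy in auto)
    qed
    then show ?thesis using sgT[OF xy(1,2) simZ] xy(4) by blast
  qed
  ultimately have "diagram R1 R2 (insert (f1, f2) T) (Z \<union> N)"
    unfolding diagram_def by blast
  then show ?thesis ..
qed

text \<open>Both sides share the exponent \<open>k\<close>: the powers in front of \<open>f1\<close>
  and \<open>f2\<close> have equal signs as soon as the leading coefficients of \<open>h1\<close>
  and \<open>h2\<close> do.\<close>

definition remainder_in :: "('a::idom poly \<times> 'b::idom poly) set \<Rightarrow> 'a poly \<Rightarrow> 'b poly \<Rightarrow> 'a poly \<Rightarrow> 'b poly \<Rightarrow> bool" where
  "remainder_in T f1 f2 h1 h2 \<longleftrightarrow> (\<exists>k s1 r1 s2 r2.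
     smult (lead_coeff h1 ^ k) f1 = h1 * s1 + r1 \<and> smult (lead_coeff h2 ^ k) f2 = h2 * s2 + r2 \<and>
     (r1 = 0 \<and> r2 = 0 \<or> (r1, r2) \<in> T \<and> degree r1 < degree h1))"

text \<open>Derivatives control a new polynomial between marked points, remainders give its signs at
  marked points.\<close>

definition (in rcf_pair) compatible :: "('a poly \<times> 'b poly) set \<Rightarrow> bool" where
  "compatible T \<longleftrightarrow> finite T \<and> (\<forall>f1 f2. (f1, f2) \<in> T \<longrightarrow> f1 \<in> pol R1 \<and> f2 \<in> pol R2 \<and> f1 \<noteq> 0 \<and> f2 \<noteq> 0 \<and>
     degree f1 = degree f2 \<and> sg R1 (lead_coeff f1) = sg R2 (lead_coeff f2) \<and>
     (degree f1 \<noteq> 0 \<longrightarrow> (pderiv f1, pderiv f2) \<in> T) \<and>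
     (\<forall>h1 h2. (h1, h2) \<in> T \<longrightarrow> remainder_in T f1 f2 h1 h2))"

theorem (in rcf_pair) diagram_exists:
  assumes C: "compatible T0"
  shows "\<exists>Z. diagram R1 R2 T0 Z"
proof -
  \<comment> \<open>Polynomials are inserted by increasing degree. Downward closure of
    \<open>T\<close> ensures that derivatives and remainders are present before they are
    consulted.\<close>
  have "T \<subseteq> T0 \<and> (\<forall>p\<in>T0. \<forall>q\<in>T. degree (fst p) < degree (fst q) \<longrightarrow> p \<in> T) \<longrightarrow> (\<exists>Z. diagram R1 R2 T Z)"
    if "finite T" for T
    using that
  proof (induction rule: finite_ranking_induct[where f = "\<lambda>p. degree (fst p)"])
    case empty
    have "diagram R1 R2 {} {}" by (simp add: diagram_def matching_def)
    then show ?case by blast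
  next
    case (insert f T)
    show ?case
    proof (intro impI, elim conjE)
      assume T: "insert f T \<subseteq> T0" 
        and down: "\<forall>p\<in>T0. \<forall>q\<in>insert f T. degree (fst p) < degree (fst q) \<longrightarrow> p \<in> insert f T"
      obtain f1 f2 where f: "f = (f1, f2)" by (cases f)
      have down_T: "p \<in> T" if "p \<in> T0" "q \<in> insert f T" "degree (fst p) < degree (fst q)" for p q
        using down that insert.hyps(2) by fastforce
      then obtain Z where Z: "diagram R1 R2 T Z" using insert.IH T by blast
      have fT: "(f1, f2) \<in> T0" using T f by auto
      have f_props: "f1 \<in> pol R1" "f2 \<in> pol R2" "f1 \<noteq> 0" "f2 \<noteq> 0" "degree f1 = degree f2"
        "sg R1 (lead_coeff f1) = sg R2 (lead_coeff f2)"
        "degree f1 \<noteq> 0 \<Longrightarrow> (pderiv f1, pderiv f2) \<in> T0"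
        using C fT unfolding compatible_def by blast+
      have der: "(pderiv f1, pderiv f2) \<in> T" if "degree f1 \<noteq> 0"
        using down_T[OF f_props(7)[OF that], of f] A.pderiv_neq_0(2)[OF that] f by simp
      \<comment> \<open>The marked point \<open>z\<close> is a root of an earlier \<open>h1\<close>.
        Up to a power of the leading coefficient of \<open>h1\<close>, the value of
        \<open>f1\<close> at \<open>z\<close> is that of its remainder, whose sign is known.\<close>
      have "sg R1 (poly f1 z) = sg R2 (poly f2 w)" if zw: "(z, w) \<in> Z" for z w
      proof -
        have zw': "z \<in> R1" "w \<in> R2" "similar Z z w" using Z zw by (auto simp: diagram_def matching_def)
        obtain h1 h2 where h: "(h1, h2) \<in> T" "poly h1 z = 0" using Z zw unfolding diagram_def by blast
        have sgT: "sg R1 (poly p z) = sg R2 (poly q w)" if "(p, q) \<in> T" for p q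
          using Z zw' that unfolding diagram_def by blast
        have h2: "poly h2 w = 0" using sgT[OF h(1)] h(2) by simp
        have hT: "(h1, h2) \<in> T0" using h T by auto
        then have h_props: "h1 \<in> pol R1" "h2 \<in> pol R2" "h1 \<noteq> 0" "h2 \<noteq> 0" 
          "sg R1 (lead_coeff h1) = sg R2 (lead_coeff h2)"
          using C unfolding compatible_def by blast+
        obtain k s1 r1 s2 r2 where r: "smult (lead_coeff h1 ^ k) f1 = h1 * s1 + r1"
         "smult (lead_coeff h2 ^ k) f2 = h2 * s2 + r2"
         "r1 = 0 \<and> r2 = 0 \<or> (r1, r2) \<in> T0 \<and> degree r1 < degree h1"
        proof -
          have "remainder_in T0 f1 f2 h1 h2" using C fT hT unfolding compatible_def by blast
          then show thesis using that unfolding remainder_in_def by blast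
        qed
        have "sg R1 (poly r1 z) = sg R2 (poly r2 w)"
          using r(3) sgT[OF down_T[of "(r1, r2)" "(h1, h2)"]] h(1) by auto
        moreover have "poly r1 z = lead_coeff h1 ^ k * poly f1 z"
          using arg_cong[OF r(1), of "\<lambda>p. poly p z"] h by simp
        moreover have "poly r2 w = lead_coeff h2 ^ k * poly f2 w"
          using arg_cong[OF r(2), of "\<lambda>p. poly p w"] h2 by simp
        ultimately have "sg R1 (lead_coeff h1) ^ k * sg R1 (poly f1 z) = sg R2 (lead_coeff h2) ^ k * sg R2 (poly f2 w)"
          using f_props h_props zw' by (simp add: A.sg_mult B.sg_mult A.sg_power B.sg_power A.pol_coeff B.pol_coeff)
        moreover have "sg R1 (lead_coeff h1) ^ k \<noteq> 0" using h_props by simp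
        ultimately show ?thesis using h_props(4,5) by auto
      qed
      then show "\<exists>Z. diagram R1 R2 (insert f T) Z"
        using diagram_insert[OF Z f_props(1,3,2,4,5,6) der] f by blast
    qed
  qed
  from this[of T0] C show ?thesis by (auto simp: compatible_def)
qed

section \<open>Transfer along one variable\<close>

locale ring_map =
  fixes \<phi> :: "'a::idom \<Rightarrow> 'b::field"
  assumes one [simp]: "\<phi> 1 = 1"
    and add [simp]: "\<phi> (x + y) = \<phi> x + \<phi> y"
    and mult [simp]: "\<phi> (x * y) = \<phi> x * \<phi> y"
begin

lemma zero [simp]: "\<phi> 0 = 0"
  using add[of 0 0] by (metis add_0 add_cancel_right_right)

lemma uminus [simp]: "\<phi> (- x) = - \<phi> x"
  using add[of x "- x"] by (simp add: eq_neg_iff_add_eq_0 add.commute)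

lemma diff [simp]: "\<phi> (x - y) = \<phi> x - \<phi> y"
  using add[of x "- y"] by simp

lemma power [simp]: "\<phi> (x ^ n) = \<phi> x ^ n"
  by (induction n) auto

lemma of_nat [simp]: "\<phi> (of_nat n) = of_nat n"
  by (induction n) auto

lemma sum: "\<phi> (sum f A) = (\<Sum>x\<in>A. \<phi> (f x))"
  by (induction A rule: infinite_finite_induct) auto

lemma prod: "\<phi> (prod f A) = (\<Prod>x\<in>A. \<phi> (f x))"
  by (induction A rule: infinite_finite_induct) auto

lemma coeff_map [simp]: "poly.coeff (map_poly \<phi> p) i = \<phi> (poly.coeff p i)"
  by (simp add: coeff_map_poly)

lemma map_add: "map_poly \<phi> (p + q) = map_poly \<phi> p + map_poly \<phi> q"
  by (simp add: poly_eq_iff)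

lemma map_mult: "map_poly \<phi> (p * q) = map_poly \<phi> p * map_poly \<phi> q"
  by (simp add: poly_eq_iff coeff_mult sum)

lemma map_smult: "map_poly \<phi> (smult c p) = smult (\<phi> c) (map_poly \<phi> p)"
  by (simp add: poly_eq_iff)

lemma map_pderiv: "map_poly \<phi> (pderiv p) = pderiv (map_poly \<phi> p)"
  by (simp add: poly_eq_iff coeff_pderiv del: of_nat_Suc)

lemma poly_map: "poly (map_poly \<phi> p) (\<phi> t) = \<phi> (poly p t)"
  by (induction p) (auto simp: map_poly_pCons)

lemma degree_map_le: "degree (map_poly \<phi> p) \<le> degree p"
  by (rule map_poly_degree_leq)

lemma image_subring: "subring_set D \<Longrightarrow> subring_set (\<phi> ` D)"
proof -
  assume "subring_set D"
  then interpret D: subring_set D .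
  show "subring_set (\<phi> ` D)"
  proof
    show "1 \<in> \<phi> ` D" using image_eqI[of 1 \<phi> 1 D] by simp
    show "x - z \<in> \<phi> ` D" "x * z \<in> \<phi> ` D" if xz: "x \<in> \<phi> ` D" "z \<in> \<phi> ` D" for x z
    proof -
      obtain f g where "f \<in> D" "g \<in> D" "x = \<phi> f" "z = \<phi> g" using xz by auto
      then show "x - z \<in> \<phi> ` D" "x * z \<in> \<phi> ` D"
        using image_eqI[of "x - z" \<phi> "f - g" D] image_eqI[of "x * z" \<phi> "f * g" D] by simp_all
    qed
  qed
qed

lemma sos_image: "s \<in> sos (\<phi> ` D) \<Longrightarrow> \<exists>t\<in>sos D. s = \<phi> t"
proof (induction rule: sos.induct)
  case zero
  then show ?case using sos.zero by (intro bexI[of _ 0]) auto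
next
  case (add x s)
  then obtain u t where "u \<in> D" "x = \<phi> u" "t \<in> sos D" "s = \<phi> t" by auto
  then show ?case by (intro bexI[of _ "u * u + t"]) (auto intro: sos.add)
qed

lemma map_division:
  assumes "smult (c ^ k) p = q * s + r"
  shows "\<phi> c ^ k * poly (map_poly \<phi> p) a = poly (map_poly \<phi> q) a * poly (map_poly \<phi> s) a + poly (map_poly \<phi> r) a"
  using arg_cong[OF assms, of "\<lambda>u. poly (map_poly \<phi> u) a"] by (simp add: map_smult map_add map_mult)

lemma lead_coeff_map:
  assumes "\<phi> (lead_coeff p) \<noteq> 0"
  shows "degree (map_poly \<phi> p) = degree p" "lead_coeff (map_poly \<phi> p) = \<phi> (lead_coeff p)"
proof -
  have "degree p \<le> degree (map_poly \<phi> p)" using assms by (intro le_degree) simp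
  then show "degree (map_poly \<phi> p) = degree p" using degree_map_le[of p] by simp
  then show "lead_coeff (map_poly \<phi> p) = \<phi> (lead_coeff p)" by simp
qed

lemma map_pol: "p \<in> pol D \<Longrightarrow> \<phi> ` D \<subseteq> R \<Longrightarrow> map_poly \<phi> p \<in> pol R"
  by (auto simp: pol_def)

end

section \<open>Truncation and finite closure under pseudo-remainders\<close>

definition trunc :: "'a::idom poly \<Rightarrow> 'a poly" where
  "trunc p = p - monom (lead_coeff p) (degree p)"

lemma trunc_less: "degree p \<noteq> 0 \<Longrightarrow> degree (trunc p) < degree p"
proof -
  assume d: "degree p \<noteq> 0"
  have "degree (trunc p) \<le> degree p" unfolding trunc_def
    by (intro degree_diff_le) (auto intro: degree_monom_le)
  moreover have "poly.coeff (trunc p) (degree p) = 0" by (simp add: trunc_def)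
  ultimately show "degree (trunc p) < degree p"
    using d by (metis degree_0 le_neq_implies_less leading_coeff_0_iff neq0_conv)
qed

lemma trunc_const: "degree p = 0 \<Longrightarrow> trunc p = 0"
  by (metis degree_eq_zeroE trunc_def diff_self monom_0 lead_coeff_pCons(2))

lemma (in subring_set) trunc_closed: "p \<in> pol R \<Longrightarrow> trunc p \<in> pol R"
  by (simp add: trunc_def pol_coeff)

lemma (in ring_map) map_trunc: "\<phi> (lead_coeff p) = 0 \<Longrightarrow> map_poly \<phi> (trunc p) = map_poly \<phi> p"
  by (auto simp: poly_eq_iff trunc_def)

text \<open>A leading term killed by \<open>\<phi>\<close> could be dropped without changing the
  image, against minimality. In degree 0 dropping it leaves 0, which \<open>W\<close>
  excludes.\<close>

lemma (in ring_map) lead_coeff_minimal: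
  assumes q: "q \<in> W" "\<And>p. p \<in> W \<Longrightarrow> degree q \<le> degree p" and W: "\<And>p. p \<in> W \<Longrightarrow> map_poly \<phi> p \<noteq> 0"
    and trunc: "\<phi> (lead_coeff q) = 0 \<Longrightarrow> trunc q \<in> W"
  shows "\<phi> (lead_coeff q) \<noteq> 0"
proof
  assume "\<phi> (lead_coeff q) = 0"
  then have tW: "trunc q \<in> W" by (rule trunc)
  then have "degree q = 0" using q(2)[OF tW] trunc_less[of q] by linarith
  then have "trunc q = 0" by (rule trunc_const)
  then show False using W[OF tW] by simp
qed

lemma degree_pderiv_less: "degree p \<noteq> 0 \<Longrightarrow> degree (pderiv (p :: 'a::idom poly)) < degree p"
proof -
  assume d: "degree p \<noteq> 0"
  have "degree (pderiv p) \<le> degree p - 1"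
    by (rule degree_le) (auto simp: coeff_pderiv coeff_eq_0)
  then show ?thesis using d by linarith
qed

definition is_premainder :: "'a::idom set \<Rightarrow> 'a poly \<Rightarrow> 'a poly \<Rightarrow> 'a poly \<Rightarrow> bool" where
  "is_premainder D f h r \<longleftrightarrow> r \<in> pol D \<and> (r = 0 \<or> degree r < degree h) \<and>
     (\<exists>k. \<exists>s\<in>pol D. smult (lead_coeff h ^ k) f = h * s + r)"

text \<open>A fixed choice turns closure under remainders into closure under a function. For
  \<open>degree f < degree h\<close> the choice is \<open>f\<close> itself, so that nothing new
  arises.\<close>

definition premainder :: "'a::idom set \<Rightarrow> 'a poly \<Rightarrow> 'a poly \<Rightarrow> 'a poly" where
  "premainder D f h = (if degree f < degree h then f else SOME r. is_premainder D f h r)"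

lemma (in subring_set) premainder:
  assumes "f \<in> pol R" "h \<in> pol R" "h \<noteq> 0" shows "is_premainder R f h (premainder R f h)"
proof (cases "degree f < degree h")
  case True
  then show ?thesis using assms unfolding premainder_def is_premainder_def
    by (auto intro!: exI[of _ 0] bexI[of _ 0])
next
  case False
  have "\<exists>r. is_premainder R f h r"
    using pseudo_division[OF assms] unfolding is_premainder_def by blast
  then show ?thesis using False by (simp add: premainder_def someI_ex)
qed

text \<open>The closure is built from the top degree downwards. Lowering the threshold
  \<open>e\<close> of \<open>closed\<close> by one adds only polynomials of degree below the new
  threshold, and these are not yet subject to closure, so every stage stays finite.\<close>

lemma (in subring_set) remainder_closure:
  assumes F: "finite F" "F \<subseteq> pol R"
  obtains C where "finite C" "F \<subseteq> C" "C \<subseteq> pol R" 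
    "\<And>f. f \<in> C \<Longrightarrow> pderiv f \<in> C" "\<And>f. f \<in> C \<Longrightarrow> trunc f \<in> C"
    "\<And>f h. f \<in> C \<Longrightarrow> h \<in> C \<Longrightarrow> h \<noteq> 0 \<Longrightarrow> premainder R f h \<in> C"
proof -
  define closed where "closed e C \<longleftrightarrow> (\<forall>f\<in>C. e \<le> degree f \<longrightarrow> pderiv f \<in> C \<and> trunc f \<in> C \<and>
      (\<forall>h\<in>C. h \<noteq> 0 \<longrightarrow> e \<le> degree h \<longrightarrow> premainder R f h \<in> C))" for e and C :: "'a poly set"
  have "\<exists>C. finite C \<and> insert 0 F \<subseteq> C \<and> C \<subseteq> pol R \<and> closed e C" if "e \<le> Suc (Max (degree ` insert 0 F))" for e
    using that
  proof (induction rule: inc_induct)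
    case base
    have "degree f \<le> Max (degree ` insert 0 F)" if "f \<in> insert 0 F" for f
      using that F by (intro Max_ge) auto
    then have "closed (Suc (Max (degree ` insert 0 F))) (insert 0 F)"
      unfolding closed_def by fastforce
    then show ?case using F by (intro exI[of _ "insert 0 F"]) auto
  next
    case (step e)
    then obtain C where C: "finite C" "insert 0 F \<subseteq> C" "C \<subseteq> pol R" "closed (Suc e) C" by blast
    define B where "B = {f \<in> C. e \<le> degree f}"
    define N where "N = pderiv ` B \<union> trunc ` B \<union> (\<lambda>(f, h). premainder R f h) ` (B \<times> (B - {0}))"
    have B: "finite B" "B \<subseteq> C" using C by (auto simp: B_def)
    have new: "u \<in> C \<or> degree u < e" if "u \<in> N" for u
    proof -
      consider f where "f \<in> B" "u = pderiv f \<or> u = trunc f" | 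
        f h where "f \<in> B" "h \<in> B" "h \<noteq> 0" "u = premainder R f h"
        using \<open>u \<in> N\<close> by (auto simp: N_def)
      then show ?thesis
      proof cases
        case 1
        \<comment> \<open>In degree 0 nothing can drop further, but derivative and truncation are
          then 0, which was put into the family from the start.\<close>
        consider "degree f = 0" | "degree f = e" "e \<noteq> 0" | "Suc e \<le> degree f" 
          using 1(1) by (fastforce simp: B_def)
        then show ?thesis
        proof cases
          assume "degree f = 0"
          then have "u = 0" using 1 trunc_const pderiv_eq_0_iff by (metis degree_eq_zeroE pderiv_singleton)
          then show ?thesis using C by blast
        next
          assume "degree f = e" "e \<noteq> 0"
          then show ?thesis using 1 trunc_less[of f] degree_pderiv_less[of f] by auto
        next
          assume "Suc e \<le> degree f"
          then show ?thesis using 1 B C(4) unfolding closed_def by blast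
        qed
      next
        case 2
        have fh: "f \<in> C" "h \<in> C" using 2 B by auto
        have prem: "is_premainder R f h u"
          using premainder[of f h] 2 fh C by auto
        consider "degree h = e" | "degree f = e" "Suc e \<le> degree h" | "Suc e \<le> degree h" "Suc e \<le> degree f"
          using 2(1,2) by (fastforce simp: B_def)
        then show ?thesis
        proof cases
          assume "degree h = e"
          then show ?thesis using prem C(2) unfolding is_premainder_def by blast
        next
          assume "degree f = e" "Suc e \<le> degree h"
          then have "u = f" using 2 by (simp add: premainder_def)
          then show ?thesis using fh by simp
        next
          assume "Suc e \<le> degree h" "Suc e \<le> degree f"
          then show ?thesis using 2 fh C(4) unfolding closed_def by blast
        qed
      qed
    qed
    have "finite (C \<union> N)" using C B by (simp add: N_def)
    moreover have "u \<in> pol R" if "u \<in> N" for u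
    proof -
      have "pderiv f \<in> pol R" "trunc f \<in> pol R" if "f \<in> B" for f
        using that B C trunc_closed by auto
      moreover have "premainder R f h \<in> pol R" if "f \<in> B" "h \<in> B - {0}" for f h
        using premainder[of f h] that B C unfolding is_premainder_def by blast
      ultimately show ?thesis using \<open>u \<in> N\<close> unfolding N_def by auto
    qed
    moreover have "closed e (C \<union> N)"
    proof -
      have inB: "f \<in> B" if "f \<in> C \<union> N" "e \<le> degree f" for f
        using that new unfolding B_def by fastforce
      show ?thesis unfolding closed_def
      proof (intro ballI impI conjI)
        fix f assume f: "f \<in> C \<union> N" "e \<le> degree f"
        show "pderiv f \<in> C \<union> N" "trunc f \<in> C \<union> N" using inB[OF f] by (auto simp: N_def)
        fix h assume h: "h \<in> C \<union> N" "h \<noteq> 0" "e \<le> degree h"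
        have "(f, h) \<in> B \<times> (B - {0})" using inB[OF f] inB[OF h(1,3)] h(2) by blast
        then have "premainder R f h \<in> (\<lambda>(f, h). premainder R f h) ` (B \<times> (B - {0}))"
          by (metis (no_types, lifting) case_prod_conv imageI)
        then show "premainder R f h \<in> C \<union> N" unfolding N_def by blast
      qed
    qed
    ultimately show ?case using C by (intro exI[of _ "C \<union> N"]) blast
  qed
  from this[of 0] obtain C where C: "finite C" "insert 0 F \<subseteq> C" "C \<subseteq> pol R" "closed 0 C" by blast
  show thesis
    by (rule that[of C]) (use C in \<open>auto simp: closed_def\<close>)
qed

locale sign_transfer = rcf_pair R1 R2 + D: subring_set D + \<phi>1: ring_map \<phi>1 + \<phi>2: ring_map \<phi>2 
  for R1 :: "'b::field set" and R2 :: "'c::field set" and D :: "'a::idom set" and \<phi>1 \<phi>2 +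
  assumes \<phi>1_closed: "\<phi>1 ` D \<subseteq> R1" and \<phi>2_closed: "\<phi>2 ` D \<subseteq> R2"
begin

text \<open>Specialisation may kill leading coefficients. As the signs of coefficients agree,
  \<open>\<phi>1\<close> and \<open>\<phi>2\<close> kill the same ones, and truncation replaces each
  member of \<open>C\<close> by 0 or a \<open>good\<close> one with the same pair of images. The
  images of good members are compatible, and their diagram yields a point in the position of
  \<open>y\<close>.\<close>

theorem one_variable:
  assumes C: "finite C" "C \<subseteq> pol D" 
    "\<And>f. f \<in> C \<Longrightarrow> pderiv f \<in> C" "\<And>f. f \<in> C \<Longrightarrow> trunc f \<in> C"
    "\<And>f h. f \<in> C \<Longrightarrow> h \<in> C \<Longrightarrow> h \<noteq> 0 \<Longrightarrow> premainder D f h \<in> C"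
    and sgn: "\<And>f i. f \<in> C \<Longrightarrow> sg R1 (\<phi>1 (poly.coeff f i)) = sg R2 (\<phi>2 (poly.coeff f i))"
    and y: "y \<in> R2"
  shows "\<exists>x\<in>R1. \<forall>f\<in>C. sg R1 (poly (map_poly \<phi>1 f) x) = sg R2 (poly (map_poly \<phi>2 f) y)"
proof -
  define good where "good f \<longleftrightarrow> f \<in> C \<and> \<phi>1 (lead_coeff f) \<noteq> 0" for f
  have coeff0: "\<phi>1 (poly.coeff f i) = 0 \<longleftrightarrow> \<phi>2 (poly.coeff f i) = 0" if "f \<in> C" for f i
    using sgn[OF that, of i] A.sg_eq_0_iff B.sg_eq_0_iff by metis
  have reduce: "\<exists>g. (g = 0 \<or> good g) \<and> degree g \<le> degree f \<and> map_poly \<phi>1 f = map_poly \<phi>1 g \<and> map_poly \<phi>2 f = map_poly \<phi>2 g"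
    if "f \<in> C" for f
    using that
  proof (induction "degree f" arbitrary: f rule: less_induct)
    case less
    show ?case
    proof (cases "\<phi>1 (lead_coeff f) = 0")
      case False
      then show ?thesis using less.prems by (intro exI[of _ f]) (auto simp: good_def)
    next
      case True
      then have T2: "\<phi>2 (lead_coeff f) = 0" using coeff0 less.prems by blast
      have eqs: "map_poly \<phi>1 (trunc f) = map_poly \<phi>1 f" "map_poly \<phi>2 (trunc f) = map_poly \<phi>2 f"
        using \<phi>1.map_trunc[OF True] \<phi>2.map_trunc[OF T2] by auto
      show ?thesis
      proof (cases "degree f = 0")
        case True
        then show ?thesis using eqs trunc_const[OF True] by (intro exI[of _ 0]) auto
      next
        case False
        obtain g where "g = 0 \<or> good g" "degree g \<le> degree (trunc f)" 
          "map_poly \<phi>1 (trunc f) = map_poly \<phi>1 g" "map_poly \<phi>2 (trunc f) = map_poly \<phi>2 g"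
          using less.hyps[OF trunc_less[OF False] C(4)[OF less.prems]] by blast
        then show ?thesis using eqs trunc_less[OF False] by (intro exI[of _ g]) auto
      qed
    qed
  qed
  define T where "T = (\<lambda>f. (map_poly \<phi>1 f, map_poly \<phi>2 f)) ` {f. good f}"
  have inT: "(map_poly \<phi>1 f, map_poly \<phi>2 f) \<in> T" if "good f" for f
    using that by (auto simp: T_def)
  have in_T_iff: "map_poly \<phi>1 f = 0 \<and> map_poly \<phi>2 f = 0 \<or> 
       map_poly \<phi>1 f \<noteq> 0 \<and> (map_poly \<phi>1 f, map_poly \<phi>2 f) \<in> T" if f: "f \<in> C" for f
  proof -
    obtain g where g: "g = 0 \<or> good g" "map_poly \<phi>1 f = map_poly \<phi>1 g" "map_poly \<phi>2 f = map_poly \<phi>2 g"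
      using reduce[OF f] by blast
    show ?thesis
    proof (cases "g = 0")
      case False
      then have "good g" using g by blast
      then have "map_poly \<phi>1 g \<noteq> 0" using \<phi>1.coeff_map[of g "degree g"] unfolding good_def by (metis coeff_0)
      then show ?thesis using g inT[OF \<open>good g\<close>] by simp
    qed (use g in auto)
  qed
  have good_props: "map_poly \<phi>1 f \<in> pol R1" "map_poly \<phi>2 f \<in> pol R2" "map_poly \<phi>1 f \<noteq> 0" "map_poly \<phi>2 f \<noteq> 0"
    "degree (map_poly \<phi>1 f) = degree f" "degree (map_poly \<phi>2 f) = degree f"
    "lead_coeff (map_poly \<phi>1 f) = \<phi>1 (lead_coeff f)" "lead_coeff (map_poly \<phi>2 f) = \<phi>2 (lead_coeff f)"
    "f \<in> C" "f \<noteq> 0" if "good f" for f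
  proof -
    show f: "f \<in> C" using that by (simp add: good_def)
    have nz: "\<phi>1 (lead_coeff f) \<noteq> 0" "\<phi>2 (lead_coeff f) \<noteq> 0" 
      using that coeff0[OF f] by (auto simp: good_def)
    show "map_poly \<phi>1 f \<in> pol R1" "map_poly \<phi>2 f \<in> pol R2"
      using \<phi>1.map_pol \<phi>2.map_pol \<phi>1_closed \<phi>2_closed f C(2) by blast+
    show "degree (map_poly \<phi>1 f) = degree f" "degree (map_poly \<phi>2 f) = degree f"
      "lead_coeff (map_poly \<phi>1 f) = \<phi>1 (lead_coeff f)" "lead_coeff (map_poly \<phi>2 f) = \<phi>2 (lead_coeff f)"
      using \<phi>1.lead_coeff_map[OF nz(1)] \<phi>2.lead_coeff_map[OF nz(2)] by auto
    show "map_poly \<phi>1 f \<noteq> 0" "map_poly \<phi>2 f \<noteq> 0"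
      using nz \<phi>1.coeff_map[of f "degree f"] \<phi>2.coeff_map[of f "degree f"] by (metis coeff_0)+
    show "f \<noteq> 0" using nz by auto
  qed
  have "compatible T"
    unfolding compatible_def
  proof (intro conjI allI impI)
    show "finite T" using C(1) by (auto simp: T_def good_def)
    fix f1 f2 assume "(f1, f2) \<in> T"
    then obtain f where f: "good f" "f1 = map_poly \<phi>1 f" "f2 = map_poly \<phi>2 f" by (auto simp: T_def)
    note p = good_props[OF f(1)]
    show "f1 \<in> pol R1" "f2 \<in> pol R2" "f1 \<noteq> 0" "f2 \<noteq> 0" "degree f1 = degree f2" using p f by auto
    show "sg R1 (lead_coeff f1) = sg R2 (lead_coeff f2)"
      unfolding f(2,3) p(7,8) using sgn[OF p(9)] .
    show "(pderiv f1, pderiv f2) \<in> T" if "degree f1 \<noteq> 0"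
      using in_T_iff[OF C(3)[OF p(9)]] A.pderiv_neq_0(1)[OF that]
      unfolding f \<phi>1.map_pderiv \<phi>2.map_pderiv by blast
    show "remainder_in T f1 f2 h1 h2" if "(h1, h2) \<in> T" for h1 h2
    proof -
      obtain h where h: "good h" "h1 = map_poly \<phi>1 h" "h2 = map_poly \<phi>2 h" using \<open>(h1, h2) \<in> T\<close> by (auto simp: T_def)
      note q = good_props[OF h(1)]
      define r where "r = premainder D f h"
      have rC: "r \<in> C" unfolding r_def using C(5) p q by blast
      have "is_premainder D f h r" unfolding r_def using D.premainder[of f h] p q C(2) by blast
      then obtain k s where r: "r = 0 \<or> degree r < degree h" "smult (lead_coeff h ^ k) f = h * s + r"
        unfolding is_premainder_def by blast
      have e1: "smult (lead_coeff h1 ^ k) f1 = h1 * map_poly \<phi>1 s + map_poly \<phi>1 r"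
        using arg_cong[OF r(2), of "map_poly \<phi>1"] unfolding f h q(7)
        by (simp add: \<phi>1.map_smult \<phi>1.map_add \<phi>1.map_mult)
      have e2: "smult (lead_coeff h2 ^ k) f2 = h2 * map_poly \<phi>2 s + map_poly \<phi>2 r"
        using arg_cong[OF r(2), of "map_poly \<phi>2"] unfolding f h q(8)
        by (simp add: \<phi>2.map_smult \<phi>2.map_add \<phi>2.map_mult)
      \<comment> \<open>As a good polynomial, \<open>h\<close> keeps its degree, whereas that of
        \<open>r\<close> can only drop.\<close>
      have "degree (map_poly \<phi>1 r) < degree h1" if "map_poly \<phi>1 r \<noteq> 0"
      proof -
        have "r \<noteq> 0" using that by auto
        then show ?thesis using r(1) \<phi>1.degree_map_le[of r] q(5) h(2) by simp
      qed
      then show ?thesis unfolding remainder_in_def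
        using e1 e2 in_T_iff[OF rC] by blast
    qed
  qed
  then obtain Z where Z: "diagram R1 R2 T Z" using diagram_exists by blast
  \<comment> \<open>The given point lies in \<open>R2\<close>, so a similar one is sought in the
    opposite direction.\<close>
  interpret sw: rcf_pair R2 R1 by unfold_locales
  have "matching R1 R2 Z" using Z by (simp add: diagram_def)
  then obtain x where x: "x \<in> R1" "similar Z x y"
    using sw.sim_exists[OF matching_converse y] unfolding sim_converse by blast
  have sgT: "sg R1 (poly p x) = sg R2 (poly q y)" if "(p, q) \<in> T" for p q
    using Z x y that unfolding diagram_def by blast
  have "sg R1 (poly (map_poly \<phi>1 f) x) = sg R2 (poly (map_poly \<phi>2 f) y)" if "f \<in> C" for f
    using in_T_iff[OF that] sgT by fastforce
  then show ?thesis using x by blast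
qed

end

section \<open>Polynomials in finitely many variables\<close>

definition mon :: "(nat \<Rightarrow> 'l::field) \<Rightarrow> (nat \<Rightarrow>\<^sub>0 nat) \<Rightarrow> 'l" where
  "mon y \<mu> = (\<Prod>i\<in>Poly_Mapping.keys \<mu>. y i ^ Poly_Mapping.lookup \<mu> i)"

lemma mon_superset:
  assumes "finite A" "Poly_Mapping.keys \<mu> \<subseteq> A"
  shows "mon y \<mu> = (\<Prod>i\<in>A. y i ^ Poly_Mapping.lookup \<mu> i)"
  unfolding mon_def using assms by (intro prod.mono_neutral_left) (auto simp: in_keys_iff)

lemma mon_add: "mon y (\<mu> + \<nu>) = mon y \<mu> * mon y \<nu>"
proof -
  let ?A = "Poly_Mapping.keys \<mu> \<union> Poly_Mapping.keys \<nu>"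
  have "mon y (\<mu> + \<nu>) = (\<Prod>i\<in>?A. y i ^ Poly_Mapping.lookup (\<mu> + \<nu>) i)"
    by (rule mon_superset) (use Poly_Mapping.keys_add[of \<mu> \<nu>] in auto)
  also have "\<dots> = (\<Prod>i\<in>?A. y i ^ Poly_Mapping.lookup \<mu> i) * (\<Prod>i\<in>?A. y i ^ Poly_Mapping.lookup \<nu> i)"
    by (simp add: lookup_add power_add prod.distrib)
  also have "\<dots> = mon y \<mu> * mon y \<nu>"
    using mon_superset[of ?A \<mu> y] mon_superset[of ?A \<nu> y] by simp
  finally show ?thesis .
qed

lemma mon_0 [simp]: "mon y 0 = 1"
  by (simp add: mon_def)

text \<open>The map \<open>h\<close> moves coefficients into a larger field, where the generic point
  has its coordinates.\<close>

definition ev :: "('k::field \<Rightarrow> 'l::field) \<Rightarrow> (nat \<Rightarrow> 'l) \<Rightarrow> 'k mpolynomial \<Rightarrow> 'l" where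
  "ev h y f = (\<Sum>\<mu>\<in>Poly_Mapping.keys f. h (Poly_Mapping.lookup f \<mu>) * mon y \<mu>)"

definition Var :: "nat \<Rightarrow> 'k::field mpolynomial" where
  "Var i = Poly_Mapping.single (Poly_Mapping.single i 1) 1"

definition Const :: "'k::field \<Rightarrow> 'k mpolynomial" where
  "Const c = Poly_Mapping.single 0 c"

text \<open>Arbitrary sets of variables are allowed because coordinates are treated one at a time,
  in an order that may depend on the ideal.\<close>

definition poly_in :: "nat set \<Rightarrow> 'k::field mpolynomial set" where
  "poly_in S = {f. \<forall>\<mu>\<in>Poly_Mapping.keys f. Poly_Mapping.keys \<mu> \<subseteq> S}"

lemma sum_singles:
  "f = (\<Sum>\<mu>\<in>Poly_Mapping.keys f. Poly_Mapping.single \<mu> (Poly_Mapping.lookup f \<mu>))"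
proof (rule poly_mapping_eqI)
  fix k
  have "(\<Sum>\<mu>\<in>Poly_Mapping.keys f. Poly_Mapping.lookup (Poly_Mapping.single \<mu> (Poly_Mapping.lookup f \<mu>)) k)
     = (\<Sum>\<mu>\<in>Poly_Mapping.keys f. if \<mu> = k then Poly_Mapping.lookup f \<mu> else 0)"
    by (intro sum.cong) (auto simp: lookup_single when_def)
  also have "\<dots> = Poly_Mapping.lookup f k" by (simp add: in_keys_iff)
  finally show "Poly_Mapping.lookup f k = Poly_Mapping.lookup
     (\<Sum>\<mu>\<in>Poly_Mapping.keys f. Poly_Mapping.single \<mu> (Poly_Mapping.lookup f \<mu>)) k"
    by (simp add: lookup_sum)
qed

locale field_map = ring_map h for h :: "'k::field \<Rightarrow> 'l::field"
begin

lemma ev_superset: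
  assumes "finite A" "Poly_Mapping.keys f \<subseteq> A"
  shows "ev h y f = (\<Sum>\<mu>\<in>A. h (Poly_Mapping.lookup f \<mu>) * mon y \<mu>)"
  unfolding ev_def using assms by (intro sum.mono_neutral_left) (auto simp: in_keys_iff)

lemma h_eq_0_iff [simp]: "h c = 0 \<longleftrightarrow> c = 0"
proof
  assume "h c = 0"
  then have "h (c * inverse c) = 0" by (simp del: right_inverse)
  then show "c = 0" by (cases "c = 0") auto
qed simp

lemma h_inverse: "h (inverse c) = inverse (h c)"
  by (cases "c = 0") (auto simp: inverse_unique[symmetric] simp flip: mult one)

lemma ev_add: "ev h y (f + g) = ev h y f + ev h y g"
proof -
  let ?A = "Poly_Mapping.keys f \<union> Poly_Mapping.keys g"
  have "ev h y (f + g) = (\<Sum>\<mu>\<in>?A. h (Poly_Mapping.lookup (f + g) \<mu>) * mon y \<mu>)"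
    by (rule ev_superset) (use Poly_Mapping.keys_add[of f g] in auto)
  also have "\<dots> = ev h y f + ev h y g"
    using ev_superset[of ?A f y] ev_superset[of ?A g y]
    by (simp add: lookup_add sum.distrib distrib_right)
  finally show ?thesis .
qed

lemma ev_0: "ev h y 0 = 0"
  by (simp add: ev_def)

lemma ev_sum: "ev h y (sum F A) = (\<Sum>x\<in>A. ev h y (F x))"
  by (induction A rule: infinite_finite_induct) (auto simp: ev_add ev_0)

lemma ev_single: "ev h y (Poly_Mapping.single \<mu> c) = h c * mon y \<mu>"
  by (simp add: ev_def)

lemma ev_mult: "ev h y (f * g) = ev h y f * ev h y g"
proof -
  let ?s = "\<lambda>f \<mu>. Poly_Mapping.single \<mu> (Poly_Mapping.lookup f \<mu>)"
  have "f * g = (\<Sum>\<mu>\<in>Poly_Mapping.keys f. ?s f \<mu>) * (\<Sum>\<nu>\<in>Poly_Mapping.keys g. ?s g \<nu>)"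
    using sum_singles[of f] sum_singles[of g] by simp
  also have "\<dots> = (\<Sum>\<mu>\<in>Poly_Mapping.keys f. \<Sum>\<nu>\<in>Poly_Mapping.keys g. ?s f \<mu> * ?s g \<nu>)"
    by (rule sum_product)
  finally have "ev h y (f * g) = (\<Sum>\<mu>\<in>Poly_Mapping.keys f. \<Sum>\<nu>\<in>Poly_Mapping.keys g. ev h y (?s f \<mu> * ?s g \<nu>))"
    by (simp only: ev_sum)
  also have "\<dots> = (\<Sum>\<mu>\<in>Poly_Mapping.keys f. \<Sum>\<nu>\<in>Poly_Mapping.keys g. ev h y (?s f \<mu>) * ev h y (?s g \<nu>))"
    by (simp add: mult_single ev_single mon_add ac_simps)
  also have "\<dots> = (\<Sum>\<mu>\<in>Poly_Mapping.keys f. ev h y (?s f \<mu>)) * (\<Sum>\<nu>\<in>Poly_Mapping.keys g. ev h y (?s g \<nu>))"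
    by (rule sum_product[symmetric])
  also have "\<dots> = ev h y f * ev h y g"
    by (simp only: ev_single) (simp only: ev_def)
  finally show ?thesis .
qed

lemma ev_Const [simp]: "ev h y (Const c) = h c"
  by (simp add: Const_def ev_single)

lemma ev_1: "ev h y 1 = 1"
  using ev_Const[of y 1] by (simp add: Const_def)

lemma ev_Var [simp]: "ev h y (Var i) = y i"
  by (simp add: Var_def ev_single mon_def)

lemma ev_ring_map: "ring_map (ev h y)"
  by standard (simp_all add: ev_add ev_mult ev_1)

lemma mon_cong: "(\<And>i. i \<in> Poly_Mapping.keys \<mu> \<Longrightarrow> y i = z i) \<Longrightarrow> mon y \<mu> = mon z \<mu>"
  unfolding mon_def by (intro prod.cong) auto

lemma ev_cong: "f \<in> poly_in S \<Longrightarrow> (\<And>i. i \<in> S \<Longrightarrow> y i = z i) \<Longrightarrow> ev h y f = ev h z f"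
  unfolding ev_def poly_in_def by (intro sum.cong) (auto intro!: arg_cong2[of _ _ _ _ "(*)"] mon_cong)

end

lemma poly_in_subring: "subring_set (poly_in S)"
proof
  show "f - g \<in> poly_in S" if "f \<in> poly_in S" "g \<in> poly_in S" for f g :: "'a mpolynomial"
    using that keys_diff[of f g] unfolding poly_in_def by blast
  show "f * g \<in> poly_in S" if "f \<in> poly_in S" "g \<in> poly_in S" for f g :: "'a mpolynomial"
  proof -
    have "Poly_Mapping.keys \<mu> \<subseteq> S" if \<mu>: "\<mu> \<in> Poly_Mapping.keys (f * g)" for \<mu>
    proof -
      obtain a b where "\<mu> = a + b" "a \<in> Poly_Mapping.keys f" "b \<in> Poly_Mapping.keys g"
        using keys_mult[of f g] \<mu> by blast
      then show ?thesis
        using Poly_Mapping.keys_add[of a b] \<open>f \<in> poly_in S\<close> \<open>g \<in> poly_in S\<close> 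
        unfolding poly_in_def by blast
    qed
    then show ?thesis by (simp add: poly_in_def)
  qed
qed (simp add: poly_in_def)

lemma Const_in [simp]: "Const c \<in> poly_in S"
  by (simp add: Const_def poly_in_def)

lemma Var_in: "i \<in> S \<Longrightarrow> Var i \<in> poly_in S"
  by (simp add: Var_def poly_in_def)

lemma poly_in_mono: "S \<subseteq> S' \<Longrightarrow> poly_in S \<subseteq> poly_in S'"
  by (auto simp: poly_in_def)

lemma poly_in_empty: "f \<in> poly_in {} \<Longrightarrow> \<exists>c. f = Const c"
proof -
  assume f: "f \<in> poly_in {}"
  then have "Poly_Mapping.keys f \<subseteq> {0}" by (auto simp: poly_in_def)
  then have "f = (\<Sum>\<mu>\<in>{0}. Poly_Mapping.single \<mu> (Poly_Mapping.lookup f \<mu>))"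
    by (subst sum_singles, intro sum.mono_neutral_left) (auto simp: in_keys_iff)
  then show ?thesis unfolding Const_def by auto
qed

lemma Var_power: "(Var i :: 'a::field mpolynomial) ^ n = Poly_Mapping.single (Poly_Mapping.single i n) 1"
proof (induction n)
  case (Suc n)
  have "Var i ^ Suc n = Var i * (Poly_Mapping.single (Poly_Mapping.single i n) 1 :: 'a mpolynomial)"
    by (simp add: Suc)
  also have "\<dots> = Poly_Mapping.single (Poly_Mapping.single i 1 + Poly_Mapping.single i n) 1"
    by (simp only: Var_def mult_single mult_1)
  finally show ?case by (simp flip: single_add)
qed simp

lemma poly_in_insert:
  assumes "f \<in> poly_in (insert i S)"
  shows "\<exists>p\<in>pol (poly_in S). f = poly p (Var i)"
proof -
  interpret D: subring_set "poly_in S :: 'a mpolynomial set" by (rule poly_in_subring)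
  interpret A: subring_set "adjoin (poly_in S :: 'a mpolynomial set) (Var i)" by (rule D.adjoin_subring)
  have "Poly_Mapping.single \<mu> c \<in> adjoin (poly_in S) (Var i)" 
    if \<mu>: "Poly_Mapping.keys \<mu> \<subseteq> insert i S" for \<mu> and c :: 'a
  proof -
    define \<nu> where "\<nu> = \<mu> - Poly_Mapping.single i (Poly_Mapping.lookup \<mu> i)"
    have eq: "\<nu> + Poly_Mapping.single i (Poly_Mapping.lookup \<mu> i) = \<mu>"
      by (rule poly_mapping_eqI) (auto simp: \<nu>_def lookup_add lookup_minus lookup_single when_def)
    have "Poly_Mapping.lookup \<nu> i = 0" by (simp add: \<nu>_def lookup_minus)
    moreover have "Poly_Mapping.keys \<nu> \<subseteq> Poly_Mapping.keys \<mu>"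
      by (auto simp: in_keys_iff \<nu>_def lookup_minus)
    ultimately have "Poly_Mapping.keys \<nu> \<subseteq> S" using \<mu> by (auto simp: in_keys_iff)
    then have "Poly_Mapping.single \<nu> c \<in> poly_in S" by (simp add: poly_in_def)
    then have "Poly_Mapping.single \<nu> c \<in> adjoin (poly_in S) (Var i)"
      using D.subset_adjoin by blast
    then have "Poly_Mapping.single \<nu> c * Var i ^ Poly_Mapping.lookup \<mu> i \<in> adjoin (poly_in S) (Var i)"
      using D.adjoin_mem by simp
    then show ?thesis by (simp add: Var_power mult_single eq)
  qed
  then have "(\<Sum>\<mu>\<in>Poly_Mapping.keys f. Poly_Mapping.single \<mu> (Poly_Mapping.lookup f \<mu>)) \<in> adjoin (poly_in S) (Var i)"
    using assms by (intro A.sum_closed) (auto simp: poly_in_def)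
  then show ?thesis by (auto simp: adjoin_def simp flip: sum_singles)
qed

text \<open>Squares of \<open>R1\<close> remain squares in \<open>R2\<close>, and the order of a
  Euclidean field is determined by its squares.\<close>

lemma sg_subset:
  assumes "euclidean_field R1" "euclidean_field R2" "R1 \<subseteq> R2" "c \<in> R1"
  shows "sg R1 c = sg R2 c"
proof -
  interpret A: euclidean_field R1 by fact
  interpret B: euclidean_field R2 by fact
  consider "c = 0" | "sg R1 c = 1" | "sg R1 c = -1" using A.sg_cases[of c] by auto
  then show ?thesis
  proof cases
    case 2
    then obtain y where "y \<in> R1" "c = y * y" "y \<noteq> 0" using A.sg_eq_1D by blast
    then show ?thesis using 2 B.sg_square[of y] assms(3) by auto
  next
    case 3
    then obtain y where "y \<in> R1" "c = - (y * y)" "y \<noteq> 0" using A.sg_eq_minus_1D[OF assms(4)] by blast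
    then show ?thesis using 3 B.sg_square[of y] B.sg_uminus[of "y * y"] assms(3) by auto
  qed simp
qed

text \<open>
  The relations over \<open>h\<close> satisfied by \<open>y\<close> are carried along, so that no
  finiteness of ideals is needed: those involving a new coordinate all follow from one of minimal
  degree in it.
\<close>
theorem (in field_map) transfer:
  assumes R: "rcf R1" "rcf R2" "R1 \<subseteq> R2" "range h \<subseteq> R1"
    and S: "finite S"
  shows "finite F \<Longrightarrow> F \<subseteq> poly_in S \<Longrightarrow> (\<And>i. i \<in> S \<Longrightarrow> y i \<in> R2) \<Longrightarrow>
    \<exists>x. (\<forall>i\<in>S. x i \<in> R1) \<and> (\<forall>f\<in>F. sg R1 (ev h x f) = sg R2 (ev h y f)) \<and>
        (\<forall>f\<in>poly_in S. ev h y f = 0 \<longrightarrow> ev h x f = 0)"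
  using S
proof (induction S arbitrary: F rule: finite_induct)
  case empty
  interpret A: rcf R1 by fact
  interpret B: rcf R2 by fact
  have *: "sg R1 (h c) = sg R2 (h c)" for c
    using sg_subset[OF A.euclidean_field_axioms B.euclidean_field_axioms R(3)] R(4) by auto
  show ?case
  proof (intro exI[of _ y] conjI ballI impI)
    show "sg R1 (ev h y f) = sg R2 (ev h y f)" if fF: "f \<in> F" for f
    proof -
      obtain c where "f = Const c" using poly_in_empty fF empty.prems(2) by blast
      then show ?thesis using * by simp
    qed
  qed auto
next
  case (insert i S)
  interpret A: rcf R1 by fact
  interpret B: rcf R2 by fact
  interpret pair: rcf_pair R1 R2 by unfold_locales
  let ?D = "poly_in S :: 'k mpolynomial set"
  interpret D: subring_set ?D by (rule poly_in_subring)
  interpret E2: ring_map "ev h y" by (rule ev_ring_map)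
  have ev_closed: "ev h z f \<in> R" if "subring_set R" "range h \<subseteq> R" "f \<in> poly_in T" "\<And>i. i \<in> T \<Longrightarrow> z i \<in> R" for z f R T
  proof -
    interpret subring_set R by fact
    show ?thesis
      unfolding ev_def mon_def using that(2-) by (intro sum_closed mult_closed prod_closed power_closed) (auto simp: poly_in_def)
  qed
  have yS: "y i \<in> R2" "\<And>j. j \<in> S \<Longrightarrow> y j \<in> R2" using insert.prems by auto
  have "\<forall>f\<in>F. \<exists>p\<in>pol ?D. f = poly p (Var i)"
    using poly_in_insert insert.prems(2) by blast
  then obtain rep where rep: "\<And>f. f \<in> F \<Longrightarrow> rep f \<in> pol ?D \<and> f = poly (rep f) (Var i)" by metis
  \<comment> \<open>\<open>Q\<close> collects the nontrivial algebraic relations of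
    \<open>y i\<close> over the earlier coordinates. If there are none, 0 stands in for
    \<open>q\<close>, which does no harm in the family \<open>C\<close>.\<close>
  define Q where "Q = {q \<in> pol ?D. map_poly (ev h y) q \<noteq> 0 \<and> poly (map_poly (ev h y) q) (y i) = 0}"
  define q where "q = (if Q = {} then 0 else arg_min degree (\<lambda>q. q \<in> Q))"
  have q: "q \<in> Q" "\<And>p. p \<in> Q \<Longrightarrow> degree q \<le> degree p" if ne: "Q \<noteq> {}"
  proof -
    obtain p0 where "p0 \<in> Q" using ne by blast
    then show "q \<in> Q" "\<And>p. p \<in> Q \<Longrightarrow> degree q \<le> degree p"
      using arg_min_natI[of "\<lambda>q. q \<in> Q" p0 degree] arg_min_nat_le[of "\<lambda>q. q \<in> Q" _ degree] ne
      by (auto simp: q_def)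
  qed
  have "q \<in> pol ?D" using q by (cases "Q = {}") (auto simp: q_def Q_def)
  then have "finite (insert q (rep ` F))" "insert q (rep ` F) \<subseteq> pol ?D"
    using insert.prems(1) rep by auto
  then obtain C where C: "finite C" "insert q (rep ` F) \<subseteq> C" "C \<subseteq> pol ?D" 
    "\<And>f. f \<in> C \<Longrightarrow> pderiv f \<in> C" "\<And>f. f \<in> C \<Longrightarrow> trunc f \<in> C"
    "\<And>f h. f \<in> C \<Longrightarrow> h \<in> C \<Longrightarrow> h \<noteq> 0 \<Longrightarrow> premainder ?D f h \<in> C"
    using D.remainder_closure by metis
  \<comment> \<open>The induction hypothesis is applied to all coefficients of the closed family, so
    their signs are settled before the last coordinate \<open>a\<close> is chosen.\<close>
  define G where "G = (\<Union>f\<in>C. poly.coeff f ` {..degree f})"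
  have "finite G" "G \<subseteq> ?D" using C(1,3) by (auto simp: G_def pol_def)
  then obtain x where x: "\<forall>j\<in>S. x j \<in> R1" "\<forall>g\<in>G. sg R1 (ev h x g) = sg R2 (ev h y g)"
     "\<forall>f\<in>poly_in S. ev h y f = 0 \<longrightarrow> ev h x f = 0"
    using insert.IH[of G] yS by blast
  interpret E1: ring_map "ev h x" by (rule ev_ring_map)
  have sgC: "sg R1 (ev h x (poly.coeff f j)) = sg R2 (ev h y (poly.coeff f j))" if "f \<in> C" for f j
  proof (cases "j \<le> degree f")
    case True
    then have "poly.coeff f j \<in> G" using that by (auto simp: G_def)
    then show ?thesis using x(2) by blast
  next
    case False
    then show ?thesis by (simp add: coeff_eq_0)
  qed
  interpret T: sign_transfer R1 R2 ?D "ev h x" "ev h y"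
  proof unfold_locales
    show "ev h x ` ?D \<subseteq> R1" using ev_closed[OF A.subring_set_axioms R(4)] x(1) by blast
    have "range h \<subseteq> R2" using R by blast
    then show "ev h y ` ?D \<subseteq> R2" using ev_closed[OF B.subring_set_axioms] yS by blast
  qed
  obtain a where a: "a \<in> R1" "\<And>f. f \<in> C \<Longrightarrow> 
      sg R1 (poly (map_poly (ev h x) f) a) = sg R2 (poly (map_poly (ev h y) f) (y i))"
    using T.one_variable[OF C(1,3-6) sgC yS(1)] by blast
  define x' where "x' = x(i := a)"
  have ev_x': "ev h x' (poly p (Var i)) = poly (map_poly (ev h x) p) a" if p: "p \<in> pol ?D" for p
  proof -
    interpret E3: ring_map "ev h x'" by (rule ev_ring_map)
    have "map_poly (ev h x') p = map_poly (ev h x) p"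
    proof (rule poly_eqI)
      fix j
      have "ev h x' (poly.coeff p j) = ev h x (poly.coeff p j)"
        using p insert.hyps by (intro ev_cong[of _ S]) (auto simp: pol_def x'_def)
      then show "poly.coeff (map_poly (ev h x') p) j = poly.coeff (map_poly (ev h x) p) j" by simp
    qed
    then show ?thesis using E3.poly_map[of p "Var i"] by (simp add: x'_def)
  qed
  have ev_y: "ev h y (poly p (Var i)) = poly (map_poly (ev h y) p) (y i)" for p
    using E2.poly_map[of p "Var i"] by simp
  have vanish: "ev h x' f = 0" if f: "f \<in> poly_in (insert i S)" "ev h y f = 0" for f
  proof -
    obtain p where p: "p \<in> pol ?D" "f = poly p (Var i)" using poly_in_insert[OF f(1)] by blast
    have p0: "poly (map_poly (ev h y) p) (y i) = 0" using f(2) p(2) ev_y by simp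
    \<comment> \<open>A polynomial whose coefficients all vanish at \<open>y\<close> has
      coefficients that are relations in the earlier variables, and these are carried along.\<close>
    have map0: "map_poly (ev h x) r = 0" if "r \<in> pol ?D" "map_poly (ev h y) r = 0" for r
    proof (rule poly_eqI)
      fix j
      have "ev h y (poly.coeff r j) = 0" using that(2) E2.coeff_map[of r j] by simp
      then show "poly.coeff (map_poly (ev h x) r) j = poly.coeff 0 j"
        using x(3) that(1) by (simp add: pol_def)
    qed
    show ?thesis
    proof (cases "Q = {}")
      case True
      then have "map_poly (ev h y) p = 0" using p p0 by (auto simp: Q_def)
      then show ?thesis using map0 p ev_x' by simp
    next
      case False
      note qQ = q(1)[OF False] and q_min = q(2)[OF False]
      have qD: "q \<in> pol ?D" "map_poly (ev h y) q \<noteq> 0" "poly (map_poly (ev h y) q) (y i) = 0"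
        using qQ by (auto simp: Q_def)
      have lcq: "ev h y (lead_coeff q) \<noteq> 0"
        using qD E2.map_trunc[of q] D.trunc_closed
        by (intro E2.lead_coeff_minimal[OF qQ q_min]) (auto simp: Q_def)
      then have "q \<noteq> 0" by auto
      \<comment> \<open>The remainder of \<open>p\<close> modulo \<open>q\<close> vanishes at
        \<open>y i\<close> and has smaller degree, so it is trivial by minimality of
        \<open>q\<close>. Over \<open>R1\<close>, \<open>a\<close> is a root of \<open>q\<close>
        because \<open>q\<close> belongs to \<open>C\<close>, and the leading coefficient of
        \<open>q\<close> stays nonzero.\<close>
      from D.pseudo_division[OF p(1) qD(1) this] obtain k s r where r: "s \<in> pol ?D" "r \<in> pol ?D"
        "smult (lead_coeff q ^ k) p = q * s + r" "r = 0 \<or> degree r < degree q" by blast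
      have "poly (map_poly (ev h y) r) (y i) = 0"
        using E2.map_division[OF r(3), of "y i"] qD(3) p0 by simp
      then have "map_poly (ev h y) r = 0" using q_min[of r] r by (fastforce simp: Q_def)
      then have r0: "map_poly (ev h x) r = 0" using map0 r by blast
      have qC: "q \<in> C" using C(2) by blast
      have "sg R1 (poly (map_poly (ev h x) q) a) = 0" using a(2)[OF qC] qD(3) by simp
      then have "poly (map_poly (ev h x) q) a = 0" by simp
      then have "ev h x (lead_coeff q) ^ k * poly (map_poly (ev h x) p) a = 0"
        using E1.map_division[OF r(3), of a] r0 by simp
      moreover have "ev h x (lead_coeff q) \<noteq> 0"
        using sgC[OF qC, of "degree q"] lcq A.sg_eq_0_iff B.sg_eq_0_iff by metis
      ultimately show ?thesis using ev_x'[OF p(1)] p(2) by simp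
    qed
  qed
  have "sg R1 (ev h x' f) = sg R2 (ev h y f)" if "f \<in> F" for f
    using rep[OF that] a(2)[of "rep f"] C(2) that ev_x' ev_y by (metis image_eqI insert_subset subsetD)
  moreover have "x' j \<in> R1" if "j \<in> insert i S" for j
    using that x(1) a(1) by (auto simp: x'_def)
  ultimately show ?case using vanish by blast
qed

section \<open>Real closed subrings containing a given one\<close>

text \<open>A sum of squares has finitely many terms, so one member of the chain contains them
  all.\<close>

lemma sos_Union_chain:
  assumes "subset.chain A C" "C \<noteq> {}" "s \<in> sos (\<Union>C)"
  shows "\<exists>R\<in>C. s \<in> sos R"
  using assms(3)
proof (induction rule: sos.induct)
  case zero
  then show ?case using assms(2) by (auto intro: sos.zero)
next
  case (add x s)
  then obtain R1 R2 where R: "R1 \<in> C" "s \<in> sos R1" "R2 \<in> C" "x \<in> R2" by auto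
  then have "R1 \<subseteq> R2 \<or> R2 \<subseteq> R1" using assms(1) by (auto simp: subset.chain_def)
  then show ?case
  proof
    assume "R1 \<subseteq> R2"
    then show ?thesis using R sos_mono[of s R1 R2] by (auto intro: sos.add)
  next
    assume "R2 \<subseteq> R1"
    then show ?thesis using R by (auto intro: sos.add)
  qed
qed

theorem real_closed_subring_exists:
  fixes S :: "'a::alg_closed_field set"
  assumes "subring_set S" "formally_real S"
  shows "\<exists>R. S \<subseteq> R \<and> real_closed_subring R"
proof -
  define A where "A = {R. subring_set R \<and> formally_real R \<and> S \<subseteq> R}"
  have "\<exists>M\<in>A. \<forall>U\<in>A. M \<subseteq> U \<longrightarrow> U = M"
  proof (rule subset_Zorn_nonempty)
    show "A \<noteq> {}" using assms by (auto simp: A_def)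
    fix C assume C: "C \<noteq> {}" "subset.chain A C"
    have pair: "\<exists>R\<in>C. x \<in> R \<and> y \<in> R" if xy: "x \<in> \<Union>C" "y \<in> \<Union>C" for x y
    proof -
      obtain R1 R2 where R: "R1 \<in> C" "x \<in> R1" "R2 \<in> C" "y \<in> R2" using xy by auto
      then have "R1 \<subseteq> R2 \<or> R2 \<subseteq> R1" using C(2) by (auto simp: subset.chain_def)
      then show ?thesis using R by blast
    qed
    have CA: "subring_set R" "formally_real R" "S \<subseteq> R" if "R \<in> C" for R
      using that C(2) by (auto simp: subset.chain_def A_def)
    have "subring_set (\<Union>C)"
    proof
      show "1 \<in> \<Union>C" using C(1) CA(1) subring_set.one_closed by blast
      show "x - y \<in> \<Union>C" "x * y \<in> \<Union>C" if "x \<in> \<Union>C" "y \<in> \<Union>C" for x y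
        using pair[OF that] CA(1) subring_set.diff_closed subring_set.mult_closed by blast+
    qed
    moreover have "formally_real (\<Union>C)"
      unfolding formally_real_def
    proof (intro ballI impI)
      fix x s assume xs: "x \<in> \<Union>C" "s \<in> sos (\<Union>C)" "x * x + s = 0"
      obtain R1 where R1: "R1 \<in> C" "s \<in> sos R1" using sos_Union_chain[OF C(2,1) xs(2)] by blast
      obtain R2 where R2: "R2 \<in> C" "x \<in> R2" using xs by blast
      have "R1 \<subseteq> R2 \<or> R2 \<subseteq> R1" using R1 R2 C(2) by (auto simp: subset.chain_def)
      then obtain R where "R \<in> C" "x \<in> R" "s \<in> sos R" using R1 R2 sos_mono by blast
      then show "x = 0" using formally_realD[OF CA(2)] xs(3) by blast
    qed
    moreover have "S \<subseteq> \<Union>C" using C(1) CA(3) by blast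
    ultimately show "\<Union>C \<in> A" by (simp add: A_def)
  qed
  then obtain M where M: "M \<in> A" "\<And>U. U \<in> A \<Longrightarrow> M \<subseteq> U \<Longrightarrow> U = M" by blast
  have MR: "subring_set M" "formally_real M" "S \<subseteq> M" using M(1) by (auto simp: A_def)
  interpret M: subring_set M by fact
  have "real_closed_subring M"
  proof
    fix p a assume "formally_real (adjoin M a)"
    then have "adjoin M a \<in> A" using M.adjoin_subring M.subset_adjoin MR by (auto simp: A_def)
    then have "adjoin M a = M" using M(2) M.subset_adjoin by blast
    then show "a \<in> M" using M.adjoin_mem by blast
  qed (rule MR)
  then show ?thesis using MR by blast
qed


section \<open>Generic points of prime ideals\<close>

text \<open>Injectivity makes the images of the variables algebraically independent over the image
  of the constants: coordinates that satisfy no relation.\<close>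

locale mpoly_embedding = e: ring_map e for e :: "'k::field mpolynomial \<Rightarrow> 'l::alg_closed_field" +
  assumes e_inj: "e f = 0 \<Longrightarrow> f = 0"
begin

definition h :: "'k \<Rightarrow> 'l" where "h c = e (Const c)"

sublocale h: field_map h
proof
  show "h 1 = 1" by (simp add: h_def Const_def)
  show "h (x + y) = h x + h y" for x y by (simp add: h_def Const_def single_add flip: e.add)
  show "h (x * y) = h x * h y" for x y by (simp add: h_def Const_def mult_single flip: e.mult)
qed

lemma ev_generic: "finite S \<Longrightarrow> f \<in> poly_in S \<Longrightarrow> ev h (\<lambda>j. e (Var j)) f = e f"
proof (induction S arbitrary: f rule: finite_induct)
  case empty
  then obtain c where "f = Const c" using poly_in_empty by blast
  then show ?case using h.ev_Const h_def by metis
next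
  case (insert i S)
  interpret E: ring_map "ev h (\<lambda>j. e (Var j))" by (rule h.ev_ring_map)
  obtain p where p: "p \<in> pol (poly_in S)" "f = poly p (Var i)" using poly_in_insert insert.prems by blast
  have "map_poly (ev h (\<lambda>j. e (Var j))) p = map_poly e p"
    using p(1) insert.IH by (simp add: poly_eq_iff pol_def)
  then show ?case using E.poly_map[of p "Var i"] e.poly_map[of p "Var i"] p(2) by simp
qed

end

locale mpoly_prime = 
  fixes n :: nat and P :: "'k::field mpolynomial set"
  assumes P_subset: "P \<subseteq> poly_in {..<n}"
    and P_0: "0 \<in> P"
    and P_add: "f \<in> P \<Longrightarrow> g \<in> P \<Longrightarrow> f + g \<in> P"
    and P_mult: "f \<in> P \<Longrightarrow> g \<in> poly_in {..<n} \<Longrightarrow> g * f \<in> P"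
    and P_prime: "f \<in> poly_in {..<n} \<Longrightarrow> g \<in> poly_in {..<n} \<Longrightarrow> f * g \<in> P \<Longrightarrow> f \<in> P \<or> g \<in> P"
    and P_1: "1 \<notin> P"
begin

abbreviation "A \<equiv> poly_in {..<n} :: 'k mpolynomial set"

lemma P_diff: "f \<in> P \<Longrightarrow> g \<in> P \<Longrightarrow> f - g \<in> P"
proof -
  assume fg: "f \<in> P" "g \<in> P"
  interpret A: subring_set A by (rule poly_in_subring)
  have "(- 1) * g \<in> P" by (rule P_mult) (use fg in auto)
  then show "f - g \<in> P" using P_add[OF fg(1), of "- g"] by simp
qed

lemma P_power: "f \<in> A \<Longrightarrow> f \<notin> P \<Longrightarrow> f ^ k \<notin> P"
proof (induction k)
  case (Suc k)
  interpret A: subring_set A by (rule poly_in_subring)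
  show ?case using P_prime[of f "f ^ k"] Suc by auto
qed (use P_1 in simp)

lemma P_const: "f \<in> P \<inter> poly_in {} \<Longrightarrow> f = 0"
proof -
  assume f: "f \<in> P \<inter> poly_in {}"
  then obtain c where c: "f = Const c" using poly_in_empty by blast
  show "f = 0"
  proof (rule ccontr)
    assume "f \<noteq> 0"
    then have "c \<noteq> 0" by (auto simp: c Const_def)
    then have "Const (inverse c) * f = 1" by (simp add: c Const_def mult_single)
    moreover have "Const (inverse c) * f \<in> P" using f by (intro P_mult) auto
    ultimately show False using P_1 by simp
  qed
qed

lemma poly_in_P: "p \<in> pol A \<Longrightarrow> (\<And>j. poly.coeff p j \<in> P) \<Longrightarrow> i < n \<Longrightarrow> poly p (Var i) \<in> P"
proof (induction p)
  case (pCons c p)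
  interpret A: subring_set A by (rule poly_in_subring)
  have "c \<in> P" using pCons.prems(2)[of 0] by simp
  moreover have "poly.coeff p j \<in> P" for j using pCons.prems(2)[of "Suc j"] by simp
  then have "poly p (Var i) \<in> P" using pCons by simp
  then have "Var i * poly p (Var i) \<in> P" using pCons.prems(3) by (intro P_mult) (auto intro: Var_in)
  ultimately show ?case using P_add by simp
qed (simp add: P_0)

end

locale mpoly_generic = mpoly_embedding e + mpoly_prime n P for e :: "'k::field mpolynomial \<Rightarrow> 'l::alg_closed_field" and n :: nat and P :: "'k mpolynomial set"
begin

text \<open>A coordinate that is algebraic modulo \<open>P\<close> over the earlier ones is sent to
  a root \<open>a\<close> of a relation \<open>q\<close> of least degree. Pseudo-division by
  \<open>q\<close> shows that elements of \<open>P\<close> vanish at \<open>a\<close>; the converse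
  is the irreducibility of \<open>q\<close> modulo \<open>P\<close>, where primality enters.\<close>

lemma generic_step:
  assumes S: "S \<subseteq> {..<n}" "i < n" "i \<notin> S"
    and y: "\<And>f. f \<in> poly_in S \<Longrightarrow> ev h y f = 0 \<longleftrightarrow> f \<in> P"
    and p0: "p0 \<in> pol (poly_in S)" "poly p0 (Var i) \<in> P" "poly.coeff p0 j0 \<notin> P"
  shows "\<exists>a. \<forall>f\<in>poly_in (insert i S). ev h (y(i := a)) f = 0 \<longleftrightarrow> f \<in> P"
proof -
  let ?D = "poly_in S :: 'k mpolynomial set"
  let ?X = "Var i :: 'k mpolynomial"
  interpret A: subring_set A by (rule poly_in_subring)
  interpret D: subring_set ?D by (rule poly_in_subring)
  interpret E: ring_map "ev h y" by (rule h.ev_ring_map)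
  let ?m = "map_poly (ev h y)"
  have DA: "?D \<subseteq> A" using poly_in_mono S(1) by blast
  then have polA: "p \<in> pol A" if "p \<in> pol ?D" for p using that by (auto simp: pol_def)
  have XA: "?X \<in> A" using S(2) by (simp add: Var_in)
  have pX: "poly p ?X \<in> A" if "p \<in> pol ?D" for p using A.poly_closed[OF polA[OF that] XA] .
  have m0: "?m p = 0 \<longleftrightarrow> (\<forall>j. poly.coeff p j \<in> P)" if "p \<in> pol ?D" for p
    using y that by (auto simp: poly_eq_iff pol_def)
  have m0_P: "poly p ?X \<in> P" if "p \<in> pol ?D" "?m p = 0" for p
    using poly_in_P[OF polA[OF that(1)]] m0[OF that(1)] that(2) S(2) by blast
  have lc_P: "lead_coeff p \<in> P \<longleftrightarrow> ev h y (lead_coeff p) = 0" if "p \<in> pol ?D" for p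
    using y that by (auto simp: pol_def)
  have trunc_X: "poly (trunc p) ?X \<in> P \<longleftrightarrow> poly p ?X \<in> P" if "p \<in> pol ?D" "lead_coeff p \<in> P" for p
  proof -
    have "?X ^ degree p * lead_coeff p \<in> P" using that XA by (intro P_mult) auto
    then have u: "poly (monom (lead_coeff p) (degree p)) ?X \<in> P" by (simp add: poly_monom mult.commute)
    have "poly p ?X = poly (trunc p) ?X + poly (monom (lead_coeff p) (degree p)) ?X"
      by (simp add: trunc_def)
    then show ?thesis using P_add[OF _ u] P_diff[OF _ u] by (metis add_diff_cancel_right')
  qed
  define W where "W = {q \<in> pol ?D. poly q ?X \<in> P \<and> ?m q \<noteq> 0}"
  have "p0 \<in> W" using p0 m0 by (auto simp: W_def)
  then obtain q where q: "q \<in> W" "\<And>p. p \<in> W \<Longrightarrow> degree q \<le> degree p"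
    using ex_has_least_nat[of "\<lambda>q. q \<in> W" p0 degree] by blast
  have qD: "q \<in> pol ?D" "poly q ?X \<in> P" "?m q \<noteq> 0" using q(1) by (auto simp: W_def)
  have lcq: "ev h y (lead_coeff q) \<noteq> 0"
    using qD D.trunc_closed trunc_X[OF qD(1)] lc_P[OF qD(1)] E.map_trunc[of q]
    by (intro E.lead_coeff_minimal[OF q]) (auto simp: W_def)
  have q0: "q \<noteq> 0" using qD by auto
  have lcqA: "lead_coeff q \<in> A" "lead_coeff q \<notin> P"
    using lcq lc_P[OF qD(1)] qD(1) DA by (auto simp: pol_def)
  have degq: "degree q \<noteq> 0"
  proof
    assume "degree q = 0"
    then obtain c where c: "q = [:c:]" by (metis degree_eq_zeroE)
    then show False using qD(2) lcqA by simp
  qed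
  then have "degree (?m q) > 0" using E.lead_coeff_map(1)[OF lcq] by simp
  then obtain a where a: "poly (?m q) a = 0" using alg_closed_imp_poly_has_root by blast
  have reduce: "\<exists>k s r. s \<in> pol ?D \<and> r \<in> pol ?D \<and> (r = 0 \<or> degree r < degree g) \<and>
       smult (lead_coeff g ^ k) p = g * s + r \<and>
       ev h y (lead_coeff g) ^ k * poly (?m p) a = poly (?m g) a * poly (?m s) a + poly (?m r) a \<and>
       lead_coeff g ^ k * poly p ?X = poly g ?X * poly s ?X + poly r ?X"
    if pg: "p \<in> pol ?D" "g \<in> pol ?D" "g \<noteq> 0" for p g
  proof -
    obtain k s r where *: "s \<in> pol ?D" "r \<in> pol ?D" "smult (lead_coeff g ^ k) p = g * s + r" 
      "r = 0 \<or> degree r < degree g"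
      using D.pseudo_division[OF pg] by blast
    have "ev h y (lead_coeff g) ^ k * poly (?m p) a = poly (?m g) a * poly (?m s) a + poly (?m r) a"
      by (rule E.map_division[OF *(3)])
    moreover have "lead_coeff g ^ k * poly p ?X = poly g ?X * poly s ?X + poly r ?X"
      using arg_cong[OF *(3), of "\<lambda>u. poly u ?X"] by simp
    ultimately show ?thesis using * by blast
  qed
  have backward: "poly (?m p) a = 0" if p: "p \<in> pol ?D" "poly p ?X \<in> P" for p
  proof -
    obtain k s r where r: "s \<in> pol ?D" "r \<in> pol ?D" "r = 0 \<or> degree r < degree q"
      "ev h y (lead_coeff q) ^ k * poly (?m p) a = poly (?m q) a * poly (?m s) a + poly (?m r) a"
      "lead_coeff q ^ k * poly p ?X = poly q ?X * poly s ?X + poly r ?X"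
      using reduce[OF p(1) qD(1) q0] by blast
    have "lead_coeff q ^ k * poly p ?X \<in> P" using p(2) lcqA by (intro P_mult) auto
    moreover have "poly q ?X * poly s ?X \<in> P" 
      using P_mult[OF qD(2) pX[OF r(1)]] by (simp add: mult.commute)
    ultimately have "poly r ?X \<in> P" using P_diff r(5) by (metis add_diff_cancel_left')
    then have "?m r = 0" using q(2)[of r] r(2,3) by (fastforce simp: W_def)
    then show ?thesis using r(4) a lcq by simp
  qed
  have forward: "poly p ?X \<in> P" if p: "p \<in> pol ?D" "poly (?m p) a = 0" for p
  proof (rule ccontr)
    assume pP: "poly p ?X \<notin> P"
    obtain k s r where r: "s \<in> pol ?D" "r \<in> pol ?D" "r = 0 \<or> degree r < degree q"
      "ev h y (lead_coeff q) ^ k * poly (?m p) a = poly (?m q) a * poly (?m s) a + poly (?m r) a"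
      "lead_coeff q ^ k * poly p ?X = poly q ?X * poly s ?X + poly r ?X"
      using reduce[OF p(1) qD(1) q0] by blast
    have rX: "poly r ?X \<notin> P"
    proof
      assume "poly r ?X \<in> P"
      moreover have "poly q ?X * poly s ?X \<in> P" 
        using P_mult[OF qD(2) pX[OF r(1)]] by (simp add: mult.commute)
      ultimately have "lead_coeff q ^ k * poly p ?X \<in> P" using P_add r(5) by metis
      then show False using P_prime[of "lead_coeff q ^ k" "poly p ?X"] P_power[OF lcqA] lcqA pX[OF p(1)] pP by auto
    qed
    \<comment> \<open>The element \<open>g\<close> of least degree in \<open>M\<close> acts as
      minimal polynomial of \<open>a\<close>. Having smaller degree than \<open>q\<close>, it is no
      relation modulo \<open>P\<close>, yet it divides \<open>q\<close> up to a constant factor and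
      a trivial remainder. Primality then puts the cofactor \<open>t\<close> into \<open>W\<close>,
      against minimality of \<open>q\<close>.\<close>
    define M where "M = {r \<in> pol ?D. ?m r \<noteq> 0 \<and> poly (?m r) a = 0}"
    have "poly (?m r) a = 0" using r(4) p(2) a by simp
    then have rM: "r \<in> M" using r(2) rX m0_P by (auto simp: M_def)
    then obtain g where g: "g \<in> M" "\<And>u. u \<in> M \<Longrightarrow> degree g \<le> degree u"
      using ex_has_least_nat[of "\<lambda>q. q \<in> M" r degree] by blast
    have gD: "g \<in> pol ?D" "?m g \<noteq> 0" "poly (?m g) a = 0" using g(1) by (auto simp: M_def)
    have g0: "g \<noteq> 0" using gD by auto
    have "r \<noteq> 0" using rX P_0 by auto
    then have deg_gq: "degree g < degree q" using r(3) g(2)[OF rM] by simp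
    then have gX: "poly g ?X \<notin> P" using q(2)[of g] gD by (fastforce simp: W_def)
    have lcg: "ev h y (lead_coeff g) \<noteq> 0"
      using gD D.trunc_closed E.map_trunc[of g]
      by (intro E.lead_coeff_minimal[OF g]) (auto simp: M_def)
    have deg_g: "degree g \<noteq> 0"
    proof
      assume "degree g = 0"
      then obtain c where c: "g = [:c:]" by (metis degree_eq_zeroE)
      then show False using gD(3) lcg by (simp add: map_poly_pCons)
    qed
    obtain l t u where t: "t \<in> pol ?D" "u \<in> pol ?D" "u = 0 \<or> degree u < degree g"
      "smult (lead_coeff g ^ l) q = g * t + u"
      "ev h y (lead_coeff g) ^ l * poly (?m q) a = poly (?m g) a * poly (?m t) a + poly (?m u) a"
      "lead_coeff g ^ l * poly q ?X = poly g ?X * poly t ?X + poly u ?X"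
      using reduce[OF qD(1) gD(1) g0] by blast
    have "poly (?m u) a = 0" using t(5) a gD(3) by simp
    then have mu: "?m u = 0" using g(2)[of u] t(2,3) by (fastforce simp: M_def)
    have lcgA: "lead_coeff g \<in> A" using gD(1) DA by (auto simp: pol_def)
    have "lead_coeff g ^ l * poly q ?X \<in> P" using qD(2) lcgA by (intro P_mult) auto
    then have "poly g ?X * poly t ?X \<in> P" 
      using P_diff[OF _ m0_P[OF t(2) mu]] t(6) by (metis add_diff_cancel_right')
    then have tX: "poly t ?X \<in> P" using P_prime[of "poly g ?X" "poly t ?X"] pX gD(1) t(1) gX by blast
    have "smult (ev h y (lead_coeff g) ^ l) (?m q) = ?m g * ?m t"
      using arg_cong[OF t(4), of ?m] mu by (simp add: E.map_smult E.map_add E.map_mult)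
    then have mt: "?m t \<noteq> 0" using qD(3) lcg by auto
    then have "t \<noteq> 0" by auto
    have "g * t = smult (lead_coeff g ^ l) q - u" using t(4) by simp
    then have "degree (g * t) \<le> degree q"
      using t(3) deg_gq by (auto intro!: degree_diff_le)
    then have "degree t < degree q" using deg_g g0 \<open>t \<noteq> 0\<close> by (simp add: degree_mult_eq)
    then show False using q(2)[of t] t(1) tX mt by (fastforce simp: W_def)
  qed
  have "ev h (y(i := a)) f = 0 \<longleftrightarrow> f \<in> P" if f: "f \<in> poly_in (insert i S)" for f
  proof -
    obtain p where p: "p \<in> pol ?D" "f = poly p ?X" using poly_in_insert[OF f] by blast
    interpret E': ring_map "ev h (y(i := a))" by (rule h.ev_ring_map)
    have "ev h (y(i := a)) (poly.coeff p j) = ev h y (poly.coeff p j)" for j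
      using p(1) S(3) by (intro h.ev_cong[of _ S]) (auto simp: pol_def)
    then have "map_poly (ev h (y(i := a))) p = ?m p" by (simp add: poly_eq_iff)
    then have "ev h (y(i := a)) f = poly (?m p) a"
      using E'.poly_map[of p ?X] p(2) by simp
    then show ?thesis using forward[OF p(1)] backward[OF p(1)] p(2) by auto
  qed
  then show ?thesis by blast
qed

text \<open>\<open>J\<close> is a maximal set of coordinates independent modulo \<open>P\<close>;
  these go to independent elements of the ambient field. Each other coordinate is algebraic over
  \<open>J\<close> modulo \<open>P\<close> and is added by \<open>generic_step\<close>.\<close>

theorem generic_point: "\<exists>y. \<forall>f\<in>A. ev h y f = 0 \<longleftrightarrow> f \<in> P"
proof -
  define \<J> where "\<J> = {J. J \<subseteq> {..<n} \<and> P \<inter> poly_in J \<subseteq> {0}}"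
  have "finite \<J>" by (simp add: \<J>_def)
  moreover have "{} \<in> \<J>" using P_const by (auto simp: \<J>_def)
  ultimately obtain J where J: "J \<in> \<J>" "\<And>K. K \<in> \<J> \<Longrightarrow> J \<subseteq> K \<Longrightarrow> J = K"
    using finite_has_maximal[of \<J>] by blast
  have Jn: "J \<subseteq> {..<n}" "P \<inter> poly_in J \<subseteq> {0}" using J(1) by (auto simp: \<J>_def)
  have "\<exists>y. \<forall>f\<in>poly_in (J \<union> T). ev h y f = 0 \<longleftrightarrow> f \<in> P" if "finite T" "T \<subseteq> {..<n} - J" for T
    using that
  proof (induction T rule: finite_induct)
    case empty
    have finJ: "finite J" using Jn finite_subset by blast
    have "ev h (\<lambda>j. e (Var j)) f = 0 \<longleftrightarrow> f \<in> P" if f: "f \<in> poly_in J" for f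
      using ev_generic[OF finJ f] e_inj[of f] f Jn(2) P_0 by (metis IntI empty_iff e.zero insert_iff subsetD)
    then show ?case by auto
  next
    case (insert i T)
    then obtain y where y: "\<And>f. f \<in> poly_in (J \<union> T) \<Longrightarrow> ev h y f = 0 \<longleftrightarrow> f \<in> P" by auto
    have i: "i < n" "i \<notin> J \<union> T" "J \<union> T \<subseteq> {..<n}" using insert Jn by auto
    \<comment> \<open>Maximality of \<open>J\<close> yields the relation for \<open>Var i\<close>:
      its leading coefficient is nonzero and involves only \<open>J\<close>, hence lies outside
      \<open>P\<close>.\<close>
    have "insert i J \<notin> \<J>" using J(2)[of "insert i J"] i by auto
    then obtain f where f: "f \<in> P" "f \<in> poly_in (insert i J)" "f \<noteq> 0"
      using i Jn by (auto simp: \<J>_def)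
    obtain p where p: "p \<in> pol (poly_in J)" "f = poly p (Var i)" using poly_in_insert[OF f(2)] by blast
    then have "p \<noteq> 0" using f(3) by auto
    then have "lead_coeff p \<noteq> 0" by simp
    moreover have "lead_coeff p \<in> poly_in J" using p(1) by (simp add: pol_def)
    ultimately have "lead_coeff p \<notin> P" using Jn(2) by blast
    moreover have "p \<in> pol (poly_in (J \<union> T))" 
      using p(1) poly_in_mono[of J "J \<union> T"] by (auto simp: pol_def)
    ultimately obtain a where "\<forall>f\<in>poly_in (insert i (J \<union> T)). ev h (y(i := a)) f = 0 \<longleftrightarrow> f \<in> P"
      using generic_step[OF i(3,1,2) y, of p "degree p"] p f(1) by blast
    then show ?case by auto
  qed
  from this[of "{..<n} - J"] show ?thesis using Jn(1) by (simp add: Un_absorb1)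
qed

text \<open>The ring \<open>K[y]\<close> is a copy of \<open>A/P\<close>, and the assumption on
  \<open>P\<close> says that it is formally real.\<close>

theorem real_point:
  assumes real: "\<And>f s. f \<in> A \<Longrightarrow> s \<in> sos A \<Longrightarrow> f * f + s \<in> P \<Longrightarrow> f \<in> P"
  obtains R y where "real_closed_subring R" "\<And>f. f \<in> A \<Longrightarrow> ev h y f \<in> R" "\<And>f. f \<in> A \<Longrightarrow> ev h y f = 0 \<longleftrightarrow> f \<in> P"
proof -
  obtain y where y: "\<And>f. f \<in> A \<Longrightarrow> ev h y f = 0 \<longleftrightarrow> f \<in> P" using generic_point by blast
  interpret A: subring_set A by (rule poly_in_subring)
  interpret E: ring_map "ev h y" by (rule h.ev_ring_map)
  let ?S = "ev h y ` A"
  have "subring_set ?S" by (rule E.image_subring[OF poly_in_subring])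
  moreover have "formally_real ?S"
    unfolding formally_real_def
  proof (intro ballI impI)
    fix x s assume xs: "x \<in> ?S" "s \<in> sos ?S" "x * x + s = 0"
    obtain t where t: "t \<in> sos A" "s = ev h y t" using E.sos_image[OF xs(2)] by blast
    obtain f where f: "f \<in> A" "x = ev h y f" using xs(1) by blast
    have "ev h y (f * f + t) = 0" using xs(3) f t by simp
    moreover have "f * f + t \<in> A" using f t A.sos_closed by simp
    ultimately have "f * f + t \<in> P" using y by blast
    then have "f \<in> P" by (rule real[OF f(1) t(1)])
    then show "x = 0" using y f by simp
  qed
  ultimately obtain R where "?S \<subseteq> R" "real_closed_subring R" using real_closed_subring_exists by blast
  then show thesis using y by (intro that[of R y]) auto
qed

end

section \<open>Real rings in the sense of \<open>HOL-Algebra\<close>\<close>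

lemma ring_of_type_algebra_simps [simp]:
  "carrier (ring_of_type_algebra :: 'a::comm_ring_1 ring) = UNIV"
  "\<one>\<^bsub>ring_of_type_algebra :: 'a ring\<^esub> = 1" "\<zero>\<^bsub>ring_of_type_algebra :: 'a ring\<^esub> = 0"
  "x \<otimes>\<^bsub>ring_of_type_algebra :: 'a ring\<^esub> y = x * y" "x \<oplus>\<^bsub>ring_of_type_algebra :: 'a ring\<^esub> y = x + y"
  by (simp_all add: ring_of_type_algebra_def)

lemma mpoly_ring_simps [simp]:
  "carrier (mpoly_ring n) = poly_in {..<n}" "\<one>\<^bsub>mpoly_ring n\<^esub> = 1" "\<zero>\<^bsub>mpoly_ring n\<^esub> = 0"
  "x \<otimes>\<^bsub>mpoly_ring n\<^esub> y = x * y" "x \<oplus>\<^bsub>mpoly_ring n\<^esub> y = x + y"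
  by (simp_all add: mpoly_ring_def poly_in_def ring_of_type_algebra_def)

text \<open>Bridges two notions of sums of squares: \<open>real_ring\<close> uses families indexed
  by \<open>{..<m}\<close>, \<open>sos\<close> iterated addition, and a new square is entered at
  index \<open>m\<close>. The map \<open>c\<close> respects the operations on \<open>D\<close> only,
  which fits a polynomial ring inside a larger type.\<close>

lemma real_ring_sos:
  assumes B: "real_ring B" and D: "subring_set D"
    and c: "\<And>x. x \<in> D \<Longrightarrow> c x \<in> carrier B" "c 0 = \<zero>\<^bsub>B\<^esub>"
      "\<And>x y. x \<in> D \<Longrightarrow> y \<in> D \<Longrightarrow> c (x + y) = c x \<oplus>\<^bsub>B\<^esub> c y"
      "\<And>x y. x \<in> D \<Longrightarrow> y \<in> D \<Longrightarrow> c (x * y) = c x \<otimes>\<^bsub>B\<^esub> c y"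
    and x: "x \<in> D" "s \<in> sos D" "c (x * x + s) = \<zero>\<^bsub>B\<^esub>"
  shows "c x = \<zero>\<^bsub>B\<^esub>"
proof -
  interpret D: subring_set D by (rule D)
  interpret B: cring B using B by (simp add: real_ring_def)
  have add_square: "c (x * x + s) = (\<Oplus>\<^bsub>B\<^esub>i\<in>{..<Suc m}. (a(m := c x)) i \<otimes>\<^bsub>B\<^esub> (a(m := c x)) i)"
    if "x \<in> D" "s \<in> D" "a \<in> {..<m} \<rightarrow> carrier B" "c s = (\<Oplus>\<^bsub>B\<^esub>i\<in>{..<m}. a i \<otimes>\<^bsub>B\<^esub> a i)" 
    for x s a and m :: nat
  proof -
    have a: "\<And>i. i < m \<Longrightarrow> a i \<in> carrier B" using that(3) by auto
    have "(\<Oplus>\<^bsub>B\<^esub>i\<in>{..<m}. (a(m := c x)) i \<otimes>\<^bsub>B\<^esub> (a(m := c x)) i) = c s"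
      unfolding that(4) using a by (intro B.finsum_cong') auto
    moreover have "(\<Oplus>\<^bsub>B\<^esub>i\<in>insert m {..<m}. (a(m := c x)) i \<otimes>\<^bsub>B\<^esub> (a(m := c x)) i)
       = c x \<otimes>\<^bsub>B\<^esub> c x \<oplus>\<^bsub>B\<^esub> (\<Oplus>\<^bsub>B\<^esub>i\<in>{..<m}. (a(m := c x)) i \<otimes>\<^bsub>B\<^esub> (a(m := c x)) i)"
      using a c(1)[OF that(1)] by (subst B.finsum_insert) auto
    ultimately show ?thesis using that(1,2) c by (simp add: lessThan_Suc)
  qed
  have "\<exists>m::nat. \<exists>a\<in>{..<m} \<rightarrow> carrier B. c s = (\<Oplus>\<^bsub>B\<^esub>i\<in>{..<m}. a i \<otimes>\<^bsub>B\<^esub> a i)"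
    using x(2)
  proof (induction rule: sos.induct)
    case zero
    then show ?case using c(2) by (intro exI[of _ 0]) auto
  next
    case (add x s)
    then obtain m :: nat and a where a: "a \<in> {..<m} \<rightarrow> carrier B" "c s = (\<Oplus>\<^bsub>B\<^esub>i\<in>{..<m}. a i \<otimes>\<^bsub>B\<^esub> a i)" by blast
    have "a(m := c x) \<in> {..<Suc m} \<rightarrow> carrier B" using a(1) c(1)[OF add(1)] by (auto simp: less_Suc_eq)
    then show ?case using add_square[OF add(1) D.sos_closed[OF add(2)] a] by blast
  qed
  then obtain m :: nat and a where a: "a \<in> {..<m} \<rightarrow> carrier B" "c s = (\<Oplus>\<^bsub>B\<^esub>i\<in>{..<m}. a i \<otimes>\<^bsub>B\<^esub> a i)" by blast
  have "a(m := c x) \<in> {..<Suc m} \<rightarrow> carrier B" using a(1) c(1)[OF x(1)] by (auto simp: less_Suc_eq)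
  moreover have "(\<Oplus>\<^bsub>B\<^esub>i\<in>{..<Suc m}. (a(m := c x)) i \<otimes>\<^bsub>B\<^esub> (a(m := c x)) i) = \<zero>\<^bsub>B\<^esub>"
    using add_square[OF x(1) D.sos_closed[OF x(2)] a] x(3) by simp
  ultimately have "(a(m := c x)) m = \<zero>\<^bsub>B\<^esub>" using B unfolding real_ring_def by blast
  then show ?thesis by simp
qed

lemma formally_real_UNIV:
  assumes "real_ring (ring_of_type_algebra :: 'k::Fields.field ring)"
  shows "formally_real (UNIV :: 'k set)"
  unfolding formally_real_def
proof (intro ballI impI)
  fix x s :: 'k assume xs: "s \<in> sos UNIV" "x * x + s = 0"
  have "subring_set (UNIV :: 'k set)" by unfold_locales auto
  from real_ring_sos[OF assms this, of "\<lambda>x. x" x s] xs show "x = 0" by simp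
qed

lemma formally_real_sum_eq_0:
  assumes R: "formally_real R" and x: "\<And>i. i \<in> I \<Longrightarrow> x i \<in> R" "finite I" 
    and sum: "(\<Sum>i\<in>I. x i * x i) = 0" and i: "i \<in> I"
  shows "x i = 0"
proof -
  have "finite J \<Longrightarrow> J \<subseteq> I \<Longrightarrow> (\<Sum>i\<in>J. x i * x i) \<in> sos R" for J
    by (induction J rule: finite_induct) (auto intro: sos.intros x)
  then have "(\<Sum>i\<in>I - {i}. x i * x i) \<in> sos R" using x(2) by blast
  then show ?thesis using formally_realD[OF R x(1)[OF i]] sum sum.remove[OF x(2) i] by metis
qed

lemma real_ringI:
  assumes A: "cring A" and S: "formally_real S"
    and g: "\<And>x. x \<in> carrier A \<Longrightarrow> g x \<in> S" "g \<zero>\<^bsub>A\<^esub> = 0"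
      "\<And>x y. x \<in> carrier A \<Longrightarrow> y \<in> carrier A \<Longrightarrow> g (x \<oplus>\<^bsub>A\<^esub> y) = g x + g y"
      "\<And>x y. x \<in> carrier A \<Longrightarrow> y \<in> carrier A \<Longrightarrow> g (x \<otimes>\<^bsub>A\<^esub> y) = g x * g y"
      "\<And>x. x \<in> carrier A \<Longrightarrow> g x = 0 \<Longrightarrow> x = \<zero>\<^bsub>A\<^esub>"
  shows "real_ring A"
proof -
  interpret A: cring A by (rule A)
  have fin: "g (\<Oplus>\<^bsub>A\<^esub>i\<in>{..<m}. a i \<otimes>\<^bsub>A\<^esub> a i) = (\<Sum>i<m. g (a i) * g (a i))"
    if "a \<in> {..<m} \<rightarrow> carrier A" for a and m :: nat
    using that
  proof (induction m)
    case (Suc m)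
    have a: "a m \<in> carrier A" "\<And>i. i < m \<Longrightarrow> a i \<in> carrier A" using Suc.prems by auto
    have "(\<Oplus>\<^bsub>A\<^esub>i\<in>insert m {..<m}. a i \<otimes>\<^bsub>A\<^esub> a i) = a m \<otimes>\<^bsub>A\<^esub> a m \<oplus>\<^bsub>A\<^esub> (\<Oplus>\<^bsub>A\<^esub>i\<in>{..<m}. a i \<otimes>\<^bsub>A\<^esub> a i)"
      using a by (subst A.finsum_insert) auto
    moreover have "(\<Oplus>\<^bsub>A\<^esub>i\<in>{..<m}. a i \<otimes>\<^bsub>A\<^esub> a i) \<in> carrier A" using a by (intro A.finsum_closed) auto
    moreover have "g (\<Oplus>\<^bsub>A\<^esub>i\<in>{..<m}. a i \<otimes>\<^bsub>A\<^esub> a i) = (\<Sum>i<m. g (a i) * g (a i))" 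
      by (rule Suc.IH) (use a in auto)
    ultimately show ?case using a g(3,4) by (simp add: lessThan_Suc)
  qed (simp add: g(2))
  show ?thesis
    unfolding real_ring_def
  proof (intro conjI allI ballI impI)
    fix m :: nat and a i
    assume a: "a \<in> {..<m} \<rightarrow> carrier A" "(\<Oplus>\<^bsub>A\<^esub>i\<in>{..<m}. a i \<otimes>\<^bsub>A\<^esub> a i) = \<zero>\<^bsub>A\<^esub>" and i: "i < m"
    have "(\<Sum>i<m. g (a i) * g (a i)) = 0" using fin[OF a(1)] a(2) g(2) by simp
    then have "g (a i) = 0"
      using formally_real_sum_eq_0[OF S, of "{..<m}" "\<lambda>i. g (a i)" i] a(1) g(1) i by auto
    then show "a i = \<zero>\<^bsub>A\<^esub>" using g(5) a(1) i by auto
  qed (rule A)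
qed


section \<open>Real closed fields inside an algebraically closed field\<close>

text \<open>Polynomials of HOL-Algebra list the leading coefficient first, those of type
  \<open>poly\<close> the constant one.\<close>

lemma eval_rev_coeffs:
  fixes a :: "'l::Fields.field"
  shows "ring.eval ring_of_type_algebra (rev cs) a = poly (Poly cs) a"
proof -
  interpret R: field "ring_of_type_algebra :: 'l ring" by (rule field_from_type_algebra)
  show ?thesis
    by (induction cs) (simp_all add: R.eval_append_aux mult.commute add.commute)
qed

context field_map
begin

lemma subfield_range: "subfield (range h) (ring_of_type_algebra :: 'l ring)"
proof -
  interpret R: field "ring_of_type_algebra :: 'l ring" by (rule field_from_type_algebra)
  have minus: "\<ominus>\<^bsub>ring_of_type_algebra\<^esub> x = - x" for x :: 'l
    by (rule R.minus_equality) auto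
  have inv: "inv\<^bsub>ring_of_type_algebra\<^esub> x = inverse x" if "x \<noteq> 0" for x :: 'l
    by (rule R.comm_inv_char) (use that in auto)
  show ?thesis
  proof (rule R.subfieldI'[OF R.subringI])
    show "inv\<^bsub>ring_of_type_algebra\<^esub> k \<in> range h" if "k \<in> range h - {\<zero>\<^bsub>ring_of_type_algebra\<^esub>}" for k
      using that inv by (auto simp flip: h_inverse)
    show "\<one>\<^bsub>ring_of_type_algebra\<^esub> \<in> range h" using one by (metis rangeI ring_of_type_algebra_simps(2))
  qed (auto simp: minus simp flip: add mult uminus)
qed

lemma algebraic_range:
  assumes "p \<in> pol (range h)" "p \<noteq> 0" "poly p a = 0"
  shows "(ring.algebraic (ring_of_type_algebra :: 'l ring) over (range h)) a"
proof -
  interpret R: field "ring_of_type_algebra :: 'l ring" by (rule field_from_type_algebra)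
  have "set (coeffs p) \<subseteq> range h"
    using assms(1) by (auto simp: pol_def coeffs_def)
  moreover have "hd (rev (coeffs p)) \<noteq> 0"
    using assms(2) by (simp add: hd_rev last_coeffs_eq_coeff_degree)
  ultimately have "rev (coeffs p) \<in> carrier (univ_poly (ring_of_type_algebra :: 'l ring) (range h))"
    by (auto simp: polynomial_def simp flip: univ_poly_carrier)
  moreover have "R.eval (rev (coeffs p)) a = \<zero>\<^bsub>ring_of_type_algebra\<^esub>"
    using assms(3) by (simp add: eval_rev_coeffs)
  ultimately show ?thesis using assms(2) by (intro R.algebraicI) auto
qed

lemma range_subring: "subring_set (range h)"
  by (rule image_subring) (unfold_locales, auto)

lemma simple_extension_range:
  "ring.simple_extension (ring_of_type_algebra :: 'l ring) (range h) a = adjoin (range h) a"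
proof -
  interpret R: field "ring_of_type_algebra :: 'l ring" by (rule field_from_type_algebra)
  interpret K: subring_set "range h" by (rule range_subring)
  interpret S: subring_set "adjoin (range h) a" by (rule K.adjoin_subring)
  show ?thesis
  proof (intro equalityI subsetI)
    show "x \<in> adjoin (range h) a" if "x \<in> R.simple_extension (range h) a" for x
      using that
    proof (induction rule: R.simple_extension.induct)
      case (lin k1 k2)
      then show ?case using K.subset_adjoin[of a] K.adjoin_mem[of a]
        by (auto intro!: S.add_closed S.mult_closed)
    qed simp
    show "x \<in> R.simple_extension (range h) a" if "x \<in> adjoin (range h) a" for x
    proof -
      obtain p where p: "p \<in> pol (range h)" "x = poly p a" using \<open>x \<in> adjoin (range h) a\<close> by (auto simp: adjoin_def)
      have "poly p a \<in> R.simple_extension (range h) a" using p(1)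
      proof (induction p)
        case 0
        then show ?case using R.simple_extension.zero by simp
      next
        case (pCons c p)
        then have "poly p a \<otimes>\<^bsub>ring_of_type_algebra\<^esub> a \<oplus>\<^bsub>ring_of_type_algebra\<^esub> c \<in> R.simple_extension (range h) a"
          by (intro R.simple_extension.lin) auto
        then show ?case by (simp add: ac_simps)
      qed
      then show ?thesis using p by simp
    qed
  qed
qed

text \<open>
  An element \<open>x\<close> of \<open>K[a]\<close> is encoded in \<^typ>\<open>'k list set\<close> by the set of all (coefficient lists of)
  polynomials over \<open>K\<close> whose value at \<open>a\<close> is \<open>x\<close>.
\<close>
lemma real_extension_trivial:
  assumes K: "real_closed_field (ring_of_type_algebra :: 'k ring)"
    and p: "p \<in> pol (range h)" "p \<noteq> 0" "poly p a = 0" and real: "formally_real (adjoin (range h) a)"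
  shows "a \<in> range h"
proof -
  let ?R = "ring_of_type_algebra :: 'l ring"
  let ?K = "range h"
  let ?S = "adjoin (range h) a"
  interpret R: field ?R by (rule field_from_type_algebra)
  interpret K: subring_set ?K by (rule range_subring)
  have alg: "(R.algebraic over ?K) a" by (rule algebraic_range[OF p])
  have S_field: "subfield ?S ?R"
    using R.simple_extension_is_subfield[OF subfield_range, of a] alg simple_extension_range by simp
  have alg_S: "(R.algebraic over ?K) x" if "x \<in> ?S" for x
    using R.simple_extesion_mem_imp_algebraic[OF subfield_range _ alg] that simple_extension_range by simp
  let ?RS = "?R\<lparr>carrier := ?S\<rparr>"
  interpret S: field ?RS using R.subfield_iff(2)[OF S_field] .
  define \<iota> :: "'l \<Rightarrow> 'k list set" where "\<iota> x = {coeffs p |p. poly (map_poly h p) a = x}" for x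
  have \<iota>_ne: "\<exists>p. poly (map_poly h p) a = x" if x: "x \<in> ?S" for x
  proof -
    obtain q where q: "q \<in> pol ?K" "x = poly q a" using x by (auto simp: adjoin_def)
    have "\<exists>p. q = map_poly h p" using q(1)
    proof (induction q)
      case (pCons c q)
      then obtain d p where "c = h d" "q = map_poly h p" by auto
      then show ?case by (intro exI[of _ "pCons d p"]) (simp add: map_poly_pCons)
    qed (auto intro: exI[of _ 0])
    then show ?thesis using q by auto
  qed
  have inj: "inj_on \<iota> ?S"
  proof (rule inj_onI)
    fix x y assume xy: "x \<in> ?S" "y \<in> ?S" "\<iota> x = \<iota> y"
    obtain p where p: "poly (map_poly h p) a = x" using \<iota>_ne[OF xy(1)] by blast
    then have "coeffs p \<in> \<iota> y" using xy(3) unfolding \<iota>_def by blast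
    then obtain q where "coeffs p = coeffs q" "poly (map_poly h q) a = y" unfolding \<iota>_def by blast
    then show "x = y" using p by (simp add: coeffs_eq_iff[symmetric])
  qed
  \<comment> \<open>The structure of \<open>K[a]\<close> is transported along the injection
    \<open>\<iota>\<close>, because \<open>real_closed_field\<close> speaks of extensions whose
    elements have that type.\<close>
  define L where "L = image_ring \<iota> ?RS"
  have inj': "inj_on \<iota> (carrier ?RS)" using inj by simp
  interpret L: field L unfolding L_def by (rule S.inj_imp_image_ring_is_field[OF inj'])
  have hom: "\<iota> \<in> ring_hom ?RS L"
    unfolding L_def using inj_imp_image_ring_iso[OF inj'] by (simp add: ring_iso_def)
  interpret H: ring_hom_ring ?RS L \<iota>
    by (rule ring_hom_ringI2[OF S.ring_axioms L.ring_axioms hom])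
  have carrier_L: "carrier L = \<iota> ` ?S" by (simp add: L_def image_ring_carrier)
  have KS: "?K \<subseteq> ?S" by (rule K.subset_adjoin)
  have "field L \<and> (\<iota> \<circ> h) \<in> ring_hom (ring_of_type_algebra :: 'k ring) L \<and>
    (\<forall>x\<in>carrier L. (ring.algebraic L over ((\<iota> \<circ> h) ` carrier (ring_of_type_algebra :: 'k ring))) x) \<and> real_ring L"
  proof (intro conjI ballI)
    show "field L" by (rule L.field_axioms)
    show "(\<iota> \<circ> h) \<in> ring_hom (ring_of_type_algebra :: 'k ring) L"
    proof (rule ring_hom_memI)
      fix x y :: 'k
      have xy: "h x \<in> carrier ?RS" "h y \<in> carrier ?RS" using KS by auto
      show "(\<iota> \<circ> h) x \<in> carrier L" using H.hom_closed[OF xy(1)] by simp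
      show "(\<iota> \<circ> h) (x \<otimes>\<^bsub>ring_of_type_algebra\<^esub> y) = (\<iota> \<circ> h) x \<otimes>\<^bsub>L\<^esub> (\<iota> \<circ> h) y"
        using H.hom_mult[OF xy] by simp
      show "(\<iota> \<circ> h) (x \<oplus>\<^bsub>ring_of_type_algebra\<^esub> y) = (\<iota> \<circ> h) x \<oplus>\<^bsub>L\<^esub> (\<iota> \<circ> h) y"
        using H.hom_add[OF xy] by simp
    next
      show "(\<iota> \<circ> h) \<one>\<^bsub>ring_of_type_algebra\<^esub> = \<one>\<^bsub>L\<^esub>" using H.hom_one by simp
    qed
    show "real_ring L"
    proof (rule real_ringI[OF L.cring_axioms real])
      let ?g = "inv_into ?S \<iota>"
      have g: "?g (\<iota> x) = x" if "x \<in> ?S" for x using inj that by simp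
      have closed: "x + y \<in> ?S" "x * y \<in> ?S" "0 \<in> ?S" if "x \<in> ?S" "y \<in> ?S" for x y
        using S.add.m_closed[of x y] S.m_closed[of x y] S.zero_closed that by auto
      show "?g x \<in> ?S" if "x \<in> carrier L" for x using that g by (auto simp: carrier_L)
      show "?g \<zero>\<^bsub>L\<^esub> = 0" using H.hom_zero g[of 0] S.zero_closed by simp
      fix x assume "x \<in> carrier L"
      then obtain u where u: "u \<in> ?S" "x = \<iota> u" by (auto simp: carrier_L)
      show "x = \<zero>\<^bsub>L\<^esub>" if "?g x = 0" using that u g H.hom_zero by simp
      fix y assume "y \<in> carrier L"
      then obtain v where v: "v \<in> ?S" "y = \<iota> v" by (auto simp: carrier_L)
      have "x \<oplus>\<^bsub>L\<^esub> y = \<iota> (u + v)" "x \<otimes>\<^bsub>L\<^esub> y = \<iota> (u * v)"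
        using H.hom_add[of u v] H.hom_mult[of u v] u v by simp_all
      then show "?g (x \<oplus>\<^bsub>L\<^esub> y) = ?g x + ?g y" "?g (x \<otimes>\<^bsub>L\<^esub> y) = ?g x * ?g y"
        using g[OF u(1)] g[OF v(1)] g[OF closed(1)[OF u(1) v(1)]] g[OF closed(2)[OF u(1) v(1)]] u(2) v(2)
        by metis+
    qed
    fix x assume "x \<in> carrier L"
    then obtain u where u: "u \<in> ?S" "x = \<iota> u" by (auto simp: carrier_L)
    \<comment> \<open>An algebraic relation of \<open>u\<close> is carried over coefficientwise;
      injectivity of \<open>\<iota>\<close> keeps its leading coefficient nonzero.\<close>
    obtain q where q: "q \<in> carrier (univ_poly ?R ?K)" "q \<noteq> []" "R.eval q u = \<zero>\<^bsub>?R\<^esub>"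
      using R.algebraicE[OF subfieldE(1)[OF subfield_range] _ alg_S[OF u(1)]] by auto
    have set_q: "set q \<subseteq> ?K" "hd q \<noteq> 0" 
      using q(1,2) by (auto simp: polynomial_def simp flip: univ_poly_carrier)
    have eval_S: "S.eval q u = R.eval q u" 
      using R.eval_consistent[OF subfieldE(1)[OF S_field]] by simp
    have "L.eval (map \<iota> q) x = \<iota> (S.eval q u)"
      using H.eval_hom'[of u q] u set_q KS by auto
    then have eval0: "L.eval (map \<iota> q) x = \<zero>\<^bsub>L\<^esub>" using eval_S q(3) H.hom_zero by simp
    have "\<iota> (hd q) \<noteq> \<zero>\<^bsub>L\<^esub>"
    proof
      assume "\<iota> (hd q) = \<zero>\<^bsub>L\<^esub>"
      then have "\<iota> (hd q) = \<iota> 0" using H.hom_zero by simp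
      moreover have "hd q \<in> ?S" using q(2) set_q(1) KS by (cases q) auto
      moreover have "0 \<in> ?S" using S.zero_closed by simp
      ultimately show False using inj set_q(2) by (auto dest: inj_onD)
    qed
    then have "map \<iota> q \<in> carrier (univ_poly L (\<iota> ` ?K))"
      using q(2) set_q by (auto simp: polynomial_def hd_map simp flip: univ_poly_carrier)
    then have "(L.algebraic over (\<iota> ` ?K)) x"
      using q(2) eval0 by (intro L.algebraicI) auto
    then show "(L.algebraic over ((\<iota> \<circ> h) ` carrier (ring_of_type_algebra :: 'k ring))) x"
      by (simp add: image_comp)
  qed
  then have "(\<iota> \<circ> h) ` carrier (ring_of_type_algebra :: 'k ring) = carrier L"
    using K unfolding real_closed_field_def by blast
  then have "\<iota> a \<in> \<iota> ` ?K" using carrier_L K.adjoin_mem by (auto simp: image_comp)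
  then obtain b where b: "b \<in> ?K" "\<iota> a = \<iota> b" by blast
  have "a = b" by (rule inj_onD[OF inj b(2)]) (use b KS K.adjoin_mem in auto)
  then show ?thesis using b by simp
qed

end

text \<open>Turns the condition on abstract algebraic extensions of \<open>K\<close> into one on
  subrings of the ambient field, so that \<open>K\<close> and the Zorn-maximal ring are treated
  alike.\<close>

theorem real_closed_range:
  fixes h :: "'k::Fields.field \<Rightarrow> 'l::alg_closed_field"
  assumes h: "field_map h" and K: "real_closed_field (ring_of_type_algebra :: 'k ring)"
  shows "real_closed_subring (range h)"
proof -
  interpret h: field_map h by (rule h)
  interpret K: subring_set "range h" by (rule h.range_subring)
  have real: "real_ring (ring_of_type_algebra :: 'k ring)" using K by (simp add: real_closed_field_def)
  have real': "formally_real (UNIV :: 'k set)" by (rule formally_real_UNIV[OF real])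
  have "formally_real (range h)"
    unfolding formally_real_def
  proof (intro ballI impI)
    fix x s assume xs: "x \<in> range h" "s \<in> sos (range h)" "x * x + s = 0"
    then obtain t c where "t \<in> sos UNIV" "s = h t" "x = h c" using h.sos_image[OF xs(2)] by auto
    moreover from this xs(3) have "h (c * c + t) = 0" by simp
    ultimately show "x = 0" using formally_realD[OF real', of c t] h.h_eq_0_iff h.zero by blast
  qed
  then show ?thesis
    using h.real_extension_trivial[OF K] by unfold_locales auto
qed


section \<open>The real Nullstellensatz\<close>

lemma mpoly_eval_eq_ev: "mpoly_eval f x = ev (\<lambda>c. c) x f"
  by (simp add: mpoly_eval_def ev_def mon_def)

lemma field_map_id: "field_map (\<lambda>c::'k::Fields.field. c)"
  by unfold_locales auto

lemmas mpoly_eval_add = field_map.ev_add[OF field_map_id, folded mpoly_eval_eq_ev]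
lemmas mpoly_eval_mult = field_map.ev_mult[OF field_map_id, folded mpoly_eval_eq_ev]
lemmas mpoly_eval_1 = field_map.ev_1[OF field_map_id, folded mpoly_eval_eq_ev]

lemma (in field_map) ev_map: "ev h (\<lambda>i. h (x i)) f = h (mpoly_eval f x)"
  unfolding mpoly_eval_eq_ev ev_def mon_def by (simp add: sum prod)


lemma mpoly_embedding_fract: "mpoly_embedding (\<lambda>f::'k::Fields.field mpolynomial. to_ac (Fract f 1))"
proof unfold_locales
  show "to_ac (Fract (1::'k mpolynomial) 1) = 1" by (simp flip: One_fract_def)
  show "to_ac (Fract (f + g) 1) = to_ac (Fract f 1) + to_ac (Fract g 1)" for f g :: "'k mpolynomial"
    by (simp flip: to_ac_add)
  show "to_ac (Fract (f * g) 1) = to_ac (Fract f 1) * to_ac (Fract g 1)" for f g :: "'k mpolynomial"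
    by (simp flip: to_ac_mult)
  show "f = 0" if "to_ac (Fract f 1) = 0" for f :: "'k mpolynomial"
    using that by (simp add: Zero_fract_def eq_fract)
qed

text \<open>Evaluation at \<open>x\<close> embeds the quotient into \<open>K\<close>, which is
  real.\<close>

lemma real_prime_ideal_vanishing:
  fixes x :: "nat \<Rightarrow> 'k::Fields.field"
  assumes K: "real_ring (ring_of_type_algebra :: 'k ring)"
  shows "real_prime_ideal {g \<in> poly_in {..<n}. mpoly_eval g x = 0} (mpoly_ring n)"
proof -
  let ?K = "ring_of_type_algebra :: 'k ring"
  let ?A = "mpoly_ring n :: 'k mpolynomial ring"
  let ?P = "{g \<in> poly_in {..<n}. mpoly_eval g x = 0}"
  interpret K: field ?K by (rule field_from_type_algebra)
  interpret A: cring ?A by (rule mpoly_ring_cring)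
  have eval_hom: "(\<lambda>g. mpoly_eval g x) \<in> ring_hom ?A ?K"
    by (rule ring_hom_memI) (simp_all add: mpoly_eval_add mpoly_eval_mult mpoly_eval_1)
  interpret E: ring_hom_ring ?A ?K "\<lambda>g. mpoly_eval g x"
    by (rule ring_hom_ringI2[OF A.ring_axioms K.ring_axioms eval_hom])
  have ker: "a_kernel ?A ?K (\<lambda>g. mpoly_eval g x) = ?P"
    unfolding a_kernel_def' mpoly_ring_simps ring_of_type_algebra_simps by (rule refl)
  have ideal: "ideal ?P ?A" using E.kernel_is_ideal unfolding ker .
  interpret P: ideal ?P ?A by (rule ideal)
  have "primeideal ?P ?A"
  proof (rule primeidealI[OF ideal A.cring_axioms])
    have "1 \<in> carrier ?A" using A.one_closed by simp
    moreover have "1 \<notin> ?P" by (simp add: mpoly_eval_1)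
    ultimately show "carrier ?A \<noteq> ?P" by blast
    show "a \<in> ?P \<or> b \<in> ?P" if "a \<in> carrier ?A" "b \<in> carrier ?A" "a \<otimes>\<^bsub>?A\<^esub> b \<in> ?P" for a b
      using that by (auto simp: mpoly_eval_mult)
  qed
  moreover have "real_ring (?A Quot ?P)"
  proof (rule real_ringI)
    let ?g = "\<lambda>U. the_elem ((\<lambda>g. mpoly_eval g x) ` U)"
    have hom: "?g \<in> ring_hom (?A Quot ?P) ?K" using E.the_elem_hom unfolding ker .
    show "cring (?A Quot ?P)" by (rule P.quotient_is_cring[OF A.cring_axioms])
    interpret Q: ring "?A Quot ?P" by (rule P.quotient_is_ring)
    interpret G: ring_hom_ring "?A Quot ?P" ?K ?g
      by (rule ring_hom_ringI2[OF Q.ring_axioms K.ring_axioms hom])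
    show "formally_real (UNIV :: 'k set)" by (rule formally_real_UNIV[OF K])
    show g0: "?g \<zero>\<^bsub>?A Quot ?P\<^esub> = 0" using G.hom_zero by simp
    fix U assume U: "U \<in> carrier (?A Quot ?P)"
    show "U = \<zero>\<^bsub>?A Quot ?P\<^esub>" if "?g U = 0"
      using E.the_elem_inj[of U "\<zero>\<^bsub>?A Quot ?P\<^esub>"] U that g0 Q.zero_closed unfolding ker by simp
    fix V assume V: "V \<in> carrier (?A Quot ?P)"
    show "?g (U \<oplus>\<^bsub>?A Quot ?P\<^esub> V) = ?g U + ?g V" using G.hom_add[OF U V] by simp
    show "?g (U \<otimes>\<^bsub>?A Quot ?P\<^esub> V) = ?g U * ?g V" using G.hom_mult[OF U V] by simp
  qed simp
  ultimately show ?thesis by (simp add: real_prime_ideal_def)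
qed

lemma mpoly_prime_if_primeideal:
  assumes "primeideal P (mpoly_ring n)" shows "mpoly_prime n P"
proof -
  interpret P: primeideal P "mpoly_ring n" by (rule assms)
  show ?thesis
  proof
    show "P \<subseteq> poly_in {..<n}" using P.a_subset by simp
    show "0 \<in> P" using additive_subgroup.zero_closed[OF P.additive_subgroup_axioms] by simp
    show "f + g \<in> P" if "f \<in> P" "g \<in> P" for f g using additive_subgroup.a_closed[OF P.additive_subgroup_axioms that] by simp
    show "g * f \<in> P" if "f \<in> P" "g \<in> poly_in {..<n}" for f g using P.I_l_closed[of f g] that by simp
    show "f \<in> P \<or> g \<in> P" if "f \<in> poly_in {..<n}" "g \<in> poly_in {..<n}" "f * g \<in> P" for f g
      using P.I_prime[of f g] that by simp
    show "1 \<notin> P" using P.one_imp_carrier P.I_notcarr by auto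
  qed
qed

text \<open>Reality of the quotient, read in the polynomial ring itself: the form that
  \<open>real_point\<close> takes as assumption.\<close>

lemma real_prime_sos:
  fixes f :: "'a::Fields.field mpolynomial"
  assumes P: "real_prime_ideal P (mpoly_ring n)" 
    and f: "f \<in> poly_in {..<n}" "s \<in> sos (poly_in {..<n})" "f * f + s \<in> P"
  shows "f \<in> P"
proof -
  let ?A = "mpoly_ring n :: 'a mpolynomial ring"
  interpret A: cring ?A by (rule mpoly_ring_cring)
  interpret P: primeideal P ?A using P by (simp add: real_prime_ideal_def)
  have zero: "P +>\<^bsub>?A\<^esub> g = \<zero>\<^bsub>?A Quot P\<^esub> \<longleftrightarrow> g \<in> P" if "g \<in> poly_in {..<n}" for g
    using P.rcos_const_imp_mem[of g] P.a_rcos_const[of g] that by (auto simp: FactRing_def)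
  interpret c: ring_hom_ring ?A "?A Quot P" "(+>\<^bsub>?A\<^esub>) P" by (rule P.rcos_ring_hom_ring)
  interpret D: subring_set "poly_in {..<n} :: 'a mpolynomial set" by (rule poly_in_subring)
  have "P +>\<^bsub>?A\<^esub> f = \<zero>\<^bsub>?A Quot P\<^esub>"
  proof (rule real_ring_sos[OF _ poly_in_subring _ _ _ _ f(1,2)])
    show "real_ring (?A Quot P)" using P by (simp add: real_prime_ideal_def)
    show "P +>\<^bsub>?A\<^esub> g \<in> carrier (?A Quot P)" if "g \<in> poly_in {..<n}" for g 
      using c.hom_closed[of g] that by simp
    show "P +>\<^bsub>?A\<^esub> 0 = \<zero>\<^bsub>?A Quot P\<^esub>" using c.hom_zero by simp
    show "P +>\<^bsub>?A\<^esub> (g + k) = (P +>\<^bsub>?A\<^esub> g) \<oplus>\<^bsub>?A Quot P\<^esub> (P +>\<^bsub>?A\<^esub> k)"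
      if "g \<in> poly_in {..<n}" "k \<in> poly_in {..<n}" for g k using c.hom_add[of g k] that by simp
    show "P +>\<^bsub>?A\<^esub> (g * k) = (P +>\<^bsub>?A\<^esub> g) \<otimes>\<^bsub>?A Quot P\<^esub> (P +>\<^bsub>?A\<^esub> k)"
      if "g \<in> poly_in {..<n}" "k \<in> poly_in {..<n}" for g k using c.hom_mult[of g k] that by simp
    show "P +>\<^bsub>?A\<^esub> (f * f + s) = \<zero>\<^bsub>?A Quot P\<^esub>"
      using zero f D.sos_closed by simp
  qed
  then show ?thesis using zero f(1) by blast
qed

lemma vanishing_in_real_prime:
  fixes f :: "'k::Fields.field mpolynomial"
  assumes K: "real_closed_field (ring_of_type_algebra :: 'k ring)"
    and P: "real_prime_ideal P (mpoly_ring n)" "\<aa> \<subseteq> P"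
    and f: "f \<in> vanishing_ideal n (zero_locus n \<aa>)"
  shows "f \<in> P"
proof -
  let ?e = "\<lambda>f::'k mpolynomial. to_ac (Fract f 1)"
  have "primeideal P (mpoly_ring n)" using P(1) by (simp add: real_prime_ideal_def)
  then interpret G: mpoly_generic ?e n P
    by (intro mpoly_generic.intro mpoly_embedding_fract mpoly_prime_if_primeideal)
  obtain R y where R: "real_closed_subring R" and yR: "\<And>g. g \<in> G.A \<Longrightarrow> ev G.h y g \<in> R" 
    and yP: "\<And>g. g \<in> G.A \<Longrightarrow> ev G.h y g = 0 \<longleftrightarrow> g \<in> P"
    using G.real_point real_prime_sos[OF P(1)] by metis
  interpret R1: real_closed_subring "range G.h" by (rule real_closed_range[OF G.h.field_map_axioms K])
  interpret R2: real_closed_subring R by (rule R)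
  have fA: "f \<in> G.A" using f by (simp add: vanishing_ideal_def)
  have "range G.h \<subseteq> R" using yR[of "Const c" for c] by auto
  moreover have "y i \<in> R" if "i \<in> {..<n}" for i using yR[of "Var i"] that by (simp add: Var_in)
  \<comment> \<open>Only the sign of \<open>f\<close> is compared; that all of \<open>P\<close>
    vanishes at \<open>x\<close> comes from the relations carried along in
    \<open>transfer\<close>.\<close>
  ultimately obtain x where x: "\<forall>i\<in>{..<n}. x i \<in> range G.h"
     "sg (range G.h) (ev G.h x f) = sg R (ev G.h y f)"
     "\<And>g. g \<in> G.A \<Longrightarrow> ev G.h y g = 0 \<Longrightarrow> ev G.h x g = 0"
    using G.h.transfer[OF R1.rcf_axioms R2.rcf_axioms _ order_refl, of "{..<n}" "{f}" y] fA by auto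
  \<comment> \<open>The coordinates lie in the image of \<open>K\<close> and are pulled back.
    Outside \<open>{..<n}\<close> the restriction supplies the default value that
    \<open>affine_space\<close> requires.\<close>
  define x0 where "x0 = (\<lambda>i\<in>{..<n}. inv_into UNIV G.h (x i))"
  have "G.h (x0 i) = x i" if "i \<in> {..<n}" for i
    using x(1) that by (simp add: x0_def f_inv_into_f)
  then have ev_x: "ev G.h x g = G.h (mpoly_eval g x0)" if "g \<in> G.A" for g
    using G.h.ev_cong[OF that, of x "\<lambda>i. G.h (x0 i)"] G.h.ev_map by simp
  have "mpoly_eval g x0 = 0" if "g \<in> \<aa>" for g
  proof -
    have "g \<in> P" "g \<in> G.A" using that P(2) G.P_subset by auto
    then have "ev G.h x g = 0" using x(3) yP by blast
    then show ?thesis using ev_x[OF \<open>g \<in> G.A\<close>] by simp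
  qed
  moreover have "x0 \<in> affine_space n" by (simp add: affine_space_def x0_def)
  ultimately have "mpoly_eval f x0 = 0"
    using f by (simp add: vanishing_ideal_def zero_locus_def)
  then have "ev G.h y f = 0" using x(2) ev_x[OF fA] by simp
  then show ?thesis using yP fA by blast
qed

theorem theorem3p19:
  fixes n :: nat and \<aa> :: "('k::field) mpolynomial set"
  assumes "real_closed_field (ring_of_type_algebra :: 'k ring)"
    and "ideal \<aa> (mpoly_ring n)"
  shows "vanishing_ideal n (zero_locus n \<aa>) = real_radical (mpoly_ring n) \<aa>"
proof (intro equalityI subsetI)
  fix f assume f: "f \<in> vanishing_ideal n (zero_locus n \<aa>)"
  then have "f \<in> carrier (mpoly_ring n)" unfolding vanishing_ideal_def by blast
  then show "f \<in> real_radical (mpoly_ring n) \<aa>"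
    unfolding real_radical_def using vanishing_in_real_prime[OF assms(1) _ _ f] by blast
next
  fix f assume f: "f \<in> real_radical (mpoly_ring n) \<aa>"
  have "\<aa> \<subseteq> poly_in {..<n}"
    using ideal.axioms(1)[OF assms(2)] additive_subgroup.a_subset by fastforce
  then have sub: "\<aa> \<subseteq> {g \<in> poly_in {..<n}. mpoly_eval g x = 0}" if "x \<in> zero_locus n \<aa>" for x
    using that by (auto simp: zero_locus_def)
  \<comment> \<open>Each zero contributes its own ideal, a real prime above \<open>\<aa>\<close>, to
    the intersection.\<close>
  have "mpoly_eval f x = 0" if "x \<in> zero_locus n \<aa>" for x
    using f sub[OF that] real_prime_ideal_vanishing[of n x] assms(1)
    by (auto simp: real_radical_def real_closed_field_def)
  moreover have "f \<in> carrier (mpoly_ring n)" using f unfolding real_radical_def by blast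
  ultimately show "f \<in> vanishing_ideal n (zero_locus n \<aa>)" by (simp add: vanishing_ideal_def)
qed

end
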